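(* Let $n\ge 1$, $\alpha\in[0,2]$, $\beta=\max\{0,\alpha-1\}$, $\langle x\rangle=\sqrt{1+|x|^2}$, and let $\Lambda\ge\lambda>0$, $M,E>0$. Put $b=\frac{1}{8\Lambda}$. There is a constant $K=K(n,\Lambda,\lambda,M,E,\alpha)>0$, depending only on the listed quantities, with the following property. Let $\mathbf A(x,t)=(a^{ij}(x,t))_{i,j=1}^n$ be a real symmetric matrix-valued function on $\mathbb{R}^n\times[0,1]$ such that $$\lambda|\xi|^2\le a^{ij}(x,t)\xi_i\xi_j\le\Lambda|\xi|^2\qquad\text{for all }\xi\in\mathbb{R}^n,\ (x,t)\in\mathbb{R}^n\times[0,1],$$ and, for all $i,j$, $$|\nabla_x a^{ij}(x,t)|+|\partial_t a^{ij}(x,t)|\le M,\qquad |\nabla_x a^{ij}(x,t)|\le E\langle x\rangle^{-\beta}\qquad\text{in }\mathbb{R}^n\times[0,1],$$ and let $P=\partial_t+\partial_i\big(a^{ij}(x,t)\partial_j\big)$. Then for every $v\in C_0^\infty(\mathbb{R}^n\times(0,1))$ and every $\gamma>0$, $$\int_{\mathbb{R}^n\times(0,1)}e^{2\gamma(t^{-K}-1)-\frac{b\langle x\rangle^\alpha+K}{t}}\big(|v|^2+|\nabla v|^2\big)\,dx\,dt\le\int_{\mathbb{R}^n\times(0,1)}e^{2\gamma(t^{-K}-1)-\frac{b\langle x\rangle^\alpha+K}{t}}|Pv|^2\,dx\,dt.$$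
   Context: Summation over repeated indices is understood; $\nabla$ denotes the gradient in $x$, $\partial_i=\partial/\partial x_i$. The $a^{ij}$ are Lipschitz functions, with the derivative bounds holding almost everywhere. $C_0^\infty$ denotes smooth functions with compact support. *)

theory Defs
  imports "HOL-Analysis.Analysis"
begin

text \<open>
  Points of space-time are pairs \<open>(x, t)\<close> of type \<open>(real ^ 'n) \<times> real\<close>, and \<open>'n\<close> indexes the
  spatial coordinates.  Functions on a strip such as \<open>UNIV \<times> {0..1}\<close> are total functions that are
  only ever constrained and evaluated (up to null sets) on that strip.
\<close>

definition japanese_bracket :: "'a::real_normed_vector \<Rightarrow> real"
  where "japanese_bracket x = sqrt (1 + (norm x)\<^sup>2)"

definition partial_t :: "((real ^ 'n) \<times> real \<Rightarrow> real) \<Rightarrow> (real ^ 'n) \<times> real \<Rightarrow> real"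
  where "partial_t f z = deriv (\<lambda>s. f (fst z, s)) (snd z)"

definition partial_x :: "'n \<Rightarrow> ((real ^ 'n) \<times> real \<Rightarrow> real) \<Rightarrow> (real ^ 'n) \<times> real \<Rightarrow> real"
  where "partial_x i f z = deriv (\<lambda>h. f (fst z + h *\<^sub>R axis i 1, snd z)) 0"

definition grad_x :: "((real ^ 'n) \<times> real \<Rightarrow> real) \<Rightarrow> (real ^ 'n) \<times> real \<Rightarrow> real ^ 'n"
  where "grad_x f z = (\<chi> i. partial_x i f z)"

text \<open>
  The operator \<open>P = \<partial>\<^sub>t + \<partial>\<^sub>i (a\<^sup>i\<^sup>j \<partial>\<^sub>j)\<close>.  For Lipschitz coefficients its value on a
  smooth function is meaningful only almost everywhere; elsewhere \<^const>\<open>deriv\<close> may return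
  an arbitrary value.
\<close>

definition parabolic_op ::
  "((real ^ 'n) \<times> real \<Rightarrow> real ^ 'n ^ 'n) \<Rightarrow> ((real ^ 'n) \<times> real \<Rightarrow> real) \<Rightarrow>
   (real ^ 'n) \<times> real \<Rightarrow> real"
  where "parabolic_op A v z =
    partial_t v z + (\<Sum>i\<in>UNIV. \<Sum>j\<in>UNIV. partial_x i (\<lambda>w. A w $ i $ j * partial_x j v w) z)"

primrec Ck :: "nat \<Rightarrow> ('a::real_normed_vector \<Rightarrow> real) \<Rightarrow> bool"
  where
    "Ck 0 f \<longleftrightarrow> continuous_on UNIV f"
  | "Ck (Suc k) f \<longleftrightarrow>
       (\<forall>z. f differentiable (at z)) \<and> (\<forall>u. Ck k (\<lambda>z. frechet_derivative f (at z) u))"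

text \<open>
  \<open>C\<^sub>0\<^sup>\<infinity>(\<Omega>)\<close> for an open set \<open>\<Omega>\<close>: the functions are extended by zero to the whole space, so the
  support is the closure in the whole space and has to be contained in \<open>\<Omega>\<close>.
\<close>

definition test_function :: "'a::real_normed_vector set \<Rightarrow> ('a \<Rightarrow> real) \<Rightarrow> bool"
  where "test_function \<Omega> v \<longleftrightarrow>
    (\<forall>k. Ck k v) \<and> compact (closure {z. v z \<noteq> 0}) \<and> closure {z. v z \<noteq> 0} \<subseteq> \<Omega>"

definition carleman_weight ::
  "real \<Rightarrow> real \<Rightarrow> real \<Rightarrow> real \<Rightarrow> (real ^ 'n) \<times> real \<Rightarrow> real"
  where "carleman_weight \<alpha> b K \<gamma> z =
    exp (2 * \<gamma> * (snd z powr (- K) - 1) - (b * japanese_bracket (fst z) powr \<alpha> + K) / snd z)"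

end

theory Submission
  imports Defs
begin

text \<open>
  Put \<open>\<psi> = \<gamma> (t\<^sup>-\<^sup>K - 1) - (b\<langle>x\<rangle>\<^sup>\<alpha> + K) / (2 t)\<close> and \<open>w = e\<^sup>\<psi> v\<close>, so that the weight is \<open>e\<^sup>2\<^sup>\<psi>\<close>.
  With \<open>Y = A \<nabla>\<psi>\<close>, \<open>q = Y \<bullet> \<nabla>\<psi> - \<partial>\<^sub>t\<psi>\<close>, \<open>L = div A \<nabla>\<close> and a scalar function \<open>f\<close> one has
  \<open>e\<^sup>\<psi> P v = (L w + q w) + T + (f - L \<psi>) w\<close>, where \<open>T = \<partial>\<^sub>tw - 2 Y \<bullet> \<nabla>w - f w\<close>.  The choice \<open>f = D / t\<close>
  instead of \<open>f = L \<psi>\<close> means that \<open>L \<psi>\<close>, which contains derivatives of the Lipschitz coefficients, is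
  never differentiated.  Integrating \<open>(L w + q w) T\<close> by parts yields
  a quadratic form in \<open>(w, \<nabla>w)\<close>.  Since \<open>\<beta> \<ge> \<alpha> - 1\<close>, all its gradient terms are \<open>O(1 / t)\<close> except
  \<open>(D / t) A \<nabla>w \<bullet> \<nabla>w\<close>, which dominates for large \<open>D\<close>.  The smallness of \<open>b\<close> makes \<open>Y \<bullet> \<nabla>\<psi>\<close> at most a
  quarter of \<open>(b\<langle>x\<rangle>\<^sup>\<alpha> + K) / (2 t\<^sup>2)\<close>, so \<open>-(D / t) q\<close> controls the zero order terms without
  \<open>\<gamma>\<close>; those with \<open>\<gamma>\<close> have the right sign once \<open>K\<close> is large compared with \<open>D\<close>.

  The integration by parts only needs a weak form of Rademacher's theorem: a Lipschitz function has a
  given directional derivative almost everywhere.  If it also has compact support, that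
  derivative has integral \<open>0\<close>, as the limit of the integrals of its difference quotients.
\<close>

text \<open>The choice \<open>f = D / t\<close> has a price: \<open>(f - L \<psi>) w\<close>
  survives in \<open>P v\<close>, and its square, of size \<open>1 / t^2\<close>, must be absorbed.
  The summand \<open>K / t\<close> of the weight pays for it, since it contributes a positive
  multiple of \<open>K / t^3\<close> to the zero order coefficient. So \<open>K\<close> has two
  jobs: as an exponent it lets the second time derivative of the \<gamma> term beat
  \<open>D / t\<close> times the first one, and as an additive constant it dominates
  \<open>(f - L \<psi>)^2\<close>. The constants are therefore fixed in one direction: bounds from
  the data, then \<open>D\<close>, then \<open>K\<close>. The \<gamma> terms are used through their
  sign only, hence the uniformity in \<gamma>.

  The bound \<alpha> \<le> 2 makes the Hessian of \<open>\<langle>x\<rangle>^\<alpha>\<close>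
  bounded and the square of its gradient \<open>O(\<langle>x\<rangle>^\<alpha>)\<close>, so that the
  zero order errors without \<gamma> are at most of order
  \<open>\<langle>x\<rangle>^\<alpha> / t^3\<close> or \<open>K / t^3\<close>.

  The fluxes contain the coefficients and are merely Lipschitz. Each is differentiated along a
  single direction, so joint differentiability never enters.\<close>

subsection \<open>Differentiability of Lipschitz functions along lines\<close>

text \<open>Vitali covering: inside an open set slightly larger than \<open>E\<close>, disjoint
  short intervals of slope below \<open>p\<close> exhaust \<open>E\<close> up to a null set. By
  monotonicity the image of each lies in an interval shorter than \<open>p\<close> times its length,
  and the Lipschitz bound keeps the image of the remaining null set null.\<close>

lemma emeasure_image_le_of_small_slopes:
  fixes f :: "real \<Rightarrow> real"
  assumes mono: "strict_mono f" and lip: "L-lipschitz_on UNIV f"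
    and E: "E \<in> sets borel" and p: "0 \<le> p"
    and fine: "\<And>x d. x \<in> E \<Longrightarrow> 0 < d \<Longrightarrow> \<exists>u v. u < x \<and> x < v \<and> v - u < d \<and> f v - f u < p * (v - u)"
  shows "emeasure lebesgue (f ` E) \<le> ennreal p * emeasure lebesgue E"
proof -
  have cont: "continuous_on UNIV f"
    using lip by (rule lipschitz_on_continuous_on)
  have bound: "emeasure lebesgue (f ` E) \<le> ennreal p * (emeasure lebesgue E + ennreal e)" if e: "0 < e" for e
  proof -
    have El: "E \<in> sets lebesgue" using E by simp
    obtain G where G: "open G" "E \<subseteq> G" "G - E \<in> lmeasurable" "emeasure lebesgue (G - E) < ennreal e"
      using sets_lebesgue_outer_open[OF El e] by blast
    define K where "K = {(u, v). u < v \<and> {u..v} \<subseteq> G \<and> f v - f u < p * (v - u)}"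
    define I where "I = (\<lambda>(u::real, v::real). {u..v})"
    define a where "a = (\<lambda>(u::real, v). (u + v) / 2)"
    define r where "r = (\<lambda>(u::real, v). (v - u) / 2)"
    have cb: "cball (a i) (r i) = I i" for i
      by (cases i) (auto simp: a_def r_def I_def cball_eq_atLeastAtMost field_simps)
    obtain C where C: "countable C" "C \<subseteq> K" 
      "pairwise (\<lambda>i j. disjnt (cball (a i) (r i)) (cball (a j) (r j))) C"
      "negligible (E - (\<Union>i\<in>C. cball (a i) (r i)))"
    proof (rule Vitali_covering_theorem_cballs[of K r E a])
      show "0 < r i" if "i \<in> K" for i
        using that by (auto simp: K_def r_def)
    next
      fix x d :: real assume x: "x \<in> E" and d: "0 < d"
      obtain \<delta> where \<delta>: "\<delta> > 0" "ball x \<delta> \<subseteq> G"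
        using G(1,2) x open_contains_ball by blast
      obtain u v where uv: "u < x" "x < v" "v - u < min \<delta> d" "f v - f u < p * (v - u)"
        using fine[OF x, of "min \<delta> d"] \<delta>(1) d by auto
      have "{u..v} \<subseteq> ball x \<delta>"
        using uv by (auto simp: dist_real_def)
      hence "(u, v) \<in> K"
        using uv \<delta> by (auto simp: K_def)
      moreover have "x \<in> cball (a (u, v)) (r (u, v))"
        unfolding cb using uv by (auto simp: I_def)
      moreover have "r (u, v) < d"
        using uv by (auto simp: r_def)
      ultimately show "\<exists>i. i \<in> K \<and> x \<in> cball (a i) (r i) \<and> r i < d"
        by blast
    qed
    have disj: "disjoint_family_on I C"
      using C(3) unfolding cb by (auto simp: disjoint_family_on_def pairwise_def disjnt_def)
    have inj: "inj f" using mono by (rule strict_mono_imp_inj_on)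
    have disjf: "disjoint_family_on (\<lambda>i. f ` I i) C"
      using disj inj unfolding disjoint_family_on_def
      by (metis image_Int image_empty)
    have fI: "f ` I i \<in> sets lebesgue" for i
    proof -
      have "compact (f ` I i)"
        by (cases i) (auto simp: I_def intro!: compact_continuous_image continuous_on_subset[OF cont])
      thus ?thesis by (simp add: borel_compact)
    qed
    have n: "negligible (f ` (E - (\<Union>i\<in>C. I i)))"
    proof (rule negligible_locally_Lipschitz_image)
      show "DIM(real) \<le> DIM(real)" by simp
      show "negligible (E - \<Union> (I ` C))" using C(4) unfolding cb .
      fix x assume "x \<in> E - \<Union> (I ` C)"
      show "\<exists>T B. open T \<and> x \<in> T \<and> (\<forall>y\<in>(E - \<Union> (I ` C)) \<inter> T. norm (f y - f x) \<le> B * norm (y - x))"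
        using lip by (intro exI[of _ UNIV] exI[of _ L]) (auto simp: lipschitz_on_def dist_norm)
    qed
    have nl: "f ` (E - (\<Union>i\<in>C. I i)) \<in> sets lebesgue"
      using n by (rule negligible_imp_sets)
    have "emeasure lebesgue (f ` E) \<le> emeasure lebesgue (f ` (E - (\<Union>i\<in>C. I i)) \<union> (\<Union>i\<in>C. f ` I i))"
    proof (rule emeasure_mono)
      have "(\<Union>i\<in>C. f ` I i) \<in> sets lebesgue"
        using C(1) fI by (intro sets.countable_UN') auto
      thus "f ` (E - (\<Union>i\<in>C. I i)) \<union> (\<Union>i\<in>C. f ` I i) \<in> sets lebesgue" using nl by blast
    qed auto
    also have "\<dots> \<le> emeasure lebesgue (f ` (E - (\<Union>i\<in>C. I i))) + emeasure lebesgue (\<Union>i\<in>C. f ` I i)"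
    proof (rule emeasure_subadditive)
      show "f ` (E - (\<Union>i\<in>C. I i)) \<in> sets lebesgue" by (rule nl)
      show "(\<Union>i\<in>C. f ` I i) \<in> sets lebesgue"
        using C(1) fI by (intro sets.countable_UN') auto
    qed
    also have "emeasure lebesgue (f ` (E - (\<Union>i\<in>C. I i))) = 0"
      using n by (simp add: negligible_iff_null_sets null_sets_def)
    also have "0 + emeasure lebesgue (\<Union>i\<in>C. f ` I i) = (\<integral>\<^sup>+i. emeasure lebesgue (f ` I i) \<partial>count_space C)"
      using fI C(1) disjf by (simp add: emeasure_UN_countable)
    also have "\<dots> \<le> (\<integral>\<^sup>+i. ennreal p * emeasure lebesgue (I i) \<partial>count_space C)"
    proof (rule nn_integral_mono)
      fix i assume "i \<in> space (count_space C)"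
      then obtain u v where i: "i = (u, v)" and uv: "u < v" "f v - f u < p * (v - u)"
        using C(2) by (auto simp: K_def)
      have "f ` I i \<subseteq> {f u..f v}"
        using mono by (auto simp: i I_def strict_mono_less_eq)
      hence "emeasure lebesgue (f ` I i) \<le> emeasure lebesgue {f u..f v}"
        by (intro emeasure_mono) auto
      also have "\<dots> = ennreal (f v - f u)"
        using mono uv(1) by (simp add: strict_mono_less_eq)
      also have "\<dots> \<le> ennreal (p * (v - u))" using uv by (intro ennreal_leI) simp
      also have "\<dots> = ennreal p * emeasure lebesgue (I i)"
        using uv p by (simp add: i I_def ennreal_mult)
      finally show "emeasure lebesgue (f ` I i) \<le> ennreal p * emeasure lebesgue (I i)" .
    qed
    also have "\<dots> = ennreal p * (\<integral>\<^sup>+i. emeasure lebesgue (I i) \<partial>count_space C)"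
      by (rule nn_integral_cmult) simp
    also have "(\<integral>\<^sup>+i. emeasure lebesgue (I i) \<partial>count_space C) = emeasure lebesgue (\<Union>i\<in>C. I i)"
    proof (rule emeasure_UN_countable[symmetric, OF _ C(1) disj])
      show "\<And>i. i \<in> C \<Longrightarrow> I i \<in> sets lebesgue" by (auto simp: I_def split: prod.splits)
    qed
    also have "emeasure lebesgue (\<Union>i\<in>C. I i) \<le> emeasure lebesgue (E \<union> (G - E))"
    proof (rule emeasure_mono)
      show "(\<Union>i\<in>C. I i) \<subseteq> E \<union> (G - E)"
        using C(2) by (force simp: K_def I_def)
      show "E \<union> (G - E) \<in> sets lebesgue" using El G(3) by blast
    qed
    also have "\<dots> \<le> emeasure lebesgue E + emeasure lebesgue (G - E)"
      using El G(3) by (intro emeasure_subadditive) auto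
    also have "\<dots> \<le> emeasure lebesgue E + ennreal e"
      using G(4) by (intro add_left_mono) simp
    finally show ?thesis by (simp add: mult_left_mono)
  qed
  show ?thesis
  proof (cases "emeasure lebesgue E = \<infinity>")
    case True
    show ?thesis
    \<comment> \<open>In \<open>ennreal\<close> the product of 0 and \<infinity> is 0, so for
      \<open>p = 0\<close> the image has to be null although \<open>E\<close> has infinite
      measure.\<close>
    proof (cases "p = 0")
      case p0: True
      have "emeasure lebesgue (f ` E) \<le> 0"
        using bound[of 1] by (simp add: p0)
      thus ?thesis by simp
    next
      case False
      thus ?thesis using True p by (simp add: ennreal_mult_top)
    qed
  next
    case False
    show ?thesis
    proof (rule ennreal_le_epsilon)
      fix e :: real assume e: "0 < e"
      \<comment> \<open>The divisor \<open>p + 1\<close> also covers \<open>p = 0\<close>.\<close>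
      have "emeasure lebesgue (f ` E) \<le> ennreal p * (emeasure lebesgue E + ennreal (e / (p + 1)))"
        using e p by (intro bound) auto
      also have "\<dots> = ennreal p * emeasure lebesgue E + ennreal (p * (e / (p + 1)))"
        using e p by (subst ennreal_mult) (auto simp: distrib_left)
      also have "\<dots> \<le> ennreal p * emeasure lebesgue E + ennreal e"
        using e p by (intro add_left_mono ennreal_leI) (simp add: field_simps)
      finally show "emeasure lebesgue (f ` E) \<le> ennreal p * emeasure lebesgue E + ennreal e" .
    qed
  qed
qed

text \<open>Requiring \<open>z\<close> to lie strictly inside the segments makes this a \<open>G\<^sub>\<delta>\<close> set for continuous \<open>F\<close>.  If
  \<open>F\<close> is not differentiable along \<open>u\<close> at \<open>z\<close>, then \<open>z\<close> lies in \<open>slopes_below F u p\<close> and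
  \<open>slopes_below (-F) u (-q)\<close> for some rational numbers \<open>p < q\<close>.\<close>

definition slopes_below :: "('a::real_normed_vector \<Rightarrow> real) \<Rightarrow> 'a \<Rightarrow> real \<Rightarrow> 'a set"
  where "slopes_below F u p = {z. \<forall>d>0. \<exists>r s. r < 0 \<and> 0 < s \<and> s - r < d \<and>
    F (z + s *\<^sub>R u) - F (z + r *\<^sub>R u) < p * (s - r)}"

lemma slopes_belowD:
  assumes "z \<in> slopes_below F u p" and "0 < d"
  obtains r s where "r < 0" "0 < s" "s - r < d" "F (z + s *\<^sub>R u) - F (z + r *\<^sub>R u) < p * (s - r)"
  using assms unfolding slopes_below_def by blast

lemma borel_slopes_below:
  fixes F :: "'a::real_normed_vector \<Rightarrow> real"
  assumes "continuous_on UNIV F"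
  shows "slopes_below F u p \<in> sets borel"
proof -
  define A where "A d = (\<Union>r\<in>{..<0}. \<Union>s\<in>{s. 0 < s \<and> s - r < d}.
      {z. F (z + s *\<^sub>R u) - F (z + r *\<^sub>R u) < p * (s - r)})" for d :: real
  have "open (A d)" for d
  proof -
    have "continuous_on UNIV (\<lambda>z. F (z + s *\<^sub>R u))" for s
      by (rule continuous_on_compose2[OF assms]) (auto intro!: continuous_intros)
    thus ?thesis
      unfolding A_def by (intro open_UN ballI open_Collect_less continuous_on_diff continuous_on_const)
  qed
  moreover have "slopes_below F u p = (\<Inter>n::nat. A (1 / Suc n))"
  proof (intro equalityI subsetI)
    fix z assume z: "z \<in> slopes_below F u p"
    show "z \<in> (\<Inter>n::nat. A (1 / Suc n))"
    proof
      fix n :: nat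
      have "0 < 1 / real (Suc n)" by simp
      from slopes_belowD[OF z this] show "z \<in> A (1 / Suc n)"
        unfolding A_def by blast
    qed
  next
    fix z assume z: "z \<in> (\<Inter>n::nat. A (1 / Suc n))"
    show "z \<in> slopes_below F u p"
      unfolding slopes_below_def
    proof (intro CollectI allI impI)
      fix d :: real assume "0 < d"
      then obtain n where n: "1 / Suc n < d" using nat_approx_posE by blast
      have "z \<in> A (1 / Suc n)" using z by blast
      thus "\<exists>r s. r < 0 \<and> 0 < s \<and> s - r < d \<and> F (z + s *\<^sub>R u) - F (z + r *\<^sub>R u) < p * (s - r)"
        unfolding A_def using n less_trans by blast
    qed
  qed
  ultimately show ?thesis by auto
qed

text \<open>The covering lemma applied to \<open>f\<close> and to its inverse gives \<open>q \<bar>E\<bar> \<le> \<bar>f E\<bar> \<le> p \<bar>E\<bar>\<close>.\<close>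

lemma null_slopes_oscillate_aux:
  fixes f :: "real \<Rightarrow> real"
  assumes lo: "\<And>x y. x \<le> y \<Longrightarrow> y - x \<le> f y - f x"
    and lip: "L-lipschitz_on UNIV f" and pq: "p < q"
    and E: "E \<in> sets borel" "E \<subseteq> slopes_below f 1 p \<inter> slopes_below (\<lambda>x. - f x) 1 (- q)"
    and fin: "emeasure lebesgue E < \<infinity>"
  shows "emeasure lebesgue E = 0"
proof (cases "E = {}")
  case False
  \<comment> \<open>A point of \<open>E\<close> sees slopes below \<open>p\<close>, while every
    slope of \<open>f\<close> is at least 1. Hence \<open>1 < p < q\<close>, and dividing by
    \<open>q\<close> is legitimate.\<close>
  then obtain x0 where x0: "x0 \<in> slopes_below f 1 p" using E by blast
  obtain r s where "r < 0" "0 < s" "f (x0 + s) - f (x0 + r) < p * (s - r)"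
    by (rule slopes_belowD[OF x0 zero_less_one]) simp
  moreover from this have "1 * (s - r) \<le> f (x0 + s) - f (x0 + r)" using lo[of "x0 + r" "x0 + s"] by simp
  ultimately have "1 * (s - r) < p * (s - r)" by (meson le_less_trans)
  moreover have "0 < s - r" using \<open>r < 0\<close> \<open>0 < s\<close> by simp
  ultimately have p1: "1 < p" using mult_less_cancel_right_pos by blast
  have mono: "strict_mono f"
  proof (rule strict_monoI)
    show "f x < f y" if "x < y" for x y using lo[of x y] that by simp
  qed
  have cont: "continuous_on UNIV f"
    using lip by (rule lipschitz_on_continuous_on)
  have surj: "\<exists>x. f x = y" for y
  proof -
    define m where "m = \<bar>y - f 0\<bar>"
    have "f (- m) \<le> y" "y \<le> f m"
      using lo[of "-m" 0] lo[of 0 m] by (auto simp: m_def)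
    thus ?thesis
      using IVT'[of f "-m" y m] continuous_on_subset[OF cont] by (auto simp: m_def)
  qed
  define g where "g = inv f"
  have inj: "inj f" using mono by (rule strict_mono_imp_inj_on)
  have gf [simp]: "g (f x) = x" for x using inj by (simp add: g_def)
  have fg [simp]: "f (g y) = y" for y
    using surj[of y] by auto
  have gmono: "strict_mono g"
  proof (rule strict_monoI)
    show "g x < g y" if "x < y" for x y
      using that strict_mono_less[OF mono, of "g x" "g y"] by simp
  qed
  have glip: "1-lipschitz_on UNIV g"
  proof (rule lipschitz_onI)
    fix x y
    show "dist (g x) (g y) \<le> 1 * dist x y"
      using lo[of "g x" "g y"] lo[of "g y" "g x"] by (cases "g x \<le> g y") (auto simp: dist_real_def)
  qed simp
  have gcont: "continuous_on UNIV g"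
    using glip by (rule lipschitz_on_continuous_on)
  have fE: "f ` E = g -` E" 
  proof (intro equalityI subsetI)
    show "y \<in> f ` E" if "y \<in> g -` E" for y
      using that imageI[of "g y" E f] by simp
  qed auto
  have fEb: "f ` E \<in> sets borel"
    unfolding fE using measurable_sets[OF borel_measurable_continuous_onI[OF gcont] E(1)] by simp
  have 1: "emeasure lebesgue (f ` E) \<le> ennreal p * emeasure lebesgue E"
  proof (rule emeasure_image_le_of_small_slopes[OF mono lip E(1)])
    show "0 \<le> p" using p1 by simp
    fix x d :: real assume x: "x \<in> E" and d: "0 < d"
    have "x \<in> slopes_below f 1 p" using x E(2) by blast
    from slopes_belowD[OF this d]
    obtain r s where "r < 0" "0 < s" "s - r < d" "f (x + s) - f (x + r) < p * (s - r)"
      by auto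
    thus "\<exists>u v. u < x \<and> x < v \<and> v - u < d \<and> f v - f u < p * (v - u)"
      by (intro exI[of _ "x + r"] exI[of _ "x + s"]) auto
  qed
  have 2: "emeasure lebesgue (g ` (f ` E)) \<le> ennreal (1 / q) * emeasure lebesgue (f ` E)"
  proof (rule emeasure_image_le_of_small_slopes[OF gmono glip fEb])
    show "0 \<le> 1 / q" using p1 pq by simp
    fix y d :: real assume "y \<in> f ` E" and d: "0 < d"
    then obtain x where x: "x \<in> E" "y = f x" by blast
    \<comment> \<open>The covering lemma for \<open>g\<close> wants short intervals around
      \<open>f x\<close>; the image of an interval shorter than \<open>d / (L + 1)\<close> is
      shorter than \<open>d\<close>.\<close>
    have d': "0 < d / (L + 1)" using d lipschitz_on_nonneg[OF lip] by simp
    have "x \<in> slopes_below (\<lambda>x. - f x) 1 (- q)" using x E(2) by blast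
    from slopes_belowD[OF this d']
    obtain r s where rs: "r < 0" "0 < s" "s - r < d / (L + 1)" "- f (x + s) + f (x + r) < - q * (s - r)"
      by auto
    have "f (x + s) - f (x + r) \<le> L * (s - r)"
      using lipschitz_onD[OF lip, of "x + s" "x + r"] rs by (auto simp: dist_real_def)
    also have "\<dots> \<le> (L + 1) * (s - r)" using rs by (intro mult_right_mono) auto
    also have "\<dots> < d" using rs lipschitz_on_nonneg[OF lip] by (simp add: field_simps)
    finally have 1: "f (x + s) - f (x + r) < d" .
    have 2: "s - r < 1 / q * (f (x + s) - f (x + r))" using rs p1 pq by (simp add: field_simps)
    show "\<exists>u v. u < y \<and> y < v \<and> v - u < d \<and> g v - g u < 1 / q * (v - u)"
      using rs 1 2 x mono by (intro exI[of _ "f (x + r)"] exI[of _ "f (x + s)"]) (auto simp: strict_mono_less)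
  qed
  have "g ` (f ` E) = E" by (simp add: image_image)
  hence "emeasure lebesgue E \<le> ennreal (1 / q) * emeasure lebesgue (f ` E)" using 2 by simp
  also have "\<dots> \<le> ennreal (1 / q) * (ennreal p * emeasure lebesgue E)"
    by (intro mult_left_mono 1) simp
  finally have le: "emeasure lebesgue E \<le> ennreal (1 / q) * (ennreal p * emeasure lebesgue E)" .
  \<comment> \<open>Finite measure is what lets \<open>q m \<le> p m\<close> with
    \<open>p < q\<close> force \<open>m = 0\<close>.\<close>
  obtain m where m: "emeasure lebesgue E = ennreal m" "0 \<le> m"
    using fin by (cases "emeasure lebesgue E") auto
  have "ennreal m \<le> ennreal (1 / q * (p * m))"
    using le m p1 pq by (simp add: ennreal_mult del: times_divide_eq_left)
  hence "m \<le> 1 / q * (p * m)" using m p1 pq by (subst (asm) ennreal_le_iff) auto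
  hence "q * m \<le> p * m" using p1 pq by (simp add: field_simps)
  moreover have "p * m < q * m" if "m \<noteq> 0" using that pq m(2) by simp
  ultimately have "m = 0" by linarith
  thus ?thesis using m by simp
qed simp

text \<open>Adding \<open>(L + 1) x\<close> raises every slope by \<open>L + 1\<close>, so that all
  slopes become at least 1 and the function has a 1-Lipschitz inverse; both thresholds move along.
  Bounded intervals supply the finite measure.\<close>

lemma null_slopes_oscillate:
  fixes F :: "real \<Rightarrow> real"
  assumes lip: "L-lipschitz_on UNIV F" and pq: "p < q"
  shows "slopes_below F 1 p \<inter> slopes_below (\<lambda>x. - F x) 1 (- q) \<in> null_sets lborel"
proof -
  define f where "f x = F x + (L + 1) * x" for x
  define N where "N = slopes_below F 1 p \<inter> slopes_below (\<lambda>x. - F x) 1 (- q)"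
  have cont: "continuous_on UNIV F"
    using lip by (rule lipschitz_on_continuous_on)
  have N: "N \<in> sets borel"
    unfolding N_def by (intro sets.Int borel_slopes_below continuous_intros cont)
  have lipf: "(L + \<bar>L + 1\<bar>)-lipschitz_on UNIV f"
    unfolding f_def by (intro lipschitz_on_add lip lipschitz_on_cmult_real[where C=1, simplified] lipschitz_on_id)
  have lo: "y - x \<le> f y - f x" if "x \<le> y" for x y
    using lipschitz_onD[OF lip, of x y] that by (auto simp: f_def dist_real_def algebra_simps abs_le_iff)
  have Nf: "N \<subseteq> slopes_below f 1 (p + L + 1) \<inter> slopes_below (\<lambda>x. - f x) 1 (- (q + L + 1))"
    unfolding N_def slopes_below_def f_def
    by (auto simp: algebra_simps)
  have "emeasure lebesgue (N \<inter> {- real n..real n}) = 0" for n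
  proof (rule null_slopes_oscillate_aux[OF lo lipf])
    show "p + L + 1 < q + L + 1" using pq by simp
    show "N \<inter> {- real n..real n} \<in> sets borel" using N by simp
    show "N \<inter> {- real n..real n} \<subseteq> slopes_below f 1 (p + L + 1) \<inter> slopes_below (\<lambda>x. - f x) 1 (- (q + L + 1))"
      using Nf by blast
    have "emeasure lebesgue (N \<inter> {- real n..real n}) \<le> emeasure lebesgue {- real n..real n}"
      by (intro emeasure_mono) auto
    also have "\<dots> < \<infinity>" by simp
    finally show "emeasure lebesgue (N \<inter> {- real n..real n}) < \<infinity>" .
  qed auto
  hence "N \<inter> {- real n..real n} \<in> null_sets lborel" for n
    using N by (intro null_setsI) auto
  hence "(\<Union>n. N \<inter> {- real n..real n}) \<in> null_sets lborel"
    by (intro null_sets_UN) auto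
  moreover have "(\<Union>n. N \<inter> {- real n..real n}) = N"
  proof -
    have "\<exists>n. x \<in> {- real n..real n}" for x
      using real_arch_simple[of "\<bar>x\<bar>"] by (auto simp: abs_le_iff) (metis minus_le_iff)
    thus ?thesis by blast
  qed
  ultimately show ?thesis unfolding N_def by simp
qed

text \<open>Liminf and Limsup are compared in \<open>ereal\<close>: a gap leaves room for two
  rationals, and without a gap the bound \<open>C\<close> keeps the common value finite.\<close>

lemma convergent_or_oscillates:
  fixes s :: "'b \<Rightarrow> real"
  assumes F: "F \<noteq> bot" and bd: "\<forall>\<^sub>F h in F. \<bar>s h\<bar> \<le> C"
  shows "(\<exists>l. (s \<longlongrightarrow> l) F) \<or>
    (\<exists>p\<in>\<rat>. \<exists>q\<in>\<rat>. p < q \<and> (\<exists>\<^sub>F h in F. s h < p) \<and> (\<exists>\<^sub>F h in F. q < s h))"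
proof (cases "Liminf F (\<lambda>h. ereal (s h)) = Limsup F (\<lambda>h. ereal (s h))")
  case True
  then obtain l where l: "((\<lambda>h. ereal (s h)) \<longlongrightarrow> l) F"
    using F by (metis tendsto_iff_Liminf_eq_Limsup)
  have "l \<le> ereal C"
    by (rule tendsto_upperbound[OF l _ F]) (use bd in eventually_elim, auto)
  moreover have "ereal (- C) \<le> l"
    by (rule tendsto_lowerbound[OF l _ F]) (use bd in eventually_elim, auto)
  ultimately obtain l' where "l = ereal l'" by (cases l) auto
  thus ?thesis using l by auto
next
  case False
  hence "Liminf F (\<lambda>h. ereal (s h)) < Limsup F (\<lambda>h. ereal (s h))"
    using Liminf_le_Limsup[OF F] by (simp add: order_less_le)
  then obtain a b :: real where ab: "Liminf F (\<lambda>h. ereal (s h)) < ereal a" "ereal a < ereal b"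
      "ereal b < Limsup F (\<lambda>h. ereal (s h))"
    by (metis ereal_dense2)
  then obtain p q :: real where pq: "p \<in> \<rat>" "q \<in> \<rat>" "a < p" "p < q" "q < b"
    by (metis Rats_dense_in_real less_ereal.simps(1))
  have "\<exists>\<^sub>F h in F. s h < p"
  proof (rule ccontr)
    assume "\<not> ?thesis"
    hence "\<forall>\<^sub>F h in F. ereal p \<le> ereal (s h)" by (simp add: not_frequently not_less)
    hence "ereal p \<le> Liminf F (\<lambda>h. ereal (s h))" by (rule Liminf_bounded)
    also have "\<dots> < ereal a" by (rule ab)
    finally show False using pq by simp
  qed
  moreover have "\<exists>\<^sub>F h in F. q < s h"
  proof (rule ccontr)
    assume "\<not> ?thesis"
    hence "\<forall>\<^sub>F h in F. ereal (s h) \<le> ereal q" by (simp add: not_frequently not_less)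
    hence "Limsup F (\<lambda>h. ereal (s h)) \<le> ereal q" by (rule Limsup_bounded)
    hence "ereal b < ereal q" using ab(3) by (rule less_le_trans[rotated])
    thus False using pq by simp
  qed
  ultimately show ?thesis using pq by blast
qed

text \<open>The chords in the hypothesis have \<open>z\<close> as an endpoint. Lengthening one by a
  small \<open>e\<close> at both ends puts \<open>z\<close> strictly inside, and continuity
  preserves the strict inequality. In \<open>G\<close>, \<open>max\<close> and \<open>min\<close>
  treat both signs of \<open>h\<close> at once.\<close>

lemma slopes_belowI:
  fixes F :: "'a::real_normed_vector \<Rightarrow> real"
  assumes cont: "continuous_on UNIV F"
    and freq: "\<exists>\<^sub>F h in at 0. (F (z + h *\<^sub>R u) - F z) / h < p"
  shows "z \<in> slopes_below F u p"
  unfolding slopes_below_def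
proof (intro CollectI allI impI)
  fix d :: real assume d: "0 < d"
  obtain h where h: "h \<noteq> 0" "\<bar>h\<bar> < d" and slope: "(F (z + h *\<^sub>R u) - F z) / h < p"
  proof -
    have "\<forall>\<^sub>F h in at (0::real). h \<noteq> 0 \<and> \<bar>h\<bar> < d"
      unfolding eventually_at using d by (intro exI[of _ d]) auto
    with freq have "\<exists>\<^sub>F h in at 0. (F (z + h *\<^sub>R u) - F z) / h < p \<and> h \<noteq> 0 \<and> \<bar>h\<bar> < d"
      by (rule frequently_eventually_frequently)
    thus ?thesis using that frequently_ex by blast
  qed
  define G where "G e = F (z + (max h 0 + e) *\<^sub>R u) - F (z + (min h 0 - e) *\<^sub>R u) - p * (max h 0 - min h 0 + 2 * e)" for e
  have G0: "G 0 < 0"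
    using slope h(1) by (cases "0 < h") (auto simp: G_def field_simps)
  have "continuous_on UNIV G"
    unfolding G_def by (intro continuous_intros continuous_on_compose2[OF cont]) auto
  hence "(G \<longlongrightarrow> G 0) (at_right 0)"
    by (metis UNIV_I continuous_on_def filterlim_at_split tendsto_within_subset top_greatest)
  hence "\<forall>\<^sub>F e in at_right 0. G e < 0" using G0 by (rule order_tendstoD)
  moreover have "\<forall>\<^sub>F e in at_right 0. e \<in> {0<..<(d - \<bar>h\<bar>) / 2}"
    using h(2) by (intro eventually_at_right_real) auto
  ultimately have "\<forall>\<^sub>F e in at_right 0. G e < 0 \<and> e < (d - \<bar>h\<bar>) / 2 \<and> 0 < e"
    by eventually_elim simp
  hence "\<exists>e. G e < 0 \<and> e < (d - \<bar>h\<bar>) / 2 \<and> 0 < e"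
    by (rule eventually_happens'[OF trivial_limit_at_right_real])
  then obtain e where e: "G e < 0" "e < (d - \<bar>h\<bar>) / 2" "0 < e" by blast
  show "\<exists>r s. r < 0 \<and> 0 < s \<and> s - r < d \<and> F (z + s *\<^sub>R u) - F (z + r *\<^sub>R u) < p * (s - r)"
  proof (intro exI conjI)
    show "min h 0 - e < 0" "0 < max h 0 + e" "max h 0 + e - (min h 0 - e) < d"
      using e(2,3) by (auto simp: min_def max_def field_simps)
    have eq: "max h 0 + e - (min h 0 - e) = max h 0 - min h 0 + 2 * e" by simp
    show "F (z + (max h 0 + e) *\<^sub>R u) - F (z + (min h 0 - e) *\<^sub>R u) < p * (max h 0 + e - (min h 0 - e))"
      unfolding eq using e(1) by (simp add: G_def)
  qed
qed

text \<open>A derivative along one line only. For a Lipschitz coefficient the exceptional null set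
  is found separately for each direction, and sum, product and chain rules already hold at this
  level.\<close>

definition has_dderiv :: "('a::real_normed_vector \<Rightarrow> real) \<Rightarrow> 'a \<Rightarrow> 'a \<Rightarrow> real \<Rightarrow> bool"
  where "has_dderiv F u z D \<longleftrightarrow> ((\<lambda>h. F (z + h *\<^sub>R u)) has_real_derivative D) (at 0)"

lemma has_dderiv_or_oscillates:
  fixes F :: "'a::real_normed_vector \<Rightarrow> real"
  assumes lip: "L-lipschitz_on UNIV F" and z: "\<nexists>D. has_dderiv F u z D"
  shows "\<exists>p\<in>\<rat>. \<exists>q\<in>\<rat>. p < q \<and> z \<in> slopes_below F u p \<inter> slopes_below (\<lambda>x. - F x) u (- q)"
proof -
  have cont: "continuous_on UNIV F"
    using lip by (rule lipschitz_on_continuous_on)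
  define s where "s h = (F (z + h *\<^sub>R u) - F z) / h" for h
  have "\<bar>s h\<bar> \<le> L * norm u" if "h \<noteq> 0" for h
    using lipschitz_onD[OF lip, of "z + h *\<^sub>R u" z] that
    by (auto simp: s_def dist_norm field_simps abs_mult)
  hence "\<forall>\<^sub>F h in at 0. \<bar>s h\<bar> \<le> L * norm u"
    by (auto simp: eventually_at_filter)
  from convergent_or_oscillates[OF _ this]
  consider l where "(s \<longlongrightarrow> l) (at 0)"
    | p q where "p \<in> \<rat>" "q \<in> \<rat>" "p < q" "\<exists>\<^sub>F h in at 0. s h < p" "\<exists>\<^sub>F h in at 0. q < s h"
    by (auto simp: trivial_limit_at)
  thus ?thesis
  proof cases
    case 1
    hence "has_dderiv F u z l"
      by (simp add: has_dderiv_def has_field_derivative_iff s_def[abs_def])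
    thus ?thesis using z by blast
  next
    case 2
    have "z \<in> slopes_below F u p"
      using 2(4) by (intro slopes_belowI[OF cont]) (simp add: s_def)
    moreover have "z \<in> slopes_below (\<lambda>x. - F x) u (- q)"
    proof (rule slopes_belowI)
      have "(- F (z + h *\<^sub>R u) - - F z) / h = - s h" for h
        by (simp add: s_def minus_divide_left)
      thus "\<exists>\<^sub>F h in at 0. (- F (z + h *\<^sub>R u) - - F z) / h < - q"
        using 2(5) by simp
    qed (intro continuous_intros cont)
    ultimately show ?thesis using 2 by blast
  qed
qed

text \<open>All translates of \<open>N\<close> have the same measure, so Tonelli's theorem for the translates along \<open>h u\<close>
  with \<open>0 \<le> h \<le> 1\<close> also covers directions that are not coordinate directions.\<close>

lemma null_sets_of_null_lines:
  fixes N :: "'a::euclidean_space set"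
  assumes N: "N \<in> sets borel" and lines: "\<And>z. {h. z + h *\<^sub>R u \<in> N} \<in> null_sets lborel"
  shows "N \<in> null_sets lborel"
proof -
  let ?f = "\<lambda>z h. indicator N (z + h *\<^sub>R u) * indicator {0..1::real} h :: ennreal"
  have [measurable]: "(\<lambda>(z, h). ?f z h) \<in> borel_measurable (lborel \<Otimes>\<^sub>M lborel)"
    using N by measurable
  have shift: "(\<integral>\<^sup>+z. indicator N (z + c) \<partial>lborel) = emeasure lborel N" for c :: 'a
  proof -
    have "emeasure lborel N = (\<integral>\<^sup>+z. indicator N z \<partial>distr lborel borel ((+) c))"
      using N by (simp add: lborel_distr_plus)
    also have "\<dots> = (\<integral>\<^sup>+z. indicator N (c + z) \<partial>lborel)"
      using N by (intro nn_integral_distr) auto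
    finally show ?thesis by (simp add: add.commute)
  qed
  have "emeasure lborel N = (\<integral>\<^sup>+h. emeasure lborel N * indicator {0..1::real} h \<partial>lborel)"
    by (simp add: nn_integral_cmult)
  also have "\<dots> = (\<integral>\<^sup>+h. (\<integral>\<^sup>+z. ?f z h \<partial>lborel) \<partial>lborel)"
    using N by (intro nn_integral_cong) (simp add: nn_integral_multc shift)
  also have "\<dots> = (\<integral>\<^sup>+z. (\<integral>\<^sup>+h. ?f z h \<partial>lborel) \<partial>lborel)"
    by (rule lborel_pair.Fubini') measurable
  also have "\<dots> = (\<integral>\<^sup>+z. 0 \<partial>(lborel :: 'a measure))"
  proof (rule nn_integral_cong)
    fix z :: 'a
    have "AE h in lborel. h \<notin> {h. z + h *\<^sub>R u \<in> N}"
      using lines[of z] by (rule AE_not_in)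
    hence "AE h in lborel. ?f z h = 0" by eventually_elim simp
    thus "(\<integral>\<^sup>+h. ?f z h \<partial>lborel) = 0"
      using N by (subst nn_integral_0_iff_AE) auto
  qed
  finally show ?thesis using N by (intro null_setsI) auto
qed

theorem lipschitz_imp_AE_has_dderiv:
  fixes F :: "'a::euclidean_space \<Rightarrow> real"
  assumes lip: "L-lipschitz_on UNIV F"
  shows "AE z in lborel. \<exists>D. has_dderiv F u z D"
proof -
  have cont: "continuous_on UNIV F"
    using lip by (rule lipschitz_on_continuous_on)
  define B where "B p q = slopes_below F u p \<inter> slopes_below (\<lambda>x. - F x) u (- q)" for p q
  have "B p q \<in> null_sets lborel" if "p < q" for p q
  proof (rule null_sets_of_null_lines)
    show "B p q \<in> sets borel"
      unfolding B_def by (intro sets.Int borel_slopes_below continuous_intros cont)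
    fix z
    have "(L * norm u)-lipschitz_on UNIV (\<lambda>h. F (z + h *\<^sub>R u))"
    proof (rule lipschitz_onI)
      show "0 \<le> L * norm u" using lipschitz_on_nonneg[OF lip] by simp
      fix x y
      show "dist (F (z + x *\<^sub>R u)) (F (z + y *\<^sub>R u)) \<le> L * norm u * dist x y"
        using lipschitz_onD[OF lip, of "z + x *\<^sub>R u" "z + y *\<^sub>R u"]
        by (simp add: dist_norm scaleR_diff_left[symmetric] mult_ac)
    qed
    from null_slopes_oscillate[OF this that]
    show "{h. z + h *\<^sub>R u \<in> B p q} \<in> null_sets lborel"
      by (simp add: B_def slopes_below_def Int_def scaleR_add_left add.assoc)
  qed
  \<comment> \<open>Rational thresholds keep the union countable.\<close>
  hence "(\<Union>p\<in>\<rat>. \<Union>q\<in>\<rat> \<inter> {p<..}. B p q) \<in> null_sets lborel"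
    by (intro null_sets_UN' countable_Int1 countable_rat) auto
  hence "AE z in lborel. z \<notin> (\<Union>p\<in>\<rat>. \<Union>q\<in>\<rat> \<inter> {p<..}. B p q)"
    by (rule AE_not_in)
  thus ?thesis
  proof eventually_elim
    case (elim z)
    thus ?case using has_dderiv_or_oscillates[OF lip, of u z] unfolding B_def by blast
  qed
qed

subsection \<open>Directional derivatives\<close>

lemma has_dderiv_add:
  "has_dderiv F u z D \<Longrightarrow> has_dderiv G u z D' \<Longrightarrow> has_dderiv (\<lambda>w. F w + G w) u z (D + D')"
  unfolding has_dderiv_def by (rule DERIV_add)

lemma has_dderiv_diff:
  "has_dderiv F u z D \<Longrightarrow> has_dderiv G u z D' \<Longrightarrow> has_dderiv (\<lambda>w. F w - G w) u z (D - D')"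
  unfolding has_dderiv_def by (rule DERIV_diff)

lemma has_dderiv_minus:
  "has_dderiv F u z D \<Longrightarrow> has_dderiv (\<lambda>w. - F w) u z (- D)"
  unfolding has_dderiv_def by (rule DERIV_minus)

lemma has_dderiv_const: "has_dderiv (\<lambda>w. c) u z 0"
  unfolding has_dderiv_def by simp

lemma has_dderiv_mult:
  "has_dderiv F u z D \<Longrightarrow> has_dderiv G u z D' \<Longrightarrow>
    has_dderiv (\<lambda>w. F w * G w) u z (D * G z + F z * D')"
  unfolding has_dderiv_def using DERIV_mult by (fastforce simp: mult.commute)

lemma has_dderiv_sum:
  "(\<And>i. i \<in> I \<Longrightarrow> has_dderiv (F i) u z (D i)) \<Longrightarrow>
    has_dderiv (\<lambda>w. \<Sum>i\<in>I. F i w) u z (\<Sum>i\<in>I. D i)"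
  unfolding has_dderiv_def by (rule DERIV_sum) auto

lemma has_dderiv_chain:
  assumes "(g has_real_derivative D') (at (F z))" and "has_dderiv F u z D"
  shows "has_dderiv (\<lambda>w. g (F w)) u z (D' * D)"
  unfolding has_dderiv_def
  by (rule DERIV_chain2[of g D' "\<lambda>h. F (z + h *\<^sub>R u)"]) (use assms in \<open>auto simp: has_dderiv_def\<close>)

lemma has_dderiv_eq_rhs: "has_dderiv F u z D \<Longrightarrow> D = D' \<Longrightarrow> has_dderiv F u z D'"
  by simp

lemma has_dderiv_unique: "has_dderiv F u z D \<Longrightarrow> has_dderiv F u z D' \<Longrightarrow> D = D'"
  unfolding has_dderiv_def by (rule DERIV_unique)

lemma has_derivative_imp_has_dderiv:
  assumes "(F has_derivative F') (at z)"
  shows "has_dderiv F u z (F' u)"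
proof -
  have 1: "((\<lambda>h. z + h *\<^sub>R u) has_derivative (\<lambda>h. h *\<^sub>R u)) (at 0)"
    by (auto intro!: derivative_eq_intros)
  have "((\<lambda>h. F (z + h *\<^sub>R u)) has_derivative (\<lambda>h. F' (h *\<^sub>R u))) (at 0)"
    by (rule has_derivative_compose[OF 1]) (use assms in simp)
  moreover have "(\<lambda>h. F' (h *\<^sub>R u)) = (\<lambda>h. F' u * h)"
    using assms by (simp add: has_derivative_def linear_scale bounded_linear.linear mult.commute)
  ultimately show ?thesis by (simp add: has_dderiv_def has_field_derivative_def)
qed

lemma has_dderiv_cong_open:
  fixes F G :: "'a::real_normed_vector \<Rightarrow> real"
  assumes "open S" "z \<in> S" and eq: "\<And>w. w \<in> S \<Longrightarrow> F w = G w"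
  shows "has_dderiv F u z D \<longleftrightarrow> has_dderiv G u z D"
  unfolding has_dderiv_def
proof (rule DERIV_cong_ev)
  have "((\<lambda>h. z + h *\<^sub>R u) \<longlongrightarrow> z + 0 *\<^sub>R u) (nhds 0)"
    by (intro tendsto_intros) (simp add: filterlim_ident)
  hence "\<forall>\<^sub>F h in nhds 0. z + h *\<^sub>R u \<in> S"
    using assms(1,2) by (auto intro: topological_tendstoD)
  thus "\<forall>\<^sub>F h in nhds 0. F (z + h *\<^sub>R u) = G (z + h *\<^sub>R u)"
    by eventually_elim (rule eq)
qed auto

lemma has_dderiv_at_line:
  "has_dderiv F u (z + h *\<^sub>R u) D \<longleftrightarrow> ((\<lambda>h. F (z + h *\<^sub>R u)) has_real_derivative D) (at h)"
  unfolding has_dderiv_def DERIV_shift[of _ D h]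
    using DERIV_shift[of "\<lambda>h. F (z + h *\<^sub>R u)" D 0 h] by (simp add: algebra_simps)

section \<open>Symmetry of mixed second derivatives\<close>

lemma second_dderiv_mean_value:
  assumes u: "\<And>z. has_dderiv f u z (fu z)" and v: "\<And>z. has_dderiv fu v z (fuv z)" and h: "0 < h"
  obtains \<xi> \<eta> where "0 < \<xi>" "\<xi> < h" "0 < \<eta>" "\<eta> < h"
    "f (z + h *\<^sub>R u + h *\<^sub>R v) - f (z + h *\<^sub>R u) - f (z + h *\<^sub>R v) + f z = h * h * fuv (z + \<xi> *\<^sub>R u + \<eta> *\<^sub>R v)"
proof -
  define g where "g s = f (z + h *\<^sub>R v + s *\<^sub>R u) - f (z + s *\<^sub>R u)" for s
  have "(g has_real_derivative fu (z + h *\<^sub>R v + s *\<^sub>R u) - fu (z + s *\<^sub>R u)) (at s)" for s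
    unfolding g_def using u by (intro DERIV_diff) (simp_all add: has_dderiv_at_line[symmetric])
  from MVT2[OF h this] obtain \<xi> where \<xi>: "0 < \<xi>" "\<xi> < h"
    "g h - g 0 = (h - 0) * (fu (z + h *\<^sub>R v + \<xi> *\<^sub>R u) - fu (z + \<xi> *\<^sub>R u))" by blast
  have "((\<lambda>s. fu (z + \<xi> *\<^sub>R u + s *\<^sub>R v)) has_real_derivative fuv (z + \<xi> *\<^sub>R u + s *\<^sub>R v)) (at s)" for s
    using v by (simp add: has_dderiv_at_line[symmetric])
  from MVT2[OF h this] obtain \<eta> where "0 < \<eta>" "\<eta> < h"
    "fu (z + \<xi> *\<^sub>R u + h *\<^sub>R v) - fu (z + \<xi> *\<^sub>R u + 0 *\<^sub>R v) = (h - 0) * fuv (z + \<xi> *\<^sub>R u + \<eta> *\<^sub>R v)" by blast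
  with \<xi> show ?thesis by (intro that[of \<xi> \<eta>]) (auto simp: g_def algebra_simps)
qed

text \<open>The second difference over the parallelogram spanned by \<open>h u\<close> and
  \<open>h v\<close> is symmetric in \<open>u\<close> and \<open>v\<close>. The mean value theorem
  in either order writes it as \<open>h^2\<close> times a nearby value of \<open>fuv\<close> or of
  \<open>fvu\<close>; continuity at \<open>z\<close> identifies the limits for
  \<open>h = 1 / (n + 1)\<close>.\<close>

lemma second_dderiv_commute:
  assumes u: "\<And>z. has_dderiv f u z (fu z)" and uv: "\<And>z. has_dderiv fu v z (fuv z)"
    and v: "\<And>z. has_dderiv f v z (fv z)" and vu: "\<And>z. has_dderiv fv u z (fvu z)"
    and cuv: "isCont fuv z" and cvu: "isCont fvu z"
  shows "fuv z = fvu z"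
proof -
  have "\<exists>\<xi> \<eta> \<xi>' \<eta>'. \<bar>\<xi>\<bar> \<le> h \<and> \<bar>\<eta>\<bar> \<le> h \<and> \<bar>\<xi>'\<bar> \<le> h \<and> \<bar>\<eta>'\<bar> \<le> h \<and>
      fuv (z + \<xi> *\<^sub>R u + \<eta> *\<^sub>R v) = fvu (z + \<xi>' *\<^sub>R v + \<eta>' *\<^sub>R u)" if h: "0 < h" for h
  proof -
    from second_dderiv_mean_value[OF u uv h, of z] obtain \<xi> \<eta> where 1: "0 < \<xi>" "\<xi> < h" "0 < \<eta>" "\<eta> < h"
      "f (z + h *\<^sub>R u + h *\<^sub>R v) - f (z + h *\<^sub>R u) - f (z + h *\<^sub>R v) + f z = h * h * fuv (z + \<xi> *\<^sub>R u + \<eta> *\<^sub>R v)" .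
    from second_dderiv_mean_value[OF v vu h, of z] obtain \<xi>' \<eta>' where 2: "0 < \<xi>'" "\<xi>' < h" "0 < \<eta>'" "\<eta>' < h"
      "f (z + h *\<^sub>R v + h *\<^sub>R u) - f (z + h *\<^sub>R v) - f (z + h *\<^sub>R u) + f z = h * h * fvu (z + \<xi>' *\<^sub>R v + \<eta>' *\<^sub>R u)" .
    have "h * h * fuv (z + \<xi> *\<^sub>R u + \<eta> *\<^sub>R v) = h * h * fvu (z + \<xi>' *\<^sub>R v + \<eta>' *\<^sub>R u)"
      unfolding 1(5)[symmetric] 2(5)[symmetric] by (simp add: add_ac)
    hence "fuv (z + \<xi> *\<^sub>R u + \<eta> *\<^sub>R v) = fvu (z + \<xi>' *\<^sub>R v + \<eta>' *\<^sub>R u)" using h by simp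
    thus ?thesis using 1 2
      by (intro exI[of _ \<xi>] exI[of _ \<eta>] exI[of _ \<xi>'] exI[of _ \<eta>']) auto
  qed
  hence "\<exists>\<xi> \<eta> \<xi>' \<eta>'. \<bar>\<xi>\<bar> \<le> 1 / Suc n \<and> \<bar>\<eta>\<bar> \<le> 1 / Suc n \<and> \<bar>\<xi>'\<bar> \<le> 1 / Suc n \<and> \<bar>\<eta>'\<bar> \<le> 1 / Suc n \<and>
      fuv (z + \<xi> *\<^sub>R u + \<eta> *\<^sub>R v) = fvu (z + \<xi>' *\<^sub>R v + \<eta>' *\<^sub>R u)" for n
    by simp
  then obtain \<xi> \<eta> \<xi>' \<eta>' where b: "\<And>n. \<bar>\<xi> n\<bar> \<le> 1 / Suc n" "\<And>n. \<bar>\<eta> n\<bar> \<le> 1 / Suc n"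
      "\<And>n. \<bar>\<xi>' n\<bar> \<le> 1 / Suc n" "\<And>n. \<bar>\<eta>' n\<bar> \<le> 1 / Suc n"
      and eq: "\<And>n. fuv (z + \<xi> n *\<^sub>R u + \<eta> n *\<^sub>R v) = fvu (z + \<xi>' n *\<^sub>R v + \<eta>' n *\<^sub>R u)"
    by metis
  have lim0: "a \<longlonglongrightarrow> 0" if "\<And>n. \<bar>a n\<bar> \<le> 1 / Suc n" for a :: "nat \<Rightarrow> real"
    by (rule Lim_null_comparison[OF _ LIMSEQ_Suc[OF lim_1_over_n]]) (use that in auto)
  have "(\<lambda>n. z + \<xi> n *\<^sub>R u + \<eta> n *\<^sub>R v) \<longlonglongrightarrow> z + 0 *\<^sub>R u + 0 *\<^sub>R v"
    by (intro tendsto_intros lim0 b)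
  hence "(\<lambda>n. fuv (z + \<xi> n *\<^sub>R u + \<eta> n *\<^sub>R v)) \<longlonglongrightarrow> fuv z"
    using isCont_tendsto_compose[OF cuv] by simp
  moreover have "(\<lambda>n. z + \<xi>' n *\<^sub>R v + \<eta>' n *\<^sub>R u) \<longlonglongrightarrow> z + 0 *\<^sub>R v + 0 *\<^sub>R u"
    by (intro tendsto_intros lim0 b)
  hence "(\<lambda>n. fvu (z + \<xi>' n *\<^sub>R v + \<eta>' n *\<^sub>R u)) \<longlonglongrightarrow> fvu z"
    using isCont_tendsto_compose[OF cvu] by simp
  ultimately show ?thesis using eq LIMSEQ_unique by simp
qed

subsection \<open>Lipschitz functions with compact support\<close>

text \<open>The fluxes have Lipschitz constants only on a set that stays away from
  \<open>t = 0\<close>, whereas difference quotients are integrated over the whole space. Points of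
  \<open>S\<close> and points outside \<open>B\<close> are at distance at least \<open>r\<close>, so
  there the bound \<open>C\<close> on \<open>F\<close> is itself at most \<open>C / r\<close> times
  the distance.\<close>

lemma lipschitz_on_zero_extension:
  fixes F :: "'a::euclidean_space \<Rightarrow> real"
  assumes lip: "L-lipschitz_on B F" and S: "compact S" "S \<subseteq> interior B"
    and zero: "\<And>z. z \<notin> S \<Longrightarrow> F z = 0"
  obtains L' where "L'-lipschitz_on UNIV F"
proof -
  have "compact (F ` S)"
    using S by (intro compact_continuous_image S(1) continuous_on_subset[OF lipschitz_on_continuous_on[OF lip]])
      (use interior_subset in blast)
  then obtain C where "0 < C" "\<forall>y\<in>F ` S. norm y \<le> C"
    using bounded_pos[of "F ` S"] compact_imp_bounded[of "F ` S"] by blast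
  hence C: "\<And>z. z \<in> S \<Longrightarrow> \<bar>F z\<bar> \<le> C" "0 \<le> C" by auto
  obtain r where r: "0 < r" "\<And>x y. x \<in> S \<Longrightarrow> y \<in> - interior B \<Longrightarrow> r \<le> dist x y"
  proof -
    have "closed (- interior B)" "S \<inter> - interior B = {}" using S(2) by auto
    from separate_compact_closed[OF S(1) this] show ?thesis using that by blast
  qed
  have L0: "0 \<le> L" using lip by (rule lipschitz_on_nonneg)
  have far: "dist (F x) (F y) \<le> (L + C / r) * dist x y" if "x \<in> S" "y \<notin> B" for x y
  proof -
    have "y \<notin> interior B" using that(2) interior_subset[of B] by blast
    hence "r \<le> dist x y" using r(2)[OF that(1)] by auto
    hence "C \<le> C / r * dist x y"
      using r(1) C(2) by (simp add: field_simps mult_left_mono)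
    also have "\<dots> \<le> (L + C / r) * dist x y" using L0 by (intro mult_right_mono) auto
    finally have "C \<le> (L + C / r) * dist x y" .
    moreover have "y \<notin> S" using that(2) S(2) interior_subset[of B] by blast
    ultimately show ?thesis
      using C(1)[OF that(1)] zero[of y] by (simp add: dist_real_def)
  qed
  have "(L + C / r)-lipschitz_on UNIV F"
  proof (rule lipschitz_onI)
    fix x y
    consider "x \<in> B" "y \<in> B" | "x \<in> S" "y \<notin> B" | "y \<in> S" "x \<notin> B" | "x \<notin> S" "y \<notin> S"
      using S(2) interior_subset[of B] by blast
    thus "dist (F x) (F y) \<le> (L + C / r) * dist x y"
    proof cases
      case 1
      hence "dist (F x) (F y) \<le> L * dist x y" using lipschitz_onD[OF lip] by blast
      also have "\<dots> \<le> (L + C / r) * dist x y" using C(2) r(1) by (intro mult_right_mono) auto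
      finally show ?thesis .
    next
      case 2 thus ?thesis by (rule far)
    next
      case 3 thus ?thesis using far[of y x] by (simp add: dist_commute)
    next
      case 4 thus ?thesis using zero L0 C(2) r(1) by simp
    qed
  qed (use L0 C(2) r(1) in auto)
  thus ?thesis by (rule that)
qed

section \<open>Integrals of directional derivatives\<close>

lemma borel_measurable_lebesgue_cong_AE:
  fixes f g :: "'a::euclidean_space \<Rightarrow> real"
  assumes f: "f \<in> borel_measurable lebesgue" and eq: "AE x in lebesgue. f x = g x"
  shows "g \<in> borel_measurable lebesgue"
proof (rule measurableI)
  fix A :: "real set" assume A: "A \<in> sets borel"
  have "AE x in lebesgue. x \<in> f -` A \<longleftrightarrow> x \<in> g -` A"
    using eq by eventually_elim simp
  moreover have "f -` A \<in> sets lebesgue" using measurable_sets[OF f A] by simp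
  ultimately show "g -` A \<inter> space lebesgue \<in> sets lebesgue"
    using complete_measure.in_sets_AE[of lebesgue "f -` A" "g -` A"] by (simp add: completion.complete_measure_axioms)
qed auto

lemma integrable_lebesgue_shift:
  fixes f :: "'a::euclidean_space \<Rightarrow> real"
  assumes "integrable lborel f"
  shows "integrable lborel (\<lambda>z. f (z + c))" "(\<integral>z. f (z + c) \<partial>lborel) = (\<integral>z. f z \<partial>lborel)"
proof -
  have f: "f \<in> borel_measurable borel" using assms by simp
  have "integrable (distr lborel borel ((+) c)) f" using assms by (simp add: lborel_distr_plus)
  thus "integrable lborel (\<lambda>z. f (z + c))"
    using f by (subst (asm) integrable_distr_eq) (auto simp: add.commute)
  have "(\<integral>z. f z \<partial>lborel) = (\<integral>z. f z \<partial>distr lborel borel ((+) c))" by (simp add: lborel_distr_plus)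
  also have "\<dots> = (\<integral>z. f (c + z) \<partial>lborel)" using f by (subst integral_distr) auto
  finally show "(\<integral>z. f (z + c) \<partial>lborel) = (\<integral>z. f z \<partial>lborel)" by (simp add: add.commute)
qed

lemma integrable_continuous_compact_support:
  fixes F :: "'a::euclidean_space \<Rightarrow> real"
  assumes cont: "continuous_on UNIV F" and S: "compact S" "\<And>z. z \<notin> S \<Longrightarrow> F z = 0"
  shows "integrable lborel F"
proof -
  have "integrable lborel (\<lambda>z. indicator S z *\<^sub>R F z)"
    using S(1) continuous_on_subset[OF cont] by (intro borel_integrable_compact) auto
  also have "(\<lambda>z. indicator S z *\<^sub>R F z) = F" using S(2) by (auto simp: indicator_def fun_eq_iff)
  finally show ?thesis .
qed

theorem has_bochner_integral_dderiv:
  fixes F :: "'a::euclidean_space \<Rightarrow> real"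
  assumes lip: "L-lipschitz_on UNIV F" and S: "compact S" "\<And>z. z \<notin> S \<Longrightarrow> F z = 0"
    and D: "AE z in lebesgue. has_dderiv F u z (D z)"
  shows "has_bochner_integral lebesgue D 0"
proof -
  have cont: "continuous_on UNIV F"
    using lip by (rule lipschitz_on_continuous_on)
  have Fi: "integrable lborel F"
    using cont S by (rule integrable_continuous_compact_support)
  define Q where "Q n z = (F (z + (1 / Suc n) *\<^sub>R u) - F z) * Suc n" for n :: nat and z
  have Q: "integrable lborel (Q n)" "(\<integral>z. Q n z \<partial>lborel) = 0" for n
    unfolding Q_def using integrable_lebesgue_shift[OF Fi] Fi by (simp_all add: Bochner_Integration.integral_diff)
  have Qm: "Q n \<in> borel_measurable borel" for n using Q(1)[of n] by simp
  have lim: "AE z in lebesgue. (\<lambda>n. Q n z) \<longlonglongrightarrow> D z"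
    using D
  proof eventually_elim
    case (elim z)
    hence "((\<lambda>h. (F (z + h *\<^sub>R u) - F z) / h) \<longlongrightarrow> D z) (at 0)"
      by (simp add: has_dderiv_def has_field_derivative_iff)
    moreover have "filterlim (\<lambda>n. 1 / real (Suc n)) (at 0) sequentially"
      using LIMSEQ_Suc[OF lim_1_over_n[where 'a=real]] by (intro filterlim_atI) auto
    ultimately have "(\<lambda>n. (F (z + (1 / real (Suc n)) *\<^sub>R u) - F z) / (1 / real (Suc n))) \<longlonglongrightarrow> D z"
      by (rule filterlim_compose)
    thus ?case by (simp add: Q_def)
  qed
  obtain R where R: "\<And>z. z \<in> S \<Longrightarrow> norm z \<le> R"
    using compact_imp_bounded[OF S(1)] by (auto simp: bounded_iff)
  \<comment> \<open>Dominating function: the quotients are at most \<open>L * norm u\<close>, and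
    since the step is at most 1 they vanish outside the ball of radius
    \<open>R + norm u\<close>.\<close>
  let ?g = "\<lambda>z. L * norm u * indicator (cball (0::'a) (R + norm u)) z"
  have bound: "\<bar>Q n z\<bar> \<le> ?g z" for n z
  proof (cases "z \<in> cball 0 (R + norm u)")
    case True
    have "\<bar>F (z + (1 / Suc n) *\<^sub>R u) - F z\<bar> \<le> L * (norm u / Suc n)"
      using lipschitz_onD[OF lip, of "z + (1 / Suc n) *\<^sub>R u" z] by (simp add: dist_norm)
    hence "\<bar>F (z + (1 / Suc n) *\<^sub>R u) - F z\<bar> * Suc n \<le> L * (norm u / Suc n) * Suc n"
      by (rule mult_right_mono) simp
    thus ?thesis using True by (simp add: Q_def abs_mult)
  next
    case False
    hence "\<not> norm z \<le> R" "\<not> norm (z + (1 / Suc n) *\<^sub>R u) \<le> R"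
    proof -
      have "norm ((1 / Suc n) *\<^sub>R u) \<le> 1 * norm u"
        unfolding norm_scaleR by (intro mult_right_mono) auto
      hence "norm z \<le> norm (z + (1 / Suc n) *\<^sub>R u) + norm u"
        using norm_triangle_ineq4[of "z + (1 / Suc n) *\<^sub>R u" "(1 / Suc n) *\<^sub>R u"] by simp
      thus "\<not> norm (z + (1 / Suc n) *\<^sub>R u) \<le> R" using False by auto
      show "\<not> norm z \<le> R" using False norm_ge_zero[of u] by (auto simp del: norm_ge_zero)
    qed
    hence "F z = 0" "F (z + (1 / Suc n) *\<^sub>R u) = 0" using S(2) R by blast+
    thus ?thesis using lipschitz_on_nonneg[OF lip] by (simp add: Q_def)
  qed
  have gi: "integrable lebesgue ?g"
    using lmeasurable_cball[of "0::'a" "R + norm u"]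
    by (intro integrable_mult_right) (auto simp: fmeasurable_def intro!: integrable_real_indicator)
  \<comment> \<open>\<open>D\<close> is prescribed only almost everywhere, so its measurability
    comes from the limit of the quotients and the completeness of Lebesgue measure.\<close>
  have Dm: "D \<in> borel_measurable lebesgue"
  proof (rule borel_measurable_lebesgue_cong_AE)
    have "(\<lambda>z. lim (\<lambda>n. Q n z)) \<in> borel_measurable borel"
      using Qm by (rule borel_measurable_lim_metric)
    thus "(\<lambda>z. lim (\<lambda>n. Q n z)) \<in> borel_measurable lebesgue"
      by (simp add: measurable_completion)
    show "AE z in lebesgue. lim (\<lambda>n. Q n z) = D z"
      using lim by eventually_elim (rule limI)
  qed
  have Qm': "Q n \<in> borel_measurable lebesgue" for n
    using Qm by (simp add: measurable_completion)
  have "integrable lebesgue D"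
    by (rule integrable_dominated_convergence[OF Dm Qm' gi lim]) (use bound in auto)
  moreover have "(\<lambda>n. integral\<^sup>L lebesgue (Q n)) \<longlonglongrightarrow> integral\<^sup>L lebesgue D"
    by (rule integral_dominated_convergence[OF Dm Qm' gi lim]) (use bound in auto)
  hence "(\<lambda>n. 0) \<longlonglongrightarrow> integral\<^sup>L lebesgue D"
    using Q(2) Qm by (simp add: integral_completion)
  hence "integral\<^sup>L lebesgue D = 0" using LIMSEQ_unique[OF tendsto_const] by metis
  ultimately show ?thesis by (simp add: has_bochner_integral_iff)
qed

subsection \<open>The pointwise Carleman inequality\<close>

lemma sum_symmetric_swap:
  fixes a :: "'n::finite \<Rightarrow> 'n \<Rightarrow> real"
  assumes "\<And>i j. a i j = a j i"
  shows "(\<Sum>i\<in>UNIV. \<Sum>j\<in>UNIV. a i j * (x i * y j)) = (\<Sum>i\<in>UNIV. \<Sum>j\<in>UNIV. a i j * (y i * x j))"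
  by (subst sum.swap) (simp add: assms mult_ac)

text \<open>With \<open>x\<close> a derivative of \<open>y\<close>, the left side is what the
  product rule produces from the quadratic form of \<open>a\<close> at \<open>y\<close>; this gives
  the derivatives of \<open>H\<close> and \<open>q\<close>. It also collects the cross terms of the
  conjugation.\<close>

lemma sum_symmetric_polar:
  fixes a :: "'n::finite \<Rightarrow> 'n \<Rightarrow> real"
  assumes "\<And>i j. a i j = a j i"
  shows "(\<Sum>i\<in>UNIV. \<Sum>j\<in>UNIV. a i j * (x i * y j + y i * x j)) = 2 * (\<Sum>i\<in>UNIV. (\<Sum>j\<in>UNIV. a i j * y j) * x i)"
proof -
  have "(\<Sum>i\<in>UNIV. \<Sum>j\<in>UNIV. a i j * (x i * y j + y i * x j))
      = (\<Sum>i\<in>UNIV. \<Sum>j\<in>UNIV. a i j * (x i * y j)) + (\<Sum>i\<in>UNIV. \<Sum>j\<in>UNIV. a i j * (y i * x j))"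
    by (simp add: distrib_left sum.distrib)
  also have "\<dots> = 2 * (\<Sum>i\<in>UNIV. \<Sum>j\<in>UNIV. a i j * (x i * y j))"
    using sum_symmetric_swap[OF assms, where x=x and y=y] by simp
  also have "(\<Sum>i\<in>UNIV. \<Sum>j\<in>UNIV. a i j * (x i * y j)) = (\<Sum>i\<in>UNIV. (\<Sum>j\<in>UNIV. a i j * y j) * x i)"
    by (simp add: sum_distrib_left sum_distrib_right mult_ac)
  finally show ?thesis .
qed

text \<open>Conjugation with \<open>e^\<psi>\<close> replaces each derivative by itself minus the
  derivative of \<psi>, and symmetry of \<open>a\<close> merges the two cross terms into
  \<open>-2 Y \<bullet> \<nabla>w\<close>. Stated as algebra between the values at one point, so
  derivatives of the coefficients are just numbers \<open>da\<close>. The number \<open>f\<close> is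
  free: it is subtracted in the second bracket and added back in the third.\<close>

lemma conjugated_operator:
  fixes a :: "'n::finite \<Rightarrow> 'n \<Rightarrow> real" and da :: "'n \<Rightarrow> 'n \<Rightarrow> 'n \<Rightarrow> real" 
  assumes sym: "\<And>i j. a i j = a j i"
    and w: "w = e * v" and wt: "wt = e * (vt + pt * v)" and wk: "\<And>i. wk i = e * (vk i + p i * v)"
    and ww: "\<And>i j. ww i j = e * (vv i j + pp i j * v + p j * vk i + p i * vk j + p i * p j * v)"
    and Y: "\<And>k. Y k = (\<Sum>l\<in>UNIV. a k l * p l)" and q: "q = (\<Sum>k\<in>UNIV. Y k * p k) - pt"
  shows "e * (vt + (\<Sum>i\<in>UNIV. \<Sum>j\<in>UNIV. da i i j * vk j + a i j * vv i j))
    = ((\<Sum>i\<in>UNIV. \<Sum>j\<in>UNIV. da i i j * wk j + a i j * ww i j) + q * w)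
      + (wt - 2 * (\<Sum>k\<in>UNIV. Y k * wk k) - f * w)
      + (f - (\<Sum>i\<in>UNIV. \<Sum>j\<in>UNIV. da i i j * p j + a i j * pp i j)) * w"
proof -
  define S where "S = (\<Sum>k\<in>UNIV. Y k * vk k)"
  define N where "N = (\<Sum>k\<in>UNIV. Y k * p k)"
  have S: "(\<Sum>i\<in>UNIV. \<Sum>j\<in>UNIV. a i j * (vk i * p j + p i * vk j)) = 2 * S"
    unfolding S_def Y by (rule sum_symmetric_polar[OF sym])
  have N: "(\<Sum>i\<in>UNIV. \<Sum>j\<in>UNIV. a i j * (p i * p j)) = N"
    unfolding N_def Y by (simp add: sum_distrib_left sum_distrib_right mult_ac)
  have YW: "(\<Sum>k\<in>UNIV. Y k * wk k) = e * S + e * v * N"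
    unfolding S_def N_def wk by (simp add: algebra_simps sum.distrib sum_distrib_left)
  have "(\<Sum>i\<in>UNIV. \<Sum>j\<in>UNIV. da i i j * wk j + a i j * ww i j)
     = (\<Sum>i\<in>UNIV. \<Sum>j\<in>UNIV. e * (da i i j * vk j + a i j * vv i j) + (e * v) * (da i i j * p j + a i j * pp i j)
       + e * (a i j * (vk i * p j + p i * vk j)) + (e * v) * (a i j * (p i * p j)))"
    by (intro sum.cong refl) (simp add: wk ww algebra_simps)
  also have "\<dots> = e * (\<Sum>i\<in>UNIV. \<Sum>j\<in>UNIV. da i i j * vk j + a i j * vv i j)
      + (e * v) * (\<Sum>i\<in>UNIV. \<Sum>j\<in>UNIV. da i i j * p j + a i j * pp i j)
      + e * (2 * S) + (e * v) * N"
    unfolding S[symmetric] N[symmetric] sum_distrib_left by (simp only: sum.distrib)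
  finally show ?thesis
    unfolding YW q N_def[symmetric] w wt by (simp add: algebra_simps)
qed

text \<open>Rellich's identity: \<open>G\<close> and \<open>G0\<close> are the derivatives of the fluxes
  \<open>V\<^sub>i T + Y\<^sub>i H - q Y\<^sub>i w\<^sup>2\<close> along \<open>e\<^sub>i\<close> and \<open>(q w\<^sup>2 - H) / 2\<close> along \<open>t\<close>.\<close>

lemma rellich_identity:
  fixes a adt :: "'n::finite \<Rightarrow> 'n \<Rightarrow> real" and da :: "'n \<Rightarrow> 'n \<Rightarrow> 'n \<Rightarrow> real"
    and w wt q dtq f T H dtH G0 :: real and wk wtk dV V Y dq dT dH G :: "'n \<Rightarrow> real" and dY ww :: "'n \<Rightarrow> 'n \<Rightarrow> real"
  assumes ww: "\<And>i j. ww i j = ww j i"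
    and V: "\<And>i. V i = (\<Sum>j\<in>UNIV. a i j * wk j)" and H: "H = (\<Sum>i\<in>UNIV. V i * wk i)"
    and T: "T = wt - 2 * (\<Sum>k\<in>UNIV. Y k * wk k) - f * w"
    and dV: "\<And>i. dV i = (\<Sum>j\<in>UNIV. da i i j * wk j + a i j * ww i j)"
    and dT: "\<And>i. dT i = wtk i - 2 * (\<Sum>k\<in>UNIV. dY i k * wk k + Y k * ww i k) - f * wk i"
    and dH: "\<And>k. dH k = (\<Sum>i\<in>UNIV. \<Sum>j\<in>UNIV. da k i j * (wk i * wk j)) + 2 * (\<Sum>i\<in>UNIV. V i * ww k i)"
    and dtH: "dtH = (\<Sum>i\<in>UNIV. \<Sum>j\<in>UNIV. adt i j * (wk i * wk j)) + 2 * (\<Sum>i\<in>UNIV. V i * wtk i)"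
    and G: "\<And>i. G i = dV i * T + V i * dT i + (dY i i * H + Y i * dH i)
      - (dq i * (Y i * w\<^sup>2) + q * (dY i i * w\<^sup>2 + Y i * (2 * w * wk i)))"
    and G0: "G0 = (dtq * w\<^sup>2 + q * (2 * w * wt) - dtH) / 2"
  shows "((\<Sum>i\<in>UNIV. \<Sum>j\<in>UNIV. da i i j * wk j + a i j * ww i j) + q * w) * T
    = (\<Sum>i\<in>UNIV. G i) + G0
      + ((\<Sum>i\<in>UNIV. \<Sum>j\<in>UNIV. adt i j * (wk i * wk j)) / 2
         + 2 * (\<Sum>i\<in>UNIV. \<Sum>k\<in>UNIV. V i * wk k * dY i k)
         - (\<Sum>k\<in>UNIV. Y k * (\<Sum>i\<in>UNIV. \<Sum>j\<in>UNIV. da k i j * (wk i * wk j)))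
         + (f - (\<Sum>i\<in>UNIV. dY i i)) * H)
      + w\<^sup>2 * (- dtq / 2 + (\<Sum>k\<in>UNIV. Y k * dq k) - (f - (\<Sum>i\<in>UNIV. dY i i)) * q)"
proof -
  let ?A = "\<lambda>k. \<Sum>i\<in>UNIV. \<Sum>j\<in>UNIV. da k i j * (wk i * wk j)"
  let ?VYW = "\<Sum>i\<in>UNIV. \<Sum>k\<in>UNIV. V i * (Y k * ww i k)"
  \<comment> \<open>These are the second derivatives of \<open>w\<close> that \<open>dV\<close> does
    not contain. They enter with factor -2 through \<open>dT\<close> and +2 through
    \<open>dH\<close>, and cancel because \<open>ww\<close> is symmetric.\<close>
  have swap: "(\<Sum>k\<in>UNIV. Y k * (\<Sum>i\<in>UNIV. V i * ww k i)) = ?VYW"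
    unfolding sum_distrib_left
    by (subst sum.swap, intro sum.cong refl) (metis mult.left_commute ww)
  have VdT: "(\<Sum>i\<in>UNIV. V i * dT i) = (\<Sum>i\<in>UNIV. V i * wtk i)
      - 2 * (\<Sum>i\<in>UNIV. \<Sum>k\<in>UNIV. V i * wk k * dY i k) - 2 * ?VYW - f * H"
  proof -
    have "(\<Sum>i\<in>UNIV. V i * dT i) = (\<Sum>i\<in>UNIV. V i * wtk i
        - 2 * (\<Sum>k\<in>UNIV. V i * wk k * dY i k) - 2 * (\<Sum>k\<in>UNIV. V i * (Y k * ww i k)) - f * (V i * wk i))"
      by (intro sum.cong refl) (simp add: dT algebra_simps sum.distrib sum_distrib_left)
    thus ?thesis by (simp only: sum_subtractf sum_distrib_left[symmetric] H)
  qed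
  have YdH: "(\<Sum>k\<in>UNIV. Y k * dH k) = (\<Sum>k\<in>UNIV. Y k * ?A k) + 2 * ?VYW"
  proof -
    have "(\<Sum>k\<in>UNIV. Y k * dH k) = (\<Sum>k\<in>UNIV. Y k * ?A k + 2 * (Y k * (\<Sum>i\<in>UNIV. V i * ww k i)))"
      by (intro sum.cong refl) (simp add: dH distrib_left)
    thus ?thesis by (simp only: sum.distrib sum_distrib_left[symmetric] swap)
  qed
  have "(\<Sum>i\<in>UNIV. G i) = (\<Sum>i\<in>UNIV. T * dV i + V i * dT i + H * dY i i + Y i * dH i
      - w\<^sup>2 * (Y i * dq i) - (q * w\<^sup>2) * dY i i - (2 * q * w) * (Y i * wk i))"
    by (intro sum.cong refl) (simp add: G algebra_simps)
  also have "\<dots> = T * (\<Sum>i\<in>UNIV. dV i) + (\<Sum>i\<in>UNIV. V i * dT i) + H * (\<Sum>i\<in>UNIV. dY i i) + (\<Sum>i\<in>UNIV. Y i * dH i)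
      - w\<^sup>2 * (\<Sum>i\<in>UNIV. Y i * dq i) - (q * w\<^sup>2) * (\<Sum>i\<in>UNIV. dY i i) - (2 * q * w) * (\<Sum>i\<in>UNIV. Y i * wk i)"
    by (simp only: sum.distrib sum_subtractf sum_distrib_left)
  finally have SG: "(\<Sum>i\<in>UNIV. G i) = \<dots>" .
  have qwT: "q * w * T = q * w * wt - 2 * q * w * (\<Sum>i\<in>UNIV. Y i * wk i) - f * q * w\<^sup>2"
    by (simp add: T algebra_simps power2_eq_square)
  show ?thesis
    unfolding SG VdT YdH G0 dtH dV[symmetric] distrib_right qwT
    by (simp add: algebra_simps add_divide_distrib diff_divide_distrib)
qed

text \<open>The coefficient of \<open>w^2\<close>, with \<open>P\<close> for the \<gamma> part,
  \<open>e\<close> for \<open>f - L \<psi>\<close>, \<open>N\<close> for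
  \<open>Y \<bullet> \<nabla>\<psi>\<close> and \<open>r\<close> for errors from derivatives of
  \<open>a\<close> and the Hessian of \<psi>. On the left, 1 is for \<open>v\<close> and
  \<open>2 b^2 \<phi> / t^2\<close> for the passage from \<open>\<nabla>w\<close> back to
  \<open>e^\<psi> \<nabla>v\<close>. With \<open>m = b \<phi> + K\<close>, the gain
  \<open>3/8 (D - C) m / t^3\<close> has to cover \<open>m / t^3\<close> with four factors: 1 for
  \<open>e^2 + 1\<close>, \<open>b\<close> for the gradient loss, 1/2 for the second time derivative
  of \<psi>, and \<open>c\<close> for \<open>r\<close>. This is the last hypothesis.\<close>

lemma zero_order_bound:
  fixes t \<phi> b K D C c P e N r :: real
  assumes t: "0 < t" "t \<le> 1" and pos: "1 \<le> \<phi>" "0 < b" "0 < K" "0 \<le> P" "0 \<le> N" "0 \<le> c" "0 \<le> C" "C \<le> D"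
    and N: "N \<le> b * \<phi> / (8 * t\<^sup>2)" and e: "(D - C) / t \<le> e" "e \<le> (D + C) / t"
    and r: "\<bar>r\<bar> \<le> c * b * \<phi> / t ^ 3"
    and K: "2 * (D + C) \<le> K" "(D + C)\<^sup>2 + 1 \<le> K" and D: "1 + b + 1/2 + c \<le> 3 / 8 * (D - C)"
  shows "1 + 2 * b\<^sup>2 * \<phi> / t\<^sup>2 \<le> 2 * (P * (K + 1) / 2 - (b * \<phi> + K) / (2 * t ^ 3) + 2 * N / t + r
      - e * (P * t - (b * \<phi> + K) / (2 * t\<^sup>2) + N)) - e\<^sup>2"
proof -
  define m where "m = b * \<phi> + K"
  have m: "0 < m" using pos by (simp add: m_def add_pos_pos)
  have t3: "1 \<le> 1 / t ^ 3" "1 / t\<^sup>2 \<le> 1 / t ^ 3"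
    using t by (auto simp: field_simps power_le_one power_decreasing intro: power_decreasing)
  have e0: "0 \<le> e" using e(1) pos t by (meson diff_ge_0_iff_ge divide_nonneg_pos order_trans)
  \<comment> \<open>All of \<open>P\<close> is disposed of here:
    \<open>e t \<le> D + C \<le> K / 2\<close>, whatever the size of \<open>P\<close>.\<close>
  have s1: "e * (P * t) \<le> P * (K + 1) / 2"
  proof -
    have "e * t \<le> D + C" using e(2) t by (simp add: field_simps)
    hence "P * (e * t) \<le> P * (D + C)" using pos by (intro mult_left_mono)
    also have "\<dots> \<le> P * ((K + 1) / 2)" using K(1) pos by (intro mult_left_mono) auto
    finally show ?thesis by (simp add: mult_ac)
  qed
  \<comment> \<open>The factor is \<open>3/8 = 1/2 - 1/8\<close>, where 1/8 comes from the bound on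
    \<open>N\<close>.\<close>
  have s2: "3 / 8 * (D - C) * (m / t ^ 3) \<le> e * (m / (2 * t\<^sup>2) - N)"
  proof -
    have "b * \<phi> / (8 * t\<^sup>2) \<le> m / (8 * t\<^sup>2)"
      using pos t by (intro divide_right_mono) (auto simp: m_def)
    hence N': "3 / 8 * (m / t\<^sup>2) \<le> m / (2 * t\<^sup>2) - N" using N by (simp add: field_simps)
    have "3 / 8 * (D - C) * (m / t ^ 3) = ((D - C) / t) * (3 / 8 * (m / t\<^sup>2))"
      by (simp add: power3_eq_cube power2_eq_square field_simps)
    also have "\<dots> \<le> e * (m / (2 * t\<^sup>2) - N)"
      using e(1) N' e0 m by (intro mult_mono) auto
    finally show ?thesis .
  qed
  \<comment> \<open>The additive constant \<open>K\<close> of the weight absorbs the square of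
    \<open>f - L \<psi>\<close>; the factor \<open>1 / t\<close> to spare is at least 1.\<close>
  have s3: "e\<^sup>2 + 1 \<le> K / t ^ 3"
  proof -
    have "e\<^sup>2 \<le> ((D + C) / t)\<^sup>2" using e(2) e0 by (rule power_mono)
    also have "\<dots> = (D + C)\<^sup>2 * (1 / t\<^sup>2)" by (simp add: power_divide)
    also have "\<dots> \<le> (D + C)\<^sup>2 * (1 / t ^ 3)" using t3 by (intro mult_left_mono) auto
    finally have "e\<^sup>2 + 1 \<le> ((D + C)\<^sup>2 + 1) * (1 / t ^ 3)"
      unfolding distrib_right using t3(1) by linarith
    also have "\<dots> \<le> K * (1 / t ^ 3)" using K(2) t by (intro mult_right_mono) auto
    finally show ?thesis by simp
  qed
  have s4: "(1 + b + 1/2 + c) * (m / t ^ 3) \<le> 3 / 8 * (D - C) * (m / t ^ 3)"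
    using D m t by (intro mult_right_mono) auto
  have s5: "c * b * \<phi> / t ^ 3 \<le> c * (m / t ^ 3)"
    using pos t by (simp add: m_def field_simps mult_left_mono)
  have s6: "b\<^sup>2 * \<phi> / t\<^sup>2 \<le> b * (m / t ^ 3)"
  proof -
    have "b\<^sup>2 * \<phi> * (1 / t\<^sup>2) \<le> b\<^sup>2 * \<phi> * (1 / t ^ 3)" using pos t3 by (intro mult_left_mono) auto
    also have "\<dots> \<le> b * m * (1 / t ^ 3)"
      using pos t by (intro mult_right_mono) (auto simp: m_def power2_eq_square algebra_simps)
    finally show ?thesis by simp
  qed
  have s7: "K / t ^ 3 \<le> m / t ^ 3"
    using pos t by (intro divide_right_mono) (auto simp: m_def)
  have s8: "0 \<le> N / t" using pos t by simp
  have m2: "m / (2 * t ^ 3) = (m / t ^ 3) / 2" by simp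
  have expand: "e * (P * t - m / (2 * t\<^sup>2) + N) = e * (P * t) - e * (m / (2 * t\<^sup>2) - N)"
    by (simp add: algebra_simps)
  have s4': "(1 + b + 1/2 + c) * (m / t ^ 3) = m / t ^ 3 + b * (m / t ^ 3) + (m / t ^ 3) / 2 + c * (m / t ^ 3)"
    by (simp only: distrib_right) simp
  have linear: "1 + 2 * u8 \<le> 2 * (u7 - m3 / 2 + 2 * u3 + r - (u1 - u2)) - e2"
    if "0 \<le> m3" "u1 \<le> u7" "u4 \<le> u2" "e2 + 1 \<le> u10" "m3 + u5 + m3 / 2 + u6 \<le> u4" "u9 \<le> u6"
      "u8 \<le> u5" "u10 \<le> m3" "0 \<le> u3" "- r \<le> u9"
    for m3 u1 u2 u3 u4 u5 u6 u7 u8 u9 u10 e2 :: real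
    using that by argo
  have m3: "0 \<le> m / t ^ 3" using m t by simp
  have "2 * b\<^sup>2 * \<phi> / t\<^sup>2 = 2 * (b\<^sup>2 * \<phi> / t\<^sup>2)" "2 * N / t = 2 * (N / t)" by simp_all
  thus ?thesis
    unfolding m_def[symmetric] expand m2
    using linear[OF m3 s1 s2 s3 s4[unfolded s4'] s5 s6 s7 s8 abs_le_D2[OF r]] by argo
qed

lemma sum_abs_le_card:
  fixes f :: "'n::finite \<Rightarrow> real"
  assumes "\<And>i. \<bar>f i\<bar> \<le> c"
  shows "\<bar>\<Sum>i\<in>UNIV. f i\<bar> \<le> real CARD('n) * c"
proof -
  have "\<bar>\<Sum>i\<in>UNIV. f i\<bar> \<le> (\<Sum>i\<in>UNIV. \<bar>f i\<bar>)" by (rule sum_abs)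
  also have "\<dots> \<le> real CARD('n) * c" using assms by (rule sum_bounded_above)
  finally show ?thesis .
qed

lemma sum2_abs_le_card:
  fixes f :: "'n::finite \<Rightarrow> 'n \<Rightarrow> real"
  assumes "\<And>i j. \<bar>f i j\<bar> \<le> c"
  shows "\<bar>\<Sum>i\<in>UNIV. \<Sum>j\<in>UNIV. f i j\<bar> \<le> (real CARD('n))\<^sup>2 * c"
  using sum_abs_le_card[OF sum_abs_le_card[OF assms]] by (simp add: power2_eq_square mult.assoc)

lemma sum3_abs_le_card:
  fixes f :: "'n::finite \<Rightarrow> 'n \<Rightarrow> 'n \<Rightarrow> real"
  assumes "\<And>k i j. \<bar>f k i j\<bar> \<le> c"
  shows "\<bar>\<Sum>k\<in>UNIV. \<Sum>i\<in>UNIV. \<Sum>j\<in>UNIV. f k i j\<bar> \<le> (real CARD('n)) ^ 3 * c"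
  using sum_abs_le_card[OF sum2_abs_le_card[OF assms]] by (simp add: power3_eq_cube power2_eq_square mult.assoc)

text \<open>Every error is at most a constant times \<open>g / t\<close>, because \<open>dY\<close>
  and \<open>Y k * da k i j\<close> are \<open>O(1 / t)\<close> and \<open>t \<le> 1\<close>.
  Ellipticity turns \<open>(D / t) H\<close> into at least \<open>lam D g / t\<close>, and
  \<open>D\<close> is chosen to win. The powers of \<open>n\<close> merely count summands.\<close>

lemma first_order_bound:
  fixes a adt dY :: "'n::finite \<Rightarrow> 'n \<Rightarrow> real" and da :: "'n \<Rightarrow> 'n \<Rightarrow> 'n \<Rightarrow> real"
    and wk V Y :: "'n \<Rightarrow> real" and t \<Lambda> lam M c1 c2 D g H :: real
  defines "n \<equiv> real CARD('n)"
  assumes t: "0 < t" "t \<le> 1" and a: "\<And>i j. \<bar>a i j\<bar> \<le> \<Lambda>" and adt: "\<And>i j. \<bar>adt i j\<bar> \<le> M"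
    and V: "\<And>i. V i = (\<Sum>j\<in>UNIV. a i j * wk j)"
    and dY: "\<And>i k. \<bar>dY i k\<bar> \<le> c1 / t" and Yda: "\<And>k i j. \<bar>Y k * da k i j\<bar> \<le> c2 / t"
    and g: "g = (\<Sum>i\<in>UNIV. (wk i)\<^sup>2)" and H: "lam * g \<le> H" and lam: "0 < lam"
    and D: "1 + n\<^sup>2 * M / 2 + 2 * n ^ 3 * \<Lambda> * c1 + n ^ 3 * c2 \<le> lam * (D - n * c1)"
  shows "g \<le> (\<Sum>i\<in>UNIV. \<Sum>j\<in>UNIV. adt i j * (wk i * wk j)) / 2
         + 2 * (\<Sum>i\<in>UNIV. \<Sum>k\<in>UNIV. V i * wk k * dY i k)
         - (\<Sum>k\<in>UNIV. Y k * (\<Sum>i\<in>UNIV. \<Sum>j\<in>UNIV. da k i j * (wk i * wk j)))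
         + (D / t - (\<Sum>i\<in>UNIV. dY i i)) * H"
proof -
  have g0: "0 \<le> g" by (simp add: g sum_nonneg)
  have M0: "0 \<le> M" and L0: "0 \<le> \<Lambda>" using adt a by (meson abs_ge_zero order_trans)+
  have c10: "0 \<le> c1" using dY[of undefined undefined] t(1) by (meson abs_ge_zero order_trans divide_less_0_iff not_le)
  have c20: "0 \<le> c2" using Yda[of undefined undefined undefined] t(1) by (meson abs_ge_zero order_trans divide_less_0_iff not_le)
  have n0: "0 \<le> n" by (simp add: n_def)
  have ww: "\<bar>wk i * wk j\<bar> \<le> g" for i j
  proof -
    have "(wk i)\<^sup>2 \<le> g" "(wk j)\<^sup>2 \<le> g" unfolding g by (auto intro!: member_le_sum)
    moreover have "2 * \<bar>wk i * wk j\<bar> \<le> (wk i)\<^sup>2 + (wk j)\<^sup>2"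
      using sum_squares_bound[of "\<bar>wk i\<bar>" "\<bar>wk j\<bar>"] by (simp add: abs_mult)
    ultimately show ?thesis by linarith
  qed
  have 1: "\<bar>\<Sum>i\<in>UNIV. \<Sum>j\<in>UNIV. adt i j * (wk i * wk j)\<bar> \<le> n\<^sup>2 * (M * g)"
    unfolding n_def by (intro sum2_abs_le_card) (simp only: abs_mult[of "adt _ _"], intro mult_mono adt ww M0 abs_ge_zero)
  have Vw: "\<bar>V i * wk k\<bar> \<le> n * (\<Lambda> * g)" for i k
  proof -
    have "V i * wk k = (\<Sum>j\<in>UNIV. a i j * (wk j * wk k))"
      by (simp add: V sum_distrib_right mult.assoc)
    also have "\<bar>\<dots>\<bar> \<le> n * (\<Lambda> * g)"
      unfolding n_def by (intro sum_abs_le_card) (simp only: abs_mult[of "a _ _"], intro mult_mono a ww L0 abs_ge_zero)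
    finally show ?thesis .
  qed
  have 2: "\<bar>\<Sum>i\<in>UNIV. \<Sum>k\<in>UNIV. V i * wk k * dY i k\<bar> \<le> n\<^sup>2 * (n * (\<Lambda> * g) * (c1 / t))"
    unfolding n_def
    by (intro sum2_abs_le_card, simp only: abs_mult[of "V _ * wk _"], intro mult_mono dY Vw[unfolded n_def] abs_ge_zero)
      (use L0 g0 in auto)
  have 3: "\<bar>\<Sum>k\<in>UNIV. Y k * (\<Sum>i\<in>UNIV. \<Sum>j\<in>UNIV. da k i j * (wk i * wk j))\<bar> \<le> n ^ 3 * (c2 / t * g)"
  proof -
    have "(\<Sum>k\<in>UNIV. Y k * (\<Sum>i\<in>UNIV. \<Sum>j\<in>UNIV. da k i j * (wk i * wk j)))
        = (\<Sum>k\<in>UNIV. \<Sum>i\<in>UNIV. \<Sum>j\<in>UNIV. (Y k * da k i j) * (wk i * wk j))"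
      by (simp add: sum_distrib_left mult.assoc)
    also have "\<bar>\<dots>\<bar> \<le> n ^ 3 * (c2 / t * g)"
      unfolding n_def
      by (intro sum3_abs_le_card, simp only: abs_mult[of "Y _ * da _ _ _"], intro mult_mono Yda ww abs_ge_zero)
        (use c20 t in auto)
    finally show ?thesis .
  qed
  have 4: "\<bar>\<Sum>i\<in>UNIV. dY i i\<bar> \<le> n * (c1 / t)"
    unfolding n_def by (intro sum_abs_le_card dY)
  have Dn: "0 \<le> D - n * c1"
  proof -
    have "0 \<le> 1 + n\<^sup>2 * M / 2 + 2 * n ^ 3 * \<Lambda> * c1 + n ^ 3 * c2"
      using M0 L0 c10 c20 n0 by simp
    hence "0 \<le> lam * (D - n * c1)" using D by linarith
    thus ?thesis using lam by (simp add: zero_le_mult_iff)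
  qed
  have "(D - n * c1) / t \<le> D / t - (\<Sum>i\<in>UNIV. dY i i)"
    using 4 by (simp add: diff_divide_distrib)
  hence "(D - n * c1) / t * (lam * g) \<le> (D / t - (\<Sum>i\<in>UNIV. dY i i)) * H"
    using Dn t H lam g0 order_trans[of 0 "(D - n * c1) / t" "D / t - (\<Sum>i\<in>UNIV. dY i i)"]
    by (intro mult_mono) auto
  hence 5: "lam * (D - n * c1) * (g / t) \<le> (D / t - (\<Sum>i\<in>UNIV. dY i i)) * H" by (simp add: mult_ac)
  have gt: "g \<le> g / t" using g0 t by (simp add: field_simps mult_left_le)
  have "(1 + n\<^sup>2 * M / 2 + 2 * n ^ 3 * \<Lambda> * c1 + n ^ 3 * c2) * (g / t) \<le> lam * (D - n * c1) * (g / t)"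
    using D g0 t by (intro mult_right_mono) auto
  hence 6: "g / t + (n\<^sup>2 * M / 2) * (g / t) + 2 * n ^ 3 * \<Lambda> * c1 * (g / t) + n ^ 3 * c2 * (g / t)
      \<le> lam * (D - n * c1) * (g / t)"
    by (simp only: distrib_right mult_1)
  have 7: "n\<^sup>2 * (M * g) / 2 \<le> (n\<^sup>2 * M / 2) * (g / t)"
    using mult_left_mono[OF gt, of "n\<^sup>2 * M / 2"] M0 by (simp add: mult_ac)
  have 8: "2 * (n\<^sup>2 * (n * (\<Lambda> * g) * (c1 / t))) = 2 * n ^ 3 * \<Lambda> * c1 * (g / t)"
    "n ^ 3 * (c2 / t * g) = n ^ 3 * c2 * (g / t)"
    by (simp_all add: power3_eq_cube power2_eq_square)
  show ?thesis using 1 2 3 5 6 7 8 gt by linarith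
qed

text \<open>Since \<open>e vk k = wk k - p k w\<close>, this recovers the gradient of
  \<open>v\<close> from that of \<open>w\<close>, at the cost of
  \<open>2 |\<nabla>\<psi>|^2 w^2\<close>.\<close>

lemma sum_mult_square_diff_le:
  fixes wk p :: "'n::finite \<Rightarrow> real" and w :: real
  shows "(\<Sum>k\<in>UNIV. (wk k - p k * w)\<^sup>2) \<le> 2 * (\<Sum>k\<in>UNIV. (wk k)\<^sup>2) + 2 * (\<Sum>k\<in>UNIV. (p k)\<^sup>2) * w\<^sup>2"
proof -
  have "(\<Sum>k\<in>UNIV. (wk k - p k * w)\<^sup>2) \<le> (\<Sum>k\<in>UNIV. 2 * (wk k)\<^sup>2 + 2 * (p k)\<^sup>2 * w\<^sup>2)"
  proof (rule sum_mono)
    fix k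
    have "0 \<le> (wk k + p k * w)\<^sup>2" by simp
    thus "(wk k - p k * w)\<^sup>2 \<le> 2 * (wk k)\<^sup>2 + 2 * (p k)\<^sup>2 * w\<^sup>2"
      by (simp add: power2_eq_square algebra_simps)
  qed
  thus ?thesis by (simp add: sum.distrib sum_distrib_left sum_distrib_right)
qed

text \<open>With \<open>X = Lw + q w\<close>, the bounds \<open>4 X T \<le> (X + T)^2 \<le> 2 (e P
  v)^2 + 2 ((f - L \<psi>) w)^2\<close> reduce everything to the cross term \<open>X T\<close>,
  which Rellich's identity turns into a divergence plus the two quadratic forms estimated before.
  Here \<open>P\<close> is the \<gamma> quantity, \<sigma> stands for
  \<open>\<langle>x\<rangle>^(\<alpha>-1)\<close>, the growth of \<open>\<nabla>\<psi>\<close>, and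
  \<rho> for \<open>\<langle>x\<rangle>^(-\<beta>)\<close>, the decay of the gradient of
  \<open>a\<close>.\<close>

lemma pointwise_carleman:
  fixes a adt dY ww vv pp :: "'n::finite \<Rightarrow> 'n \<Rightarrow> real" and da :: "'n \<Rightarrow> 'n \<Rightarrow> 'n \<Rightarrow> real"
    and wk wtk vk p V Y dq dV dT dH G :: "'n \<Rightarrow> real"
    and t \<Lambda> lam M Ec b K D c1 c2 c \<phi> \<sigma> \<rho> P e f v vt w wt pt ptt q dtq T H dtH G0 :: real
  defines "n \<equiv> real CARD('n)"
  defines "c1 \<equiv> n * (Ec * b + 2 * \<Lambda> * b)" and "c2 \<equiv> n * \<Lambda> * b * Ec"
  defines "c \<equiv> n ^ 4 * \<Lambda> * Ec * b\<^sup>2 + 4 * n ^ 4 * \<Lambda>\<^sup>2 * b\<^sup>2 + n\<^sup>2 * M * b"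
  assumes t: "0 < t" "t \<le> 1"
    and sym: "\<And>i j. a i j = a j i" and wwsym: "\<And>i j. ww i j = ww j i"
    and ell: "\<And>x. lam * (\<Sum>i\<in>UNIV. (x i)\<^sup>2) \<le> (\<Sum>i\<in>UNIV. \<Sum>j\<in>UNIV. a i j * (x i * x j))"
      "\<And>x. (\<Sum>i\<in>UNIV. \<Sum>j\<in>UNIV. a i j * (x i * x j)) \<le> \<Lambda> * (\<Sum>i\<in>UNIV. (x i)\<^sup>2)"
    and a: "\<And>i j. \<bar>a i j\<bar> \<le> \<Lambda>" and da: "\<And>k i j. \<bar>da k i j\<bar> \<le> Ec * \<rho>" and adt: "\<And>i j. \<bar>adt i j\<bar> \<le> M"
    and pos: "0 < lam" "0 < \<Lambda>" "0 < M" "0 < Ec" "0 < b" "0 < K" "0 \<le> P" and b: "b = 1 / (8 * \<Lambda>)"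
    and sc: "0 \<le> \<sigma>" "0 \<le> \<rho>" "\<sigma> * \<rho> \<le> 1" "\<sigma>\<^sup>2 \<le> \<phi>" "1 \<le> \<phi>"
    and p: "\<And>k. \<bar>p k\<bar> \<le> b * \<sigma> / t" and pp: "\<And>i j. \<bar>pp i j\<bar> \<le> 2 * b / t"
    and p2: "(\<Sum>k\<in>UNIV. (p k)\<^sup>2) \<le> b\<^sup>2 * \<phi> / t\<^sup>2"
    and pt: "pt = - P * t + (b * \<phi> + K) / (2 * t\<^sup>2)" and ptt: "ptt = P * (K + 1) - (b * \<phi> + K) / t ^ 3"
    and w: "w = e * v" and wt: "wt = e * (vt + pt * v)" and wk: "\<And>i. wk i = e * (vk i + p i * v)"
    and ww: "\<And>i j. ww i j = e * (vv i j + pp i j * v + p j * vk i + p i * vk j + p i * p j * v)"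
    and Y: "\<And>k. Y k = (\<Sum>l\<in>UNIV. a k l * p l)" and q: "q = (\<Sum>k\<in>UNIV. Y k * p k) - pt"
    and dY: "\<And>i k. dY i k = (\<Sum>l\<in>UNIV. da i k l * p l + a k l * pp i l)"
    and dq: "\<And>k. dq k = (\<Sum>i\<in>UNIV. \<Sum>j\<in>UNIV. da k i j * (p i * p j)) + 2 * (\<Sum>i\<in>UNIV. Y i * pp k i) + p k / t"
    and dtq: "dtq = (\<Sum>i\<in>UNIV. \<Sum>j\<in>UNIV. adt i j * (p i * p j)) - 2 * (\<Sum>k\<in>UNIV. Y k * p k) / t - ptt"
    and f: "f = D / t"
    and V: "\<And>i. V i = (\<Sum>j\<in>UNIV. a i j * wk j)" and H: "H = (\<Sum>i\<in>UNIV. V i * wk i)"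
    and T: "T = wt - 2 * (\<Sum>k\<in>UNIV. Y k * wk k) - f * w"
    and dV: "\<And>i. dV i = (\<Sum>j\<in>UNIV. da i i j * wk j + a i j * ww i j)"
    and dT: "\<And>i. dT i = wtk i - 2 * (\<Sum>k\<in>UNIV. dY i k * wk k + Y k * ww i k) - f * wk i"
    and dH: "\<And>k. dH k = (\<Sum>i\<in>UNIV. \<Sum>j\<in>UNIV. da k i j * (wk i * wk j)) + 2 * (\<Sum>i\<in>UNIV. V i * ww k i)"
    and dtH: "dtH = (\<Sum>i\<in>UNIV. \<Sum>j\<in>UNIV. adt i j * (wk i * wk j)) + 2 * (\<Sum>i\<in>UNIV. V i * wtk i)"
    and G: "\<And>i. G i = dV i * T + V i * dT i + (dY i i * H + Y i * dH i)
      - (dq i * (Y i * w\<^sup>2) + q * (dY i i * w\<^sup>2 + Y i * (2 * w * wk i)))"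
    and G0: "G0 = (dtq * w\<^sup>2 + q * (2 * w * wt) - dtH) / 2"
    and D1: "1 + n\<^sup>2 * M / 2 + 2 * n ^ 3 * \<Lambda> * c1 + n ^ 3 * c2 \<le> lam * (D - n * c1)"
    and D2: "1 + b + 1/2 + c \<le> 3 / 8 * (D - n * c1)"
    and K: "2 * (D + n * c1) \<le> K" "(D + n * c1)\<^sup>2 + 1 \<le> K"
  shows "e\<^sup>2 * (v\<^sup>2 + (\<Sum>k\<in>UNIV. (vk k)\<^sup>2)) + 2 * ((\<Sum>i\<in>UNIV. G i) + G0)
    \<le> e\<^sup>2 * (vt + (\<Sum>i\<in>UNIV. \<Sum>j\<in>UNIV. da i i j * vk j + a i j * vv i j))\<^sup>2"
proof -
  define Lw where "Lw = (\<Sum>i\<in>UNIV. \<Sum>j\<in>UNIV. da i i j * wk j + a i j * ww i j)"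
  define Lp where "Lp = (\<Sum>i\<in>UNIV. dY i i)"
  define N where "N = (\<Sum>k\<in>UNIV. Y k * p k)"
  define g where "g = (\<Sum>i\<in>UNIV. (wk i)\<^sup>2)"
  define B1 where "B1 = (\<Sum>i\<in>UNIV. \<Sum>j\<in>UNIV. adt i j * (wk i * wk j)) / 2
         + 2 * (\<Sum>i\<in>UNIV. \<Sum>k\<in>UNIV. V i * wk k * dY i k)
         - (\<Sum>k\<in>UNIV. Y k * (\<Sum>i\<in>UNIV. \<Sum>j\<in>UNIV. da k i j * (wk i * wk j)))
         + (f - Lp) * H"
  define B2 where "B2 = - dtq / 2 + (\<Sum>k\<in>UNIV. Y k * dq k) - (f - Lp) * q"
  have n1: "1 \<le> n" using card_gt_0_iff[of "UNIV :: 'n set"] by (simp add: n_def Suc_le_eq)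
  have c1: "0 \<le> c1" and c2: "0 \<le> c2" and c: "0 \<le> c"
    using n1 pos by (simp_all add: c1_def c2_def c_def)

  have Yb: "\<bar>Y k\<bar> \<le> n * (\<Lambda> * (b * \<sigma> / t))" for k
    unfolding n_def Y
    by (intro sum_abs_le_card, simp only: abs_mult, intro mult_mono a p abs_ge_zero) (use pos in simp)
  \<comment> \<open>The growth of \<open>\<nabla>\<psi>\<close> is paid for by the decay of the
    spatial derivatives of \<open>a\<close>; this makes \<open>dY\<close> and
    \<open>Y k * da k i j\<close> bounded by \<open>1 / t\<close> uniformly in
    \<open>x\<close>.\<close>
  have sr: "\<sigma> * \<rho> * x \<le> x" if "0 \<le> x" for x using mult_right_mono[OF sc(3) that] by simp
  have dYb: "\<bar>dY i k\<bar> \<le> c1 / t" for i k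
  proof -
    have "\<bar>da i k l * p l + a k l * pp i l\<bar> \<le> (Ec * b + 2 * \<Lambda> * b) / t" for l
    proof -
      have "\<bar>da i k l * p l\<bar> \<le> (Ec * \<rho>) * (b * \<sigma> / t)"
        unfolding abs_mult using pos sc by (intro mult_mono da p) auto
      also have "\<dots> \<le> Ec * b / t" using sr[of "Ec * b / t"] pos t by (simp add: mult_ac)
      finally have 1: "\<bar>da i k l * p l\<bar> \<le> Ec * b / t" .
      have "\<bar>a k l * pp i l\<bar> \<le> \<Lambda> * (2 * b / t)"
        unfolding abs_mult using pos by (intro mult_mono a pp) auto
      with 1 have "\<bar>da i k l * p l + a k l * pp i l\<bar> \<le> Ec * b / t + \<Lambda> * (2 * b / t)" by linarith
      thus ?thesis by (simp add: add_divide_distrib mult_ac)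
    qed
    from sum_abs_le_card[OF this] show ?thesis unfolding dY c1_def n_def by simp
  qed
  have Yda: "\<bar>Y k * da k i j\<bar> \<le> c2 / t" for k i j
  proof -
    have "\<bar>Y k * da k i j\<bar> \<le> n * (\<Lambda> * (b * \<sigma> / t)) * (Ec * \<rho>)"
      unfolding abs_mult using pos sc n1 t by (intro mult_mono da Yb) auto
    also have "\<dots> \<le> c2 / t" using sr[of "c2 / t"] c2 t by (simp add: c2_def mult_ac)
    finally show ?thesis .
  qed
  have Hq: "H = (\<Sum>i\<in>UNIV. \<Sum>j\<in>UNIV. a i j * (wk i * wk j))"
    unfolding H V by (simp add: sum_distrib_left sum_distrib_right mult_ac)
  have Hlow: "lam * g \<le> H" unfolding Hq g_def by (rule ell(1))
  have B1: "g \<le> B1"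
    unfolding B1_def Lp_def f
    by (rule first_order_bound[where ?c1.0=c1 and ?c2.0=c2 and M=M and \<Lambda>=\<Lambda> and a=a and lam=lam])
       (use t a adt V dYb Yda g_def Hlow pos D1 in \<open>simp_all add: n_def\<close>)

  have Nq: "N = (\<Sum>i\<in>UNIV. \<Sum>j\<in>UNIV. a i j * (p i * p j))"
    unfolding N_def Y by (simp add: sum_distrib_left sum_distrib_right mult_ac)
  have "0 \<le> lam * (\<Sum>k\<in>UNIV. (p k)\<^sup>2)" using pos by (intro mult_nonneg_nonneg sum_nonneg) auto
  also have "\<dots> \<le> N" unfolding Nq by (rule ell(1))
  finally have N0: "0 \<le> N" .
  have "N \<le> \<Lambda> * (\<Sum>k\<in>UNIV. (p k)\<^sup>2)" unfolding Nq by (rule ell(2))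
  also have "\<dots> \<le> \<Lambda> * (b\<^sup>2 * \<phi> / t\<^sup>2)" using pos p2 by (intro mult_left_mono) auto
  \<comment> \<open>The value of \<open>b\<close> gives
    \<open>\<Lambda> b^2 = b / 8\<close>.\<close>
  also have "\<dots> = b * \<phi> / (8 * t\<^sup>2)" using pos by (simp add: b power2_eq_square)
  finally have N1: "N \<le> b * \<phi> / (8 * t\<^sup>2)" .

  \<comment> \<open>The part of the zero order coefficient that involves derivatives of
    \<open>a\<close> or the Hessian of \<psi>. Its three sums are quadratic or cubic in \<psi>, and
    \<open>c\<close> is assembled from their bounds.\<close>
  define r where "r = - (\<Sum>i\<in>UNIV. \<Sum>j\<in>UNIV. adt i j * (p i * p j)) / 2
    + (\<Sum>k\<in>UNIV. Y k * (\<Sum>i\<in>UNIV. \<Sum>j\<in>UNIV. da k i j * (p i * p j)))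
    + 2 * (\<Sum>k\<in>UNIV. \<Sum>i\<in>UNIV. Y k * Y i * pp k i)"
  have Ydq: "(\<Sum>k\<in>UNIV. Y k * dq k) = (\<Sum>k\<in>UNIV. Y k * (\<Sum>i\<in>UNIV. \<Sum>j\<in>UNIV. da k i j * (p i * p j)))
      + 2 * (\<Sum>k\<in>UNIV. \<Sum>i\<in>UNIV. Y k * Y i * pp k i) + N / t"
  proof -
    have "(\<Sum>k\<in>UNIV. Y k * dq k) = (\<Sum>k\<in>UNIV. Y k * (\<Sum>i\<in>UNIV. \<Sum>j\<in>UNIV. da k i j * (p i * p j))
      + 2 * (\<Sum>i\<in>UNIV. Y k * Y i * pp k i) + Y k * p k / t)"
      by (intro sum.cong refl) (simp add: dq distrib_left sum_distrib_left mult_ac)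
    thus ?thesis by (simp only: sum.distrib sum_distrib_left[symmetric] sum_divide_distrib[symmetric] N_def)
  qed
  have B2r: "B2 = P * (K + 1) / 2 - (b * \<phi> + K) / (2 * t ^ 3) + 2 * N / t + r
      - (f - Lp) * (P * t - (b * \<phi> + K) / (2 * t\<^sup>2) + N)"
    unfolding B2_def Ydq dtq q N_def[symmetric] pt ptt r_def
    by (simp add: add_divide_distrib diff_divide_distrib) (simp add: algebra_simps)
  have rb: "\<bar>r\<bar> \<le> c * b * \<phi> / t ^ 3"
  proof -
    have \<sigma>\<phi>: "x * \<sigma>\<^sup>2 \<le> x * \<phi>" if "0 \<le> x" for x using sc(4) that by (rule mult_left_mono)
    have pij: "\<bar>p i * p j\<bar> \<le> b * \<sigma> / t * (b * \<sigma> / t)" for i j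
      unfolding abs_mult using pos sc t by (intro mult_mono p) auto
    have "\<bar>\<Sum>i\<in>UNIV. \<Sum>j\<in>UNIV. adt i j * (p i * p j)\<bar> \<le> n\<^sup>2 * (M * (b * \<sigma> / t * (b * \<sigma> / t)))"
      unfolding n_def using pos
      by (intro sum2_abs_le_card, simp only: abs_mult[of "adt _ _"], intro mult_mono adt pij abs_ge_zero) auto
    also have "\<dots> = n\<^sup>2 * M * b\<^sup>2 / t\<^sup>2 * \<sigma>\<^sup>2" by (simp add: power2_eq_square)
    also have "\<dots> \<le> n\<^sup>2 * M * b\<^sup>2 / t\<^sup>2 * \<phi>" using pos by (intro \<sigma>\<phi>) simp
    also have "\<dots> = n\<^sup>2 * M * b\<^sup>2 * \<phi> * (1 / t\<^sup>2)" by simp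
    also have "\<dots> \<le> n\<^sup>2 * M * b\<^sup>2 * \<phi> * (1 / t ^ 3)"
      using pos t sc by (intro mult_left_mono divide_left_mono power_decreasing) auto
    finally have r1: "\<bar>\<Sum>i\<in>UNIV. \<Sum>j\<in>UNIV. adt i j * (p i * p j)\<bar> \<le> n\<^sup>2 * M * b * (b * \<phi> / t ^ 3)"
      by (simp add: power2_eq_square)
    have "(\<Sum>k\<in>UNIV. Y k * (\<Sum>i\<in>UNIV. \<Sum>j\<in>UNIV. da k i j * (p i * p j)))
        = (\<Sum>k\<in>UNIV. \<Sum>i\<in>UNIV. \<Sum>j\<in>UNIV. (Y k * da k i j) * (p i * p j))"
      by (simp add: sum_distrib_left mult.assoc)
    also have "\<bar>\<dots>\<bar> \<le> n ^ 3 * (c2 / t * (b * \<sigma> / t * (b * \<sigma> / t)))"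
      unfolding n_def using c2 t
      by (intro sum3_abs_le_card, simp only: abs_mult[of "Y _ * da _ _ _"], intro mult_mono Yda pij abs_ge_zero) auto
    also have "\<dots> = n ^ 4 * \<Lambda> * Ec * b ^ 3 / t ^ 3 * \<sigma>\<^sup>2"
      by (simp add: c2_def power2_eq_square power3_eq_cube power4_eq_xxxx mult_ac)
    also have "\<dots> \<le> n ^ 4 * \<Lambda> * Ec * b ^ 3 / t ^ 3 * \<phi>" using pos t by (intro \<sigma>\<phi>) simp
    also have "\<dots> = n ^ 4 * \<Lambda> * Ec * b\<^sup>2 * (b * \<phi> / t ^ 3)"
      by (simp add: power2_eq_square power3_eq_cube)
    finally have r2: "\<bar>\<Sum>k\<in>UNIV. Y k * (\<Sum>i\<in>UNIV. \<Sum>j\<in>UNIV. da k i j * (p i * p j))\<bar>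
      \<le> n ^ 4 * \<Lambda> * Ec * b\<^sup>2 * (b * \<phi> / t ^ 3)" .
    have YY: "\<bar>Y k * Y i\<bar> \<le> n * (\<Lambda> * (b * \<sigma> / t)) * (n * (\<Lambda> * (b * \<sigma> / t)))" for k i
      unfolding abs_mult using pos n1 sc t by (intro mult_mono Yb) auto
    have "\<bar>\<Sum>k\<in>UNIV. \<Sum>i\<in>UNIV. Y k * Y i * pp k i\<bar>
        \<le> n\<^sup>2 * (n * (\<Lambda> * (b * \<sigma> / t)) * (n * (\<Lambda> * (b * \<sigma> / t))) * (2 * b / t))"
      unfolding n_def using pos n1 sc t
      by (intro sum2_abs_le_card, simp only: abs_mult[of "Y _ * Y _"], intro mult_mono pp YY[unfolded n_def] abs_ge_zero) auto
    also have "\<dots> = 2 * n ^ 4 * \<Lambda>\<^sup>2 * b ^ 3 / t ^ 3 * \<sigma>\<^sup>2"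
      by (simp add: power2_eq_square power3_eq_cube power4_eq_xxxx mult_ac)
    also have "\<dots> \<le> 2 * n ^ 4 * \<Lambda>\<^sup>2 * b ^ 3 / t ^ 3 * \<phi>" using pos t by (intro \<sigma>\<phi>) simp
    also have "\<dots> = 2 * n ^ 4 * \<Lambda>\<^sup>2 * b\<^sup>2 * (b * \<phi> / t ^ 3)"
      by (simp add: power2_eq_square power3_eq_cube)
    finally have r3: "\<bar>\<Sum>k\<in>UNIV. \<Sum>i\<in>UNIV. Y k * Y i * pp k i\<bar> \<le> 2 * n ^ 4 * \<Lambda>\<^sup>2 * b\<^sup>2 * (b * \<phi> / t ^ 3)" .
    have "c * b * \<phi> / t ^ 3 = n ^ 4 * \<Lambda> * Ec * b\<^sup>2 * (b * \<phi> / t ^ 3)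
        + 2 * (2 * n ^ 4 * \<Lambda>\<^sup>2 * b\<^sup>2 * (b * \<phi> / t ^ 3)) + n\<^sup>2 * M * b * (b * \<phi> / t ^ 3)"
      by (simp add: c_def algebra_simps add_divide_distrib)
    thus ?thesis unfolding r_def using r1 r2 r3 by linarith
  qed
  have Lpb: "\<bar>Lp\<bar> \<le> n * (c1 / t)"
    unfolding Lp_def n_def by (intro sum_abs_le_card dYb)
  have eb: "(D - n * c1) / t \<le> f - Lp" "f - Lp \<le> (D + n * c1) / t"
    using Lpb by (auto simp: f diff_divide_distrib add_divide_distrib)
  have CD: "n * c1 \<le> D" using D2 pos(5) c by argo
  have B2: "1 + 2 * b\<^sup>2 * \<phi> / t\<^sup>2 \<le> 2 * B2 - (f - Lp)\<^sup>2"
    unfolding B2r using t sc pos c c1 n1 CD N0 N1 eb rb K D2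
    by (intro zero_order_bound[where C="n * c1" and D=D and c=c]) auto

  have Lp: "(\<Sum>i\<in>UNIV. \<Sum>j\<in>UNIV. da i i j * p j + a i j * pp i j) = Lp"
    unfolding Lp_def dY ..
  have conj: "e * (vt + (\<Sum>i\<in>UNIV. \<Sum>j\<in>UNIV. da i i j * vk j + a i j * vv i j)) = (Lw + q * w) + T + (f - Lp) * w"
    using conjugated_operator[OF sym w wt wk ww Y q, where da=da and f=f] unfolding Lp T Lw_def .
  have RT: "(Lw + q * w) * T = (\<Sum>i\<in>UNIV. G i) + G0 + B1 + w\<^sup>2 * B2"
    unfolding Lw_def B1_def B2_def Lp_def
    by (rule rellich_identity[OF wwsym V H T dV dT dH dtH G G0])
  \<comment> \<open>The square of \<open>X - T\<close> is discarded, so \<open>T\<close> itself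
    needs no lower bound.\<close>
  have "4 * ((Lw + q * w) * T) \<le> (Lw + q * w + T)\<^sup>2"
    using zero_le_power2[of "Lw + q * w - T"] by (simp add: power2_eq_square algebra_simps)
  moreover have "(Lw + q * w + T)\<^sup>2 \<le> 2 * ((Lw + q * w) + T + (f - Lp) * w)\<^sup>2 + 2 * ((f - Lp) * w)\<^sup>2"
    using zero_le_power2[of "(Lw + q * w) + T + (f - Lp) * w + (f - Lp) * w"]
    by (simp add: power2_eq_square algebra_simps)
  ultimately have main: "2 * ((Lw + q * w) * T) - (f - Lp)\<^sup>2 * w\<^sup>2 \<le> (e * (vt + (\<Sum>i\<in>UNIV. \<Sum>j\<in>UNIV. da i i j * vk j + a i j * vv i j)))\<^sup>2"
    unfolding conj power_mult_distrib by linarith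
  have "(1 + 2 * b\<^sup>2 * \<phi> / t\<^sup>2) * w\<^sup>2 \<le> (2 * B2 - (f - Lp)\<^sup>2) * w\<^sup>2"
    using B2 by (intro mult_right_mono) auto
  hence low: "w\<^sup>2 + 2 * b\<^sup>2 * \<phi> / t\<^sup>2 * w\<^sup>2 \<le> 2 * (w\<^sup>2 * B2) - (f - Lp)\<^sup>2 * w\<^sup>2"
    by (simp add: algebra_simps)
  have "e\<^sup>2 * (v\<^sup>2 + (\<Sum>k\<in>UNIV. (vk k)\<^sup>2)) = w\<^sup>2 + (\<Sum>k\<in>UNIV. (wk k - p k * w)\<^sup>2)"
  proof -
    have "wk k - p k * w = e * vk k" for k by (simp add: wk w algebra_simps)
    thus ?thesis by (simp add: w power_mult_distrib sum_distrib_left distrib_left)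
  qed
  also have "\<dots> \<le> w\<^sup>2 + (2 * g + 2 * (\<Sum>k\<in>UNIV. (p k)\<^sup>2) * w\<^sup>2)"
    unfolding g_def by (intro add_left_mono sum_mult_square_diff_le)
  also have "2 * (\<Sum>k\<in>UNIV. (p k)\<^sup>2) * w\<^sup>2 \<le> 2 * b\<^sup>2 * \<phi> / t\<^sup>2 * w\<^sup>2"
    using p2 by (intro mult_right_mono) auto
  finally have "e\<^sup>2 * (v\<^sup>2 + (\<Sum>k\<in>UNIV. (vk k)\<^sup>2)) \<le> w\<^sup>2 + (2 * g + 2 * b\<^sup>2 * \<phi> / t\<^sup>2 * w\<^sup>2)" by simp
  thus ?thesis
    using main low B1 unfolding RT power_mult_distrib by argo
qed

subsection \<open>Smooth functions\<close>

abbreviation fderiv :: "'a::real_normed_vector \<Rightarrow> ('a \<Rightarrow> real) \<Rightarrow> 'a \<Rightarrow> real"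
  where "fderiv u f z \<equiv> frechet_derivative f (at z) u"

lemma has_dderiv_fderiv:
  assumes "\<And>k. Ck k f"
  shows "has_dderiv f u z (fderiv u f z)"
proof -
  have "(f has_derivative frechet_derivative f (at z)) (at z)"
    using assms[of "Suc 0"] by (simp add: frechet_derivative_works)
  thus ?thesis by (rule has_derivative_imp_has_dderiv)
qed

lemma Ck_fderiv: "(\<And>k. Ck k f) \<Longrightarrow> Ck k (fderiv u f)"
  by (metis Ck.simps(2))

lemma Ck_continuous: "(\<And>k. Ck k f) \<Longrightarrow> continuous_on UNIV f"
  by (metis Ck.simps(1))

lemma fderiv_commute:
  fixes f :: "'a::real_normed_vector \<Rightarrow> real"
  assumes f: "\<And>k. Ck k f"
  shows "fderiv u (fderiv u' f) z = fderiv u' (fderiv u f) z"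
proof (rule second_dderiv_commute[of f u' "fderiv u' f" u "fderiv u (fderiv u' f)" "fderiv u f" "fderiv u' (fderiv u f)"])
  show "has_dderiv f u' y (fderiv u' f y)" "has_dderiv f u y (fderiv u f y)" for y
    using f by (intro has_dderiv_fderiv; simp)+
  show "has_dderiv (fderiv u' f) u y (fderiv u (fderiv u' f) y)"
    "has_dderiv (fderiv u f) u' y (fderiv u' (fderiv u f) y)" for y
    using Ck_fderiv[OF f] by (intro has_dderiv_fderiv; simp)+
  have "continuous_on UNIV (fderiv u (fderiv u' f))" "continuous_on UNIV (fderiv u' (fderiv u f))"
    using Ck_fderiv[OF Ck_fderiv[OF f]] by (intro Ck_continuous; simp)+
  thus "isCont (fderiv u (fderiv u' f)) z" "isCont (fderiv u' (fderiv u f)) z"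
    by (simp_all add: continuous_on_eq_continuous_at)
qed

lemma fderiv_eq_0:
  assumes f: "\<And>k. Ck k f" and S: "closed S" "\<And>z. z \<notin> S \<Longrightarrow> f z = 0" and z: "z \<notin> S"
  shows "fderiv u f z = 0"
proof -
  have "has_dderiv f u z 0 \<longleftrightarrow> has_dderiv (\<lambda>_. 0) u z 0"
    by (rule has_dderiv_cong_open[of "- S"]) (use S z in auto)
  hence "has_dderiv f u z 0" by (simp add: has_dderiv_const)
  thus ?thesis using has_dderiv_unique has_dderiv_fderiv[OF f] by blast
qed

subsection \<open>Lipschitz functions on a compact convex set\<close>

text \<open>Hiding the constant lets the fluxes be treated by closure rules. Only the existence of
  some constant matters, as their derivatives integrate to 0 whatever its value.\<close>

definition lipschitz_fun_on :: "'a::metric_space set \<Rightarrow> ('a \<Rightarrow> real) \<Rightarrow> bool"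
  where "lipschitz_fun_on B f \<longleftrightarrow> (\<exists>L. L-lipschitz_on B f)"

lemma lipschitz_fun_on_const: "lipschitz_fun_on B (\<lambda>_. c)"
  unfolding lipschitz_fun_on_def by (intro exI[of _ 0] lipschitz_on_constant)

lemma lipschitz_fun_on_add:
  "lipschitz_fun_on B f \<Longrightarrow> lipschitz_fun_on B g \<Longrightarrow> lipschitz_fun_on B (\<lambda>z. f z + g z)"
  unfolding lipschitz_fun_on_def by (blast intro: lipschitz_on_add)

lemma lipschitz_fun_on_diff:
  "lipschitz_fun_on B f \<Longrightarrow> lipschitz_fun_on B g \<Longrightarrow> lipschitz_fun_on B (\<lambda>z. f z - g z)"
  unfolding lipschitz_fun_on_def by (blast intro: lipschitz_on_diff)

lemma lipschitz_fun_on_sum: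
  "(\<And>i. i \<in> I \<Longrightarrow> lipschitz_fun_on B (f i)) \<Longrightarrow> lipschitz_fun_on B (\<lambda>z. \<Sum>i\<in>I. f i z)"
  by (induction I rule: infinite_finite_induct) (auto intro: lipschitz_fun_on_const lipschitz_fun_on_add)

lemma lipschitz_fun_on_bounded:
  assumes "lipschitz_fun_on B f" and "compact B"
  obtains C where "0 \<le> C" "\<And>z. z \<in> B \<Longrightarrow> \<bar>f z\<bar> \<le> C"
proof -
  have "continuous_on B f"
    using assms(1) lipschitz_on_continuous_on unfolding lipschitz_fun_on_def by blast
  hence "compact (f ` B)" using assms(2) by (rule compact_continuous_image)
  then obtain C where "0 < C" "\<forall>y\<in>f ` B. norm y \<le> C"
    using bounded_pos compact_imp_bounded by blast
  thus ?thesis using that[of C] by auto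
qed

lemma lipschitz_fun_on_mult:
  assumes f: "lipschitz_fun_on B f" and g: "lipschitz_fun_on B g" and B: "compact B"
  shows "lipschitz_fun_on B (\<lambda>z. f z * g z)"
proof -
  obtain C where C: "0 \<le> C" "\<And>z. z \<in> B \<Longrightarrow> \<bar>f z\<bar> \<le> C" using lipschitz_fun_on_bounded[OF f B] by blast
  obtain C' where C': "0 \<le> C'" "\<And>z. z \<in> B \<Longrightarrow> \<bar>g z\<bar> \<le> C'" using lipschitz_fun_on_bounded[OF g B] by blast
  obtain L L' where L: "L-lipschitz_on B f" "L'-lipschitz_on B g"
    using f g unfolding lipschitz_fun_on_def by blast
  have "(C * L' + C' * L)-lipschitz_on B (\<lambda>z. f z * g z)"
  proof (rule lipschitz_onI)
    show "0 \<le> C * L' + C' * L" using C(1) C'(1) lipschitz_on_nonneg[OF L(1)] lipschitz_on_nonneg[OF L(2)] by simp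
    fix x y assume xy: "x \<in> B" "y \<in> B"
    have "f x * g x - f y * g y = f x * (g x - g y) + g y * (f x - f y)" by (simp add: algebra_simps)
    also have "\<bar>\<dots>\<bar> \<le> \<bar>f x\<bar> * \<bar>g x - g y\<bar> + \<bar>g y\<bar> * \<bar>f x - f y\<bar>"
      by (rule order_trans[OF abs_triangle_ineq]) (simp add: abs_mult)
    also have "\<dots> \<le> C * (L' * dist x y) + C' * (L * dist x y)"
      using C C' xy lipschitz_onD[OF L(1) xy] lipschitz_onD[OF L(2) xy]
      by (intro add_mono mult_mono) (auto simp: dist_real_def)
    finally show "dist (f x * g x) (f y * g y) \<le> (C * L' + C' * L) * dist x y"
      by (simp add: dist_real_def algebra_simps)
  qed
  thus ?thesis unfolding lipschitz_fun_on_def by blast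
qed

text \<open>The convex hull of the compact image is again compact and stays inside the convex set
  \<open>U\<close>; there \<open>g'\<close> is bounded and the mean value theorem applies.\<close>

lemma lipschitz_fun_on_compose:
  fixes g g' :: "real \<Rightarrow> real"
  assumes f: "lipschitz_fun_on B f" and B: "compact B" and U: "convex U" "f ` B \<subseteq> U"
    and g: "\<And>y. y \<in> U \<Longrightarrow> (g has_real_derivative g' y) (at y)" and g': "continuous_on U g'"
  shows "lipschitz_fun_on B (\<lambda>z. g (f z))"
proof -
  let ?H = "convex hull (f ` B)"
  have "continuous_on B f"
    using f lipschitz_on_continuous_on unfolding lipschitz_fun_on_def by blast
  hence H: "compact ?H" using B by (intro compact_convex_hull compact_continuous_image)
  have HU: "?H \<subseteq> U" using U by (rule hull_minimal[rotated])
  have "compact (g' ` ?H)" using H continuous_on_subset[OF g' HU] by (intro compact_continuous_image)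
  then obtain C where C: "0 < C" "\<forall>y\<in>g' ` ?H. norm y \<le> C"
    using bounded_pos compact_imp_bounded by blast
  have "C-lipschitz_on ?H g"
  proof (rule bounded_derivative_imp_lipschitz)
    show "(g has_derivative (*) (g' y)) (at y within ?H)" if "y \<in> ?H" for y
      using g HU that by (auto simp: has_field_derivative_def intro: has_derivative_at_withinI)
    show "onorm ((*) (g' y)) \<le> C" if "y \<in> ?H" for y
      using C that by (intro onorm_le) (auto simp: abs_mult intro!: mult_right_mono)
  qed (use C in auto)
  hence "C-lipschitz_on (f ` B) g" by (rule lipschitz_on_subset) (rule hull_subset)
  moreover obtain L where "L-lipschitz_on B f" using f unfolding lipschitz_fun_on_def by blast
  ultimately have "(C * L)-lipschitz_on B (\<lambda>z. g (f z))" by (intro lipschitz_on_compose2)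
  thus ?thesis unfolding lipschitz_fun_on_def by blast
qed

lemma lipschitz_fun_on_powr:
  assumes "lipschitz_fun_on B f" "compact B" "\<And>z. z \<in> B \<Longrightarrow> 0 < f z"
  shows "lipschitz_fun_on B (\<lambda>z. f z powr r)"
proof (rule lipschitz_fun_on_compose[OF assms(1,2), of "{0<..}" "\<lambda>y. y powr r" "\<lambda>y. r * y powr (r - 1)"])
  show "((\<lambda>y. y powr r) has_real_derivative r * y powr (r - 1)) (at y)" if "y \<in> {0<..}" for y
    using that by (auto intro!: has_real_derivative_powr)
  show "continuous_on {0<..} (\<lambda>y. r * y powr (r - 1))" by (intro continuous_intros) auto
qed (use assms(3) in auto)

lemma lipschitz_fun_on_exp:
  assumes "lipschitz_fun_on B f" "compact B"
  shows "lipschitz_fun_on B (\<lambda>z. exp (f z))"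
  by (rule lipschitz_fun_on_compose[OF assms, of UNIV exp exp]) (auto intro!: continuous_intros)

lemma lipschitz_fun_on_C1:
  fixes f :: "'a::euclidean_space \<Rightarrow> real"
  assumes f: "\<And>k. Ck k f" and B: "compact B" "convex B"
  shows "lipschitz_fun_on B f"
proof -
  have "continuous_on B (\<lambda>z. \<Sum>u\<in>Basis. \<bar>fderiv u f z\<bar>)"
    using Ck_continuous[OF Ck_fderiv[OF f]]
    by (intro continuous_intros) (auto intro: continuous_on_subset)
  hence "compact ((\<lambda>z. \<Sum>u\<in>Basis. \<bar>fderiv u f z\<bar>) ` B)" using B(1) by (rule compact_continuous_image)
  then obtain C where C: "0 < C" "\<forall>y\<in>(\<lambda>z. \<Sum>u\<in>Basis. \<bar>fderiv u f z\<bar>) ` B. norm y \<le> C"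
    using bounded_pos compact_imp_bounded by blast
  have "C-lipschitz_on B f"
  proof (rule bounded_derivative_imp_lipschitz)
    fix z assume z: "z \<in> B"
    have d: "(f has_derivative frechet_derivative f (at z)) (at z)"
      using f[of "Suc 0"] by (auto simp: frechet_derivative_works)
    thus "(f has_derivative frechet_derivative f (at z)) (at z within B)"
      by (rule has_derivative_at_withinI)
    have "onorm (frechet_derivative f (at z)) \<le> (\<Sum>u\<in>Basis. \<bar>fderiv u f z\<bar>)"
      using onorm_componentwise[OF has_derivative_bounded_linear[OF d]] by simp
    also have "\<dots> \<le> C" using C z by force
    finally show "onorm (frechet_derivative f (at z)) \<le> C" .
  qed (use B C in auto)
  thus ?thesis unfolding lipschitz_fun_on_def by blast
qed

subsection \<open>The Carleman weight\<close>

definition dir_x :: "'n \<Rightarrow> (real ^ 'n) \<times> real" where "dir_x k = (axis k 1, 0)"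
definition dir_t :: "(real ^ 'n) \<times> real" where "dir_t = (0, 1)"

lemma partial_x_eq: "has_dderiv f (dir_x k) z D \<Longrightarrow> partial_x k f z = D"
  unfolding has_dderiv_def partial_x_def dir_x_def
  by (cases z) (auto intro: DERIV_imp_deriv)

lemma partial_t_eq: "has_dderiv f dir_t z D \<Longrightarrow> partial_t f z = D"
proof -
  assume "has_dderiv f dir_t z D"
  hence "((\<lambda>h. f (fst z, snd z + h)) has_real_derivative D) (at 0)"
    unfolding has_dderiv_def dir_t_def by (cases z) auto
  hence "((\<lambda>s. f (fst z, s)) has_real_derivative D) (at (snd z))"
    using DERIV_shift[of "\<lambda>s. f (fst z, s)" D 0 "snd z"] by (simp add: add.commute)
  thus ?thesis unfolding partial_t_def by (rule DERIV_imp_deriv)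
qed

lemma has_dderiv_fst_dir_t: "has_dderiv (\<lambda>z. f (fst z)) dir_t z 0"
  by (simp add: has_dderiv_def dir_t_def)

lemma has_dderiv_snd_dir_x: "has_dderiv (\<lambda>z. f (snd z)) (dir_x k) z 0"
  by (simp add: has_dderiv_def dir_x_def)

lemma has_dderiv_snd_dir_t:
  assumes "(f has_real_derivative D) (at (snd z))"
  shows "has_dderiv (\<lambda>z. f (snd z)) dir_t z D"
  unfolding has_dderiv_def dir_t_def
  using DERIV_shift[of f D 0 "snd z"] assms by (simp add: add.commute)

lemma has_dderiv_component_dir_x:
  "has_dderiv (\<lambda>z. fst z $ k) (dir_x l) z (if k = l then 1 else 0)"
  unfolding has_dderiv_def dir_x_def by (auto simp: axis_def intro!: derivative_eq_intros)

lemma japanese_bracket_ge_1: "1 \<le> japanese_bracket x"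
  by (simp add: japanese_bracket_def)

lemma japanese_bracket_powr:
  "japanese_bracket x powr r = (1 + (norm x)\<^sup>2) powr (r / 2)"
  by (simp add: japanese_bracket_def powr_powr add_pos_nonneg flip: powr_half_sqrt)

lemma has_dderiv_japanese_bracket_powr:
  fixes z :: "(real ^ 'n) \<times> real"
  shows "has_dderiv (\<lambda>z. japanese_bracket (fst z) powr r) (dir_x k) z
    (r * japanese_bracket (fst z) powr (r - 2) * fst z $ k)"
proof -
  define x where "x = fst z"
  have sq: "(norm (x + h *\<^sub>R axis k 1))\<^sup>2 = (norm x)\<^sup>2 + 2 * h * x $ k + h\<^sup>2" for h
    unfolding power2_norm_eq_inner
    by (simp add: inner_add_left inner_add_right inner_axis inner_axis' power2_eq_square algebra_simps)
  have "((\<lambda>h. (1 + ((norm x)\<^sup>2 + 2 * h * x $ k + h\<^sup>2)) powr (r / 2)) has_real_derivative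
     r / 2 * (1 + (norm x)\<^sup>2) powr (r / 2 - 1) * (2 * x $ k)) (at 0)"
    by (auto intro!: derivative_eq_intros simp: add_pos_nonneg)
  also have "r / 2 * (1 + (norm x)\<^sup>2) powr (r / 2 - 1) * (2 * x $ k)
      = r * japanese_bracket x powr (r - 2) * x $ k"
    by (simp add: japanese_bracket_powr diff_divide_distrib)
  finally show ?thesis
    unfolding has_dderiv_def dir_x_def fst_add fst_scaleR fst_conv x_def[symmetric]
    unfolding japanese_bracket_powr sq .
qed

lemma powr_mult_self: "0 < (t :: real) \<Longrightarrow> t powr (r - 1) * t = t powr r"
  using powr_add[of t "r - 1" 1] by simp

section \<open>Derivatives and growth of the exponent of the weight\<close>

locale carleman_weight_fun =
  fixes \<alpha> b K \<gamma> :: real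
begin

definition phi :: "(real ^ 'n) \<times> real \<Rightarrow> real"
  where "phi z = japanese_bracket (fst z) powr \<alpha>"

definition psi :: "(real ^ 'n) \<times> real \<Rightarrow> real"
  where "psi z = \<gamma> * (snd z powr (- K) - 1) - (b * phi z + K) * (1 / (2 * snd z))"

definition psi_x :: "'n \<Rightarrow> (real ^ 'n) \<times> real \<Rightarrow> real"
  where "psi_x k z = - (1 / (2 * snd z)) * (b * (\<alpha> * japanese_bracket (fst z) powr (\<alpha> - 2) * fst z $ k))"

definition psi_xx :: "'n \<Rightarrow> 'n \<Rightarrow> (real ^ 'n) \<times> real \<Rightarrow> real"
  where "psi_xx k l z = - (1 / (2 * snd z)) * (b * (\<alpha> * ((\<alpha> - 2) * japanese_bracket (fst z) powr (\<alpha> - 4) * fst z $ k * fst z $ l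
    + japanese_bracket (fst z) powr (\<alpha> - 2) * (if l = k then 1 else 0))))"

text \<open>Normalised so that the \<gamma> parts of the first and second time derivative of
  \<open>psi\<close> are \<open>- gam z * t\<close> and \<open>gam z * (K + 1)\<close> with
  \<open>t = snd z\<close>; their comparison is then free of \<gamma>.\<close>

definition gam :: "(real ^ 'n) \<times> real \<Rightarrow> real"
  where "gam z = \<gamma> * K * snd z powr (- K - 2)"

definition psi_t :: "(real ^ 'n) \<times> real \<Rightarrow> real"
  where "psi_t z = - gam z * snd z + (b * phi z + K) * (1 / (2 * (snd z)\<^sup>2))"

definition psi_tt :: "(real ^ 'n) \<times> real \<Rightarrow> real"
  where "psi_tt z = gam z * (K + 1) - (b * phi z + K) / snd z ^ 3"

lemma carleman_weight_eq: "carleman_weight \<alpha> b K \<gamma> z = (exp (psi z))\<^sup>2"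
  by (simp add: carleman_weight_def psi_def phi_def power2_eq_square exp_add[symmetric] field_simps)

lemma has_dderiv_phi:
  "has_dderiv phi (dir_x k) z (\<alpha> * japanese_bracket (fst z) powr (\<alpha> - 2) * fst z $ k)"
  "has_dderiv phi dir_t z 0"
  unfolding phi_def[abs_def]
  by (rule has_dderiv_japanese_bracket_powr) (rule has_dderiv_fst_dir_t)

lemmas has_dderiv_intros = has_dderiv_add has_dderiv_diff has_dderiv_mult has_dderiv_const has_dderiv_minus

lemma has_dderiv_psi:
  assumes "0 < snd z"
  shows "has_dderiv psi (dir_x k) z (psi_x k z)" "has_dderiv psi dir_t z (psi_t z)"
proof -
  show "has_dderiv psi (dir_x k) z (psi_x k z)"
    unfolding psi_def[abs_def]
    by (rule has_dderiv_eq_rhs, (rule has_dderiv_intros has_dderiv_phi has_dderiv_snd_dir_x)+)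
       (simp add: psi_x_def)
  have 1: "has_dderiv (\<lambda>z. snd z powr (- K)) dir_t z (- K * snd z powr (- K - 1))"
    using assms by (intro has_dderiv_snd_dir_t has_real_derivative_powr)
  have 2: "has_dderiv (\<lambda>z. 1 / (2 * snd z)) dir_t z (- 1 / (2 * (snd z)\<^sup>2))"
    using assms by (intro has_dderiv_snd_dir_t) (auto intro!: derivative_eq_intros simp: power2_eq_square)
  have "- K - 2 = - K - 1 - 1" by simp
  hence 3: "snd z powr (- K - 2) * snd z = snd z powr (- K - 1)"
    using powr_mult_self[OF assms] by metis
  show "has_dderiv psi dir_t z (psi_t z)"
    unfolding psi_def[abs_def]
    by (rule has_dderiv_eq_rhs, (rule 1 2 has_dderiv_intros has_dderiv_phi)+)
       (simp add: psi_t_def gam_def mult.assoc 3)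
qed

lemma has_dderiv_psi_x:
  assumes "0 < snd z"
  shows "has_dderiv (psi_x l) (dir_x k) z (psi_xx k l z)" "has_dderiv (psi_x k) dir_t z (- psi_x k z / snd z)"
proof -
  have 1: "has_dderiv (\<lambda>z. japanese_bracket (fst z) powr (\<alpha> - 2)) (dir_x k) z
      ((\<alpha> - 2) * japanese_bracket (fst z) powr (\<alpha> - 4) * fst z $ k)"
    using has_dderiv_japanese_bracket_powr[of "\<alpha> - 2" k z] by simp
  show "has_dderiv (psi_x l) (dir_x k) z (psi_xx k l z)"
    unfolding psi_x_def[abs_def]
    by (rule has_dderiv_eq_rhs, (rule 1 has_dderiv_component_dir_x has_dderiv_intros has_dderiv_snd_dir_x)+)
       (simp add: psi_xx_def algebra_simps)
  have 2: "has_dderiv (\<lambda>z. 1 / (2 * snd z)) dir_t z (- 1 / (2 * (snd z)\<^sup>2))"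
    using assms by (intro has_dderiv_snd_dir_t) (auto intro!: derivative_eq_intros simp: power2_eq_square)
  show "has_dderiv (psi_x k) dir_t z (- psi_x k z / snd z)"
    unfolding psi_x_def[abs_def]
    by (rule has_dderiv_eq_rhs, (rule 2 has_dderiv_fst_dir_t has_dderiv_mult has_dderiv_minus)+)
       (simp add: power2_eq_square)
qed

lemma has_dderiv_psi_t:
  assumes "0 < snd z"
  shows "has_dderiv psi_t (dir_x k) z (- psi_x k z / snd z)" "has_dderiv psi_t dir_t z (psi_tt z)"
proof -
  show "has_dderiv psi_t (dir_x k) z (- psi_x k z / snd z)"
    unfolding psi_t_def[abs_def] gam_def[abs_def]
    by (rule has_dderiv_eq_rhs, (rule has_dderiv_intros has_dderiv_phi has_dderiv_snd_dir_x)+)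
       (simp add: psi_x_def power2_eq_square)
  have 1: "has_dderiv (\<lambda>z. snd z powr (- K - 2)) dir_t z ((- K - 2) * snd z powr (- K - 2 - 1))"
    using assms by (intro has_dderiv_snd_dir_t has_real_derivative_powr)
  have 2: "has_dderiv (\<lambda>z. 1 / (2 * (snd z)\<^sup>2)) dir_t z (- 1 / snd z ^ 3)"
    using assms
    by (intro has_dderiv_snd_dir_t)
      (auto intro!: derivative_eq_intros simp: power2_eq_square power3_eq_cube field_simps)
  have 3: "has_dderiv (\<lambda>z. snd z) dir_t z 1"
    by (intro has_dderiv_snd_dir_t) (auto intro!: derivative_eq_intros)
  have "snd z powr (- K - 2 - 1) * snd z = snd z powr (- K - 2)"
    using assms by (rule powr_mult_self)
  hence "(- K - 2) * snd z powr (- K - 2 - 1) * snd z + snd z powr (- K - 2) = - (K + 1) * snd z powr (- K - 2)"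
    by (simp add: mult.assoc algebra_simps)
  moreover have "psi_tt z = - (\<gamma> * K) * (- (K + 1) * snd z powr (- K - 2)) - (b * phi z + K) / snd z ^ 3"
    by (simp add: psi_tt_def gam_def algebra_simps)
  ultimately have 4: "psi_tt z = - (\<gamma> * K) * ((- K - 2) * snd z powr (- K - 2 - 1) * snd z + snd z powr (- K - 2))
      - (b * phi z + K) / snd z ^ 3" by (simp only:)
  show "has_dderiv psi_t dir_t z (psi_tt z)"
    unfolding psi_t_def[abs_def] gam_def[abs_def]
    by (rule has_dderiv_eq_rhs, (rule 1 2 3 has_dderiv_intros has_dderiv_phi)+)
       (simp add: 4 algebra_simps)
qed

lemma abs_component_le_japanese_bracket: "\<bar>(x :: real ^ 'n) $ k\<bar> \<le> japanese_bracket x"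
proof -
  have "\<bar>x $ k\<bar> \<le> sqrt ((norm x)\<^sup>2)" using component_le_norm_cart[of x k] by simp
  also have "\<dots> \<le> japanese_bracket x" unfolding japanese_bracket_def by (rule real_sqrt_le_mono) simp
  finally show ?thesis .
qed

lemma japanese_bracket_powr_mult: "japanese_bracket x powr (r - 1) * japanese_bracket x = japanese_bracket x powr r"
  using powr_mult_self[of "japanese_bracket x"] japanese_bracket_ge_1[of x] by simp

lemma weight_bounds:
  fixes z :: "(real ^ 'n) \<times> real"
  assumes \<alpha>: "0 \<le> \<alpha>" "\<alpha> \<le> 2" and b: "0 < b" and t: "0 < snd z"
  shows "\<bar>psi_x k z\<bar> \<le> b * japanese_bracket (fst z) powr (\<alpha> - 1) / snd z"
    and "\<bar>psi_xx k l z\<bar> \<le> 2 * b / snd z"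
    and "(\<Sum>k\<in>UNIV. (psi_x k z)\<^sup>2) \<le> b\<^sup>2 * phi z / (snd z)\<^sup>2"
proof -
  define s where "s = japanese_bracket (fst z)"
  have s1: "1 \<le> s" unfolding s_def by (rule japanese_bracket_ge_1)
  have xs: "\<bar>fst z $ k\<bar> \<le> s" for k unfolding s_def by (rule abs_component_le_japanese_bracket)
  have sm: "s powr (r - 1) * s = s powr r" for r unfolding s_def by (rule japanese_bracket_powr_mult)
  have "\<alpha> * s powr (\<alpha> - 2) * \<bar>fst z $ k\<bar> \<le> 2 * s powr (\<alpha> - 2) * s"
    using \<alpha> xs s1 by (intro mult_mono) auto
  also have "\<dots> = 2 * s powr (\<alpha> - 1)" using sm[of "\<alpha> - 1"] by simp
  finally have "b * (\<alpha> * s powr (\<alpha> - 2) * \<bar>fst z $ k\<bar>) / (2 * snd z) \<le> b * (2 * s powr (\<alpha> - 1)) / (2 * snd z)"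
    using b t by (intro divide_right_mono mult_left_mono) auto
  thus "\<bar>psi_x k z\<bar> \<le> b * japanese_bracket (fst z) powr (\<alpha> - 1) / snd z"
    using \<alpha> b t by (simp add: psi_x_def s_def abs_mult)
  have le1: "s powr (\<alpha> - 2) \<le> 1" using s1 \<alpha> powr_mono[of "\<alpha> - 2" 0 s] by simp
  have "\<bar>(\<alpha> - 2) * s powr (\<alpha> - 4) * fst z $ k * fst z $ l\<bar> \<le> (2 - \<alpha>) * s powr (\<alpha> - 4) * s * s"
    unfolding abs_mult using \<alpha> xs s1 by (intro mult_mono) auto
  also have "\<dots> = (2 - \<alpha>) * s powr (\<alpha> - 2)"
    using sm[of "\<alpha> - 3"] sm[of "\<alpha> - 2"] by (simp add: mult.assoc)
  finally have 1: "\<bar>(\<alpha> - 2) * s powr (\<alpha> - 4) * fst z $ k * fst z $ l\<bar> \<le> (2 - \<alpha>) * s powr (\<alpha> - 2)" .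
  have 2: "\<bar>s powr (\<alpha> - 2) * (if l = k then 1 else 0)\<bar> \<le> s powr (\<alpha> - 2)" by simp
  define X where "X = (\<alpha> - 2) * s powr (\<alpha> - 4) * fst z $ k * fst z $ l + s powr (\<alpha> - 2) * (if l = k then 1 else 0)"
  have "\<bar>X\<bar> \<le> (2 - \<alpha>) * s powr (\<alpha> - 2) + s powr (\<alpha> - 2)"
    unfolding X_def by (rule order_trans[OF abs_triangle_ineq add_mono[OF 1 2]])
  also have "\<dots> = (3 - \<alpha>) * s powr (\<alpha> - 2)" by (simp add: algebra_simps)
  also have "\<dots> \<le> (3 - \<alpha>) * 1" using \<alpha> le1 by (intro mult_left_mono) auto
  finally have "\<alpha> * \<bar>X\<bar> \<le> \<alpha> * (3 - \<alpha>)" using \<alpha> by (intro mult_left_mono) auto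
  \<comment> \<open>The maximum over \<alpha> is 9/4; the rounder 4 turns the factor
    \<open>b / (2 t)\<close> into \<open>2 b / t\<close>.\<close>
  also have "\<dots> \<le> 4" using zero_le_power2[of "\<alpha> - 3/2"] by (simp add: power2_eq_square algebra_simps)
  finally have "b * (\<alpha> * \<bar>X\<bar>) / (2 * snd z) \<le> b * 4 / (2 * snd z)"
    using b t by (intro divide_right_mono mult_left_mono) auto
  moreover have "\<bar>psi_xx k l z\<bar> = b * (\<alpha> * \<bar>X\<bar>) / (2 * snd z)"
    using \<alpha> b t unfolding psi_xx_def s_def[symmetric] X_def[symmetric] by (simp add: abs_mult)
  ultimately show "\<bar>psi_xx k l z\<bar> \<le> 2 * b / snd z" by simp
  have "(\<Sum>k\<in>UNIV. (psi_x k z)\<^sup>2) = (b * (\<alpha> * s powr (\<alpha> - 2)) / (2 * snd z))\<^sup>2 * (\<Sum>k\<in>UNIV. (fst z $ k)\<^sup>2)"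
    unfolding sum_distrib_left
    by (intro sum.cong refl) (simp add: psi_x_def s_def power_mult_distrib power_divide mult_ac)
  also have "(\<Sum>k\<in>UNIV. (fst z $ k)\<^sup>2) = (norm (fst z))\<^sup>2"
    by (simp add: norm_vec_def L2_set_def sum_nonneg)
  also have "(b * (\<alpha> * s powr (\<alpha> - 2)) / (2 * snd z))\<^sup>2 * (norm (fst z))\<^sup>2
      = (b * (\<alpha> * s powr (\<alpha> - 2)) / (2 * snd z) * norm (fst z))\<^sup>2" by (rule power_mult_distrib[symmetric])
  also have "\<dots> \<le> (b * (2 * s powr (\<alpha> - 2)) / (2 * snd z) * s)\<^sup>2"
  proof -
    have "norm (fst z) \<le> s" unfolding s_def japanese_bracket_def
      by (rule real_le_rsqrt) simp
    thus ?thesis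
      using \<alpha> b t s1 by (intro power_mono mult_mono divide_right_mono mult_left_mono mult_right_mono mult_nonneg_nonneg divide_nonneg_pos) auto
  qed
  also have "\<dots> = (b / snd z * (s powr (\<alpha> - 2) * s))\<^sup>2" by (simp add: mult.assoc)
  also have "s powr (\<alpha> - 2) * s = s powr (\<alpha> - 1)" using sm[of "\<alpha> - 1"] by simp
  also have "(b / snd z * s powr (\<alpha> - 1))\<^sup>2 = b\<^sup>2 / (snd z)\<^sup>2 * (s powr (\<alpha> - 1))\<^sup>2"
    by (simp add: power_mult_distrib power_divide)
  \<comment> \<open>This is \<open>2 (\<alpha> - 1) \<le> \<alpha>\<close>, that is
    \<open>\<alpha> \<le> 2\<close>.\<close>
  also have "(s powr (\<alpha> - 1))\<^sup>2 \<le> phi z"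
    unfolding phi_def s_def[symmetric] power2_eq_square powr_add[symmetric] using s1 \<alpha> by (intro powr_mono) auto
  hence "b\<^sup>2 / (snd z)\<^sup>2 * (s powr (\<alpha> - 1))\<^sup>2 \<le> b\<^sup>2 / (snd z)\<^sup>2 * phi z"
    by (rule mult_left_mono) simp
  finally show "(\<Sum>k\<in>UNIV. (psi_x k z)\<^sup>2) \<le> b\<^sup>2 * phi z / (snd z)\<^sup>2" by simp
qed

lemma scale_bounds:
  assumes \<alpha>: "0 \<le> \<alpha>" "\<alpha> \<le> 2" and \<beta>: "\<alpha> - 1 \<le> \<beta>"
  shows "japanese_bracket (fst z) powr (\<alpha> - 1) * japanese_bracket (fst z) powr (- \<beta>) \<le> 1"
    and "(japanese_bracket (fst z) powr (\<alpha> - 1))\<^sup>2 \<le> phi z" and "1 \<le> phi z"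
proof -
  define s where "s = japanese_bracket (fst z)"
  have s1: "1 \<le> s" unfolding s_def by (rule japanese_bracket_ge_1)
  show "japanese_bracket (fst z) powr (\<alpha> - 1) * japanese_bracket (fst z) powr (- \<beta>) \<le> 1"
    unfolding s_def[symmetric] powr_add[symmetric] using s1 \<beta> powr_mono[of "\<alpha> - 1 + - \<beta>" 0 s] by simp
  show "(japanese_bracket (fst z) powr (\<alpha> - 1))\<^sup>2 \<le> phi z"
    unfolding phi_def s_def[symmetric] power2_eq_square powr_add[symmetric] using s1 \<alpha> by (intro powr_mono) auto
  show "1 \<le> phi z"
    unfolding phi_def s_def[symmetric] using s1 \<alpha> by (intro ge_one_powr_ge_zero)
qed

end

subsection \<open>The Carleman estimate\<close>

text \<open>Clamping the time to \<open>[0, 1]\<close> is a 1-Lipschitz retraction onto the strip,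
  so composing with it extends \<open>f\<close> to the whole space. The extension agrees with
  \<open>f\<close> near each point of the open strip, hence has the same line derivatives
  there.\<close>

lemma AE_has_dderiv_strip:
  fixes f :: "(real ^ 'n) \<times> real \<Rightarrow> real"
  assumes lip: "L-lipschitz_on (UNIV \<times> {0..1}) f"
  shows "AE z in lebesgue. z \<in> UNIV \<times> {0<..<1} \<longrightarrow> (\<exists>D. has_dderiv f u z D)"
proof -
  define c :: "(real ^ 'n) \<times> real \<Rightarrow> (real ^ 'n) \<times> real" where "c z = (fst z, max 0 (min 1 (snd z)))" for z
  have cl: "1-lipschitz_on UNIV c"
  proof (rule lipschitz_onI)
    fix x y :: "(real ^ 'n) \<times> real"
    have "dist (snd (c x)) (snd (c y)) \<le> dist (snd x) (snd y)"
      by (auto simp: c_def dist_real_def)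
    thus "dist (c x) (c y) \<le> 1 * dist x y"
      by (simp add: dist_prod_def c_def real_sqrt_le_mono power_mono)
  qed simp
  have "c ` UNIV \<subseteq> UNIV \<times> {0..1}" by (auto simp: c_def)
  hence "(L * 1)-lipschitz_on UNIV (\<lambda>z. f (c z))"
    by (intro lipschitz_on_compose2[OF cl] lipschitz_on_subset[OF lip])
  from lipschitz_imp_AE_has_dderiv[OF this]
  have "AE z in lebesgue. \<exists>D. has_dderiv (\<lambda>z. f (c z)) u z D" by (rule AE_completion)
  thus ?thesis
  proof eventually_elim
    case (elim z)
    have "open ((UNIV :: (real ^ 'n) set) \<times> {0<..<1::real})" by (intro open_Times) auto
    hence "z \<in> UNIV \<times> {0<..<1} \<Longrightarrow> has_dderiv (\<lambda>z. f (c z)) u z D \<longleftrightarrow> has_dderiv f u z D" for D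
      by (rule has_dderiv_cong_open) (auto simp: c_def)
    thus ?case using elim by blast
  qed
qed

lemma has_dderiv_le_lipschitz:
  fixes F :: "'a::real_normed_vector \<Rightarrow> real"
  assumes lip: "L-lipschitz_on UNIV F" and D: "has_dderiv F u z D"
  shows "\<bar>D\<bar> \<le> L * norm u"
proof -
  have "((\<lambda>h. \<bar>(F (z + h *\<^sub>R u) - F z) / h\<bar>) \<longlongrightarrow> \<bar>D\<bar>) (at 0)"
    using D by (intro tendsto_rabs) (simp add: has_dderiv_def has_field_derivative_iff)
  moreover have "\<forall>\<^sub>F h in at 0. \<bar>(F (z + h *\<^sub>R u) - F z) / h\<bar> \<le> L * norm u"
  proof -
    have "\<bar>(F (z + h *\<^sub>R u) - F z) / h\<bar> \<le> L * norm u" if "h \<noteq> 0" for h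
      using lipschitz_onD[OF lip, of "z + h *\<^sub>R u" z] that
      by (auto simp: dist_norm field_simps abs_mult)
    thus ?thesis by (auto simp: eventually_at_filter)
  qed
  ultimately show ?thesis by (rule tendsto_upperbound) simp
qed

lemma lipschitz_fun_on_cong:
  "(\<And>z. z \<in> B \<Longrightarrow> f z = g z) \<Longrightarrow> lipschitz_fun_on B g \<Longrightarrow> lipschitz_fun_on B f"
  unfolding lipschitz_fun_on_def by (auto simp: lipschitz_on_def)

lemma lipschitz_fun_on_minus: "lipschitz_fun_on B f \<Longrightarrow> lipschitz_fun_on B (\<lambda>z. - f z)"
  using lipschitz_fun_on_diff[OF lipschitz_fun_on_const[of B 0]] by simp

lemma lipschitz_fun_on_snd: "lipschitz_fun_on B snd"
  unfolding lipschitz_fun_on_def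
  by (intro exI[of _ 1] lipschitz_onI) (auto simp: dist_snd_le)

lemma lipschitz_fun_on_component:
  fixes B :: "((real ^ 'n) \<times> real) set"
  shows "lipschitz_fun_on B (\<lambda>z. fst z $ k)"
  unfolding lipschitz_fun_on_def
proof (intro exI[of _ 1] lipschitz_onI)
  fix x y :: "(real ^ 'n) \<times> real"
  show "dist (fst x $ k) (fst y $ k) \<le> 1 * dist x y"
    using dist_vec_nth_le[of "fst x" k "fst y"] dist_fst_le[of x y] by simp
qed simp

lemma lipschitz_fun_on_japanese_bracket_powr:
  fixes B :: "('a::real_normed_vector \<times> 'b::metric_space) set"
  assumes "compact B"
  shows "lipschitz_fun_on B (\<lambda>z. japanese_bracket (fst z) powr r)"
proof -
  have n: "lipschitz_fun_on B (\<lambda>z. norm (fst z))"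
    unfolding lipschitz_fun_on_def
  proof (intro exI[of _ 1] lipschitz_onI)
    fix x y :: "'a \<times> 'b"
    show "dist (norm (fst x)) (norm (fst y)) \<le> 1 * dist x y"
      using norm_triangle_ineq3[of "fst x" "fst y"] dist_fst_le[of x y] by (simp add: dist_real_def dist_norm)
  qed simp
  show ?thesis
    unfolding japanese_bracket_powr power2_eq_square using assms
    by (intro lipschitz_fun_on_powr lipschitz_fun_on_add lipschitz_fun_on_mult lipschitz_fun_on_const n)
      (auto intro: add_pos_nonneg)
qed

text \<open>\<open>S\<close> carries \<open>v\<close>, and \<open>B\<close> is a compact convex
  neighbourhood of it inside the open strip: compactness keeps \<open>t\<close> away from 0, where
  the weight functions fail to be Lipschitz, and convexity makes smooth functions Lipschitz.\<close>

locale carleman_setting = carleman_weight_fun \<alpha> b K \<gamma> for \<alpha> b K \<gamma> :: real +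
  fixes \<beta> lam \<Lambda> M Ec D n c1 c2 c :: real and A :: "(real ^ 'n) \<times> real \<Rightarrow> real ^ 'n ^ 'n"
    and v :: "(real ^ 'n) \<times> real \<Rightarrow> real" and B S :: "((real ^ 'n) \<times> real) set"
  assumes \<alpha>: "0 \<le> \<alpha>" "\<alpha> \<le> 2" and \<beta>: "\<beta> = max 0 (\<alpha> - 1)"
    and pos: "0 < lam" "0 < \<Lambda>" "0 < M" "0 < Ec" "0 < K" "0 < \<gamma>" and b: "b = 1 / (8 * \<Lambda>)"
    and n: "n = real CARD('n)" and c1: "c1 = n * (Ec * b + 2 * \<Lambda> * b)" and c2: "c2 = n * \<Lambda> * b * Ec"
    and c: "c = n ^ 4 * \<Lambda> * Ec * b\<^sup>2 + 4 * n ^ 4 * \<Lambda>\<^sup>2 * b\<^sup>2 + n\<^sup>2 * M * b"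
    and D1: "1 + n\<^sup>2 * M / 2 + 2 * n ^ 3 * \<Lambda> * c1 + n ^ 3 * c2 \<le> lam * (D - n * c1)"
    and D2: "1 + b + 1/2 + c \<le> 3 / 8 * (D - n * c1)"
    and K: "2 * (D + n * c1) \<le> K" "(D + n * c1)\<^sup>2 + 1 \<le> K"
    and A_sym: "\<forall>z \<in> UNIV \<times> {0..1}. transpose (A z) = A z"
    and A_ell: "\<forall>z \<in> UNIV \<times> {0..1}. \<forall>\<xi> :: real ^ 'n.
        lam * (norm \<xi>)\<^sup>2 \<le> (\<Sum>i\<in>UNIV. \<Sum>j\<in>UNIV. A z $ i $ j * \<xi> $ i * \<xi> $ j) \<and>
        (\<Sum>i\<in>UNIV. \<Sum>j\<in>UNIV. A z $ i $ j * \<xi> $ i * \<xi> $ j) \<le> \<Lambda> * (norm \<xi>)\<^sup>2"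
    and A_lip: "\<forall>i j. \<exists>L. L-lipschitz_on (UNIV \<times> {0..1}) (\<lambda>z. A z $ i $ j)"
    and A_M: "\<forall>i j. AE z in lebesgue. z \<in> UNIV \<times> {0..1} \<longrightarrow>
        norm (grad_x (\<lambda>w. A w $ i $ j) z) + \<bar>partial_t (\<lambda>w. A w $ i $ j) z\<bar> \<le> M"
    and A_E: "\<forall>i j. AE z in lebesgue. z \<in> UNIV \<times> {0..1} \<longrightarrow>
        norm (grad_x (\<lambda>w. A w $ i $ j) z) \<le> Ec * japanese_bracket (fst z) powr (- \<beta>)"
    and v: "\<And>k. Ck k v" and v0: "\<And>z. z \<notin> S \<Longrightarrow> v z = 0"
    and S: "compact S" "S \<subseteq> interior B" and B: "compact B" "convex B" "B \<subseteq> UNIV \<times> {0<..<1}"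
begin

abbreviation "\<Omega> \<equiv> (UNIV :: (real ^ 'n) set) \<times> {0<..<1::real}"

lemma S_\<Omega>: "S \<subseteq> \<Omega>" using S(2) interior_subset B(3) by blast

lemma b0: "0 < b" using b pos by simp

section \<open>Coefficients and the exceptional null set\<close>

definition "a i j z = A z $ i $ j"
definition "da k i j z = partial_x k (a i j) z"
definition "adt i j z = partial_t (a i j) z"

lemma a_sym: "z \<in> \<Omega> \<Longrightarrow> a i j z = a j i z"
  using A_sym by (auto simp: a_def transpose_def vec_eq_iff)

lemma a_ell:
  assumes "z \<in> \<Omega>"
  shows "lam * (\<Sum>i\<in>UNIV. (x i)\<^sup>2) \<le> (\<Sum>i\<in>UNIV. \<Sum>j\<in>UNIV. a i j z * (x i * x j))"
    and "(\<Sum>i\<in>UNIV. \<Sum>j\<in>UNIV. a i j z * (x i * x j)) \<le> \<Lambda> * (\<Sum>i\<in>UNIV. (x i)\<^sup>2)"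
proof -
  have z: "z \<in> UNIV \<times> {0..1}" using assms by auto
  have [simp]: "(norm (\<chi> i. x i))\<^sup>2 = (\<Sum>i\<in>UNIV. (x i)\<^sup>2)"
    by (simp add: norm_vec_def L2_set_def sum_nonneg)
  show "lam * (\<Sum>i\<in>UNIV. (x i)\<^sup>2) \<le> (\<Sum>i\<in>UNIV. \<Sum>j\<in>UNIV. a i j z * (x i * x j))"
    "(\<Sum>i\<in>UNIV. \<Sum>j\<in>UNIV. a i j z * (x i * x j)) \<le> \<Lambda> * (\<Sum>i\<in>UNIV. (x i)\<^sup>2)"
    using A_ell[rule_format, OF z, of "\<chi> i. x i"] by (auto simp: a_def mult.assoc)
qed

text \<open>Polarisation: with \<open>Q\<close> the quadratic form, \<open>4 a i j\<close> is the
  difference of its values at the sum and the difference of two unit vectors. Both values lie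
  between 0 and \<open>4 \<Lambda>\<close>, so the difference is at most \<open>4 \<Lambda>\<close>
  in absolute value, also for \<open>i = j\<close>.\<close>

lemma a_bound:
  assumes z: "z \<in> \<Omega>"
  shows "\<bar>a i j z\<bar> \<le> \<Lambda>"
proof -
  define Q where "Q x = (\<Sum>i\<in>UNIV. \<Sum>j\<in>UNIV. a i j z * (x i * x j))" for x
  define d where "d i k = (if k = i then 1 else 0 :: real)" for i k :: 'n
  have d: "(\<Sum>k\<in>UNIV. d i k * f k) = f i" for i f
  proof -
    have "(\<Sum>k\<in>UNIV. d i k * f k) = (\<Sum>k\<in>UNIV. if k = i then f k else 0)"
      by (intro sum.cong) (auto simp: d_def)
    thus ?thesis by simp
  qed
  have d1: "(\<Sum>k\<in>UNIV. d i k) = 1" for i using d[of i "\<lambda>_. 1"] by simp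
  have 1: "(\<Sum>k\<in>UNIV. \<Sum>l\<in>UNIV. a k l z * (d i k * d j l)) = a i j z" for i j
  proof -
    have "(\<Sum>k\<in>UNIV. \<Sum>l\<in>UNIV. a k l z * (d i k * d j l)) = (\<Sum>k\<in>UNIV. d i k * (\<Sum>l\<in>UNIV. d j l * a k l z))"
      by (simp add: sum_distrib_left mult_ac)
    thus ?thesis by (simp add: d)
  qed
  have "Q (\<lambda>k. d i k + d j k) - Q (\<lambda>k. d i k - d j k)
      = (\<Sum>k\<in>UNIV. \<Sum>l\<in>UNIV. 2 * (a k l z * (d i k * d j l)) + 2 * (a k l z * (d j k * d i l)))"
    unfolding Q_def sum_subtractf[symmetric] by (intro sum.cong refl) (simp add: algebra_simps)
  also have "\<dots> = 2 * a i j z + 2 * a j i z"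
    by (simp only: sum.distrib sum_distrib_left[symmetric] 1)
  finally have eq: "4 * a i j z = Q (\<lambda>k. d i k + d j k) - Q (\<lambda>k. d i k - d j k)"
    using a_sym[OF z, of j i] by simp
  have "(d i k + d j k)\<^sup>2 \<le> 2 * d i k + 2 * d j k" "(d i k - d j k)\<^sup>2 \<le> 2 * d i k + 2 * d j k" for k
    by (auto simp: d_def)
  hence "(\<Sum>k\<in>UNIV. (d i k + d j k)\<^sup>2) \<le> (\<Sum>k\<in>UNIV. 2 * d i k + 2 * d j k)"
    "(\<Sum>k\<in>UNIV. (d i k - d j k)\<^sup>2) \<le> (\<Sum>k\<in>UNIV. 2 * d i k + 2 * d j k)"
    by (auto intro: sum_mono)
  moreover have "(\<Sum>k\<in>UNIV. 2 * d i k + 2 * d j k) = 4"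
    by (simp only: sum.distrib sum_distrib_left[symmetric] d1)
  ultimately have n: "(\<Sum>k\<in>UNIV. (d i k + d j k)\<^sup>2) \<le> 4" "(\<Sum>k\<in>UNIV. (d i k - d j k)\<^sup>2) \<le> 4"
    by simp_all
  have q: "0 \<le> Q x \<and> Q x \<le> \<Lambda> * 4" if "(\<Sum>k\<in>UNIV. (x k)\<^sup>2) \<le> 4" for x
  proof
    have "0 \<le> lam * (\<Sum>i\<in>UNIV. (x i)\<^sup>2)" using pos by (intro mult_nonneg_nonneg sum_nonneg) auto
    also have "\<dots> \<le> Q x" unfolding Q_def by (rule a_ell(1)[OF z])
    finally show "0 \<le> Q x" .
    have "Q x \<le> \<Lambda> * (\<Sum>i\<in>UNIV. (x i)\<^sup>2)" unfolding Q_def by (rule a_ell(2)[OF z])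
    also have "\<dots> \<le> \<Lambda> * 4" using that pos by (intro mult_left_mono) auto
    finally show "Q x \<le> \<Lambda> * 4" .
  qed
  show ?thesis using eq q[OF n(1)] q[OF n(2)] by linarith
qed

definition good :: "(real ^ 'n) \<times> real \<Rightarrow> bool"
  where "good z \<longleftrightarrow> (\<forall>i j. (\<forall>k. has_dderiv (a i j) (dir_x k) z (da k i j z) \<and>
      \<bar>da k i j z\<bar> \<le> Ec * japanese_bracket (fst z) powr (- \<beta>)) \<and>
    has_dderiv (a i j) dir_t z (adt i j z) \<and> \<bar>adt i j z\<bar> \<le> M)"

lemma AE_good: "AE z in lebesgue. z \<in> \<Omega> \<longrightarrow> good z"
proof -
  have 0: "AE z in lebesgue. z \<in> \<Omega> \<longrightarrow> (\<exists>D. has_dderiv (a i j) u z D)" for i j u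
  proof -
    obtain L where "L-lipschitz_on (UNIV \<times> {0..1}) (a i j)" using A_lip unfolding a_def[abs_def] by blast
    thus ?thesis by (rule AE_has_dderiv_strip)
  qed
  have 1: "AE z in lebesgue. \<forall>i j k. z \<in> \<Omega> \<longrightarrow> (\<exists>D. has_dderiv (a i j) (dir_x k) z D)"
    by (intro eventually_all_finite 0)
  have 2: "AE z in lebesgue. \<forall>i j. z \<in> \<Omega> \<longrightarrow> (\<exists>D. has_dderiv (a i j) dir_t z D)"
    by (intro eventually_all_finite 0)
  have 3: "AE z in lebesgue. \<forall>i j. z \<in> UNIV \<times> {0..1} \<longrightarrow>
        norm (grad_x (a i j) z) + \<bar>adt i j z\<bar> \<le> M"
    using A_M unfolding a_def[abs_def] adt_def by (intro eventually_all_finite) blast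
  have 4: "AE z in lebesgue. \<forall>i j. z \<in> UNIV \<times> {0..1} \<longrightarrow>
        norm (grad_x (a i j) z) \<le> Ec * japanese_bracket (fst z) powr (- \<beta>)"
    using A_E unfolding a_def[abs_def] by (intro eventually_all_finite) blast
  from 1 2 3 4 show ?thesis
  proof eventually_elim
    case (elim z)
    show ?case
    proof
      assume z: "z \<in> \<Omega>"
      hence z': "z \<in> UNIV \<times> {0..1}" by auto
      have "\<bar>da k i j z\<bar> \<le> norm (grad_x (a i j) z)" for i j k
        using component_le_norm_cart[of "grad_x (a i j) z" k] by (simp add: grad_x_def da_def)
      hence "\<bar>da k i j z\<bar> \<le> Ec * japanese_bracket (fst z) powr (- \<beta>)" for i j k
        using elim(4) z' order_trans by blast
      moreover have "\<bar>adt i j z\<bar> \<le> M" for i j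
      proof -
        have "norm (grad_x (a i j) z) + \<bar>adt i j z\<bar> \<le> M" using elim(3) z' by blast
        thus ?thesis using norm_ge_zero[of "grad_x (a i j) z"] by linarith
      qed
      moreover have "has_dderiv (a i j) (dir_x k) z (da k i j z)" for i j k
        using elim(1) z partial_x_eq unfolding da_def by blast
      moreover have "has_dderiv (a i j) dir_t z (adt i j z)" for i j
        using elim(2) z partial_t_eq unfolding adt_def by blast
      ultimately show "good z" unfolding good_def by blast
    qed
  qed
qed

section \<open>The conjugated function and its derivatives\<close>

definition "vk k = fderiv (dir_x k) v"
definition "vt = fderiv dir_t v"
definition "e z = exp (psi z)"
definition "w z = e z * v z"
definition "wk k z = e z * (vk k z + psi_x k z * v z)"
definition "wt z = e z * (vt z + psi_t z * v z)"
definition "ww i j z = e z * (fderiv (dir_x i) (vk j) z + psi_xx i j z * v z + psi_x j z * vk i z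
    + psi_x i z * vk j z + psi_x i z * psi_x j z * v z)"
text \<open>One expression for both mixed derivatives, of \<open>wk\<close> in time and of
  \<open>wt\<close> in space; their equality removes the mixed terms from Rellich's
  identity.\<close>

definition "wtk k z = e z * (fderiv (dir_x k) vt z + psi_t z * vk k z + psi_x k z * vt z
    + psi_t z * psi_x k z * v z - psi_x k z / snd z * v z)"

lemma dv: "has_dderiv v (dir_x k) z (vk k z)" "has_dderiv v dir_t z (vt z)"
  unfolding vk_def vt_def by (intro has_dderiv_fderiv v)+

lemma dvk: "has_dderiv (vk k) u z (fderiv u (vk k) z)" and dvt: "has_dderiv vt u z (fderiv u vt z)"
  unfolding vk_def vt_def by (intro has_dderiv_fderiv Ck_fderiv v)+

lemma de:
  assumes "z \<in> \<Omega>"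
  shows "has_dderiv e (dir_x k) z (e z * psi_x k z)" "has_dderiv e dir_t z (e z * psi_t z)"
  unfolding e_def[abs_def] using assms
  by (auto intro!: has_dderiv_chain[of exp] DERIV_exp has_dderiv_psi)

lemma dw:
  assumes z: "z \<in> \<Omega>"
  shows "has_dderiv w (dir_x k) z (wk k z)" "has_dderiv w dir_t z (wt z)"
  unfolding w_def[abs_def]
  by (rule has_dderiv_eq_rhs, (rule has_dderiv_mult de[OF z] dv)+, simp add: wk_def wt_def algebra_simps)+

lemma dwk:
  assumes z: "z \<in> \<Omega>"
  shows "has_dderiv (wk j) (dir_x i) z (ww i j z)" "has_dderiv (wk k) dir_t z (wtk k z)"
proof -
  have t: "0 < snd z" using z by auto
  show "has_dderiv (wk j) (dir_x i) z (ww i j z)"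
    unfolding wk_def[abs_def]
    by (rule has_dderiv_eq_rhs, (rule has_dderiv_mult has_dderiv_add de[OF z] dv dvk has_dderiv_psi_x[OF t])+)
      (simp add: ww_def algebra_simps)
  have c: "fderiv dir_t (vk k) z = fderiv (dir_x k) vt z"
    unfolding vk_def vt_def using v by (rule fderiv_commute)
  show "has_dderiv (wk k) dir_t z (wtk k z)"
    unfolding wk_def[abs_def]
    by (rule has_dderiv_eq_rhs, (rule has_dderiv_mult has_dderiv_add de[OF z] dv dvk has_dderiv_psi_x[OF t])+)
      (simp add: wtk_def c algebra_simps)
qed

lemma dwt:
  assumes z: "z \<in> \<Omega>"
  shows "has_dderiv wt (dir_x k) z (wtk k z)"
proof -
  have t: "0 < snd z" using z by auto
  show ?thesis
    unfolding wt_def[abs_def]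
    by (rule has_dderiv_eq_rhs, (rule has_dderiv_mult has_dderiv_add de[OF z] dv dvt has_dderiv_psi_t[OF t])+)
      (simp add: wtk_def algebra_simps)
qed

lemma ww_sym: "ww i j z = ww j i z"
proof -
  have "fderiv (dir_x i) (vk j) z = fderiv (dir_x j) (vk i) z"
    unfolding vk_def using v by (rule fderiv_commute)
  moreover have "psi_xx i j z = psi_xx j i z" by (simp add: psi_xx_def mult_ac)
  ultimately show ?thesis by (simp add: ww_def algebra_simps)
qed

definition "V i z = (\<Sum>j\<in>UNIV. a i j z * wk j z)"
definition "Y k z = (\<Sum>l\<in>UNIV. a k l z * psi_x l z)"
text \<open>\<open>H\<close> and \<open>q\<close> are double sums in \<open>a\<close> so that their
  derivatives follow from polarisation, without a general derivative of \<open>V\<close>.\<close>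

definition "H z = (\<Sum>i\<in>UNIV. \<Sum>j\<in>UNIV. a i j z * (wk i z * wk j z))"
definition "q z = (\<Sum>i\<in>UNIV. \<Sum>j\<in>UNIV. a i j z * (psi_x i z * psi_x j z)) - psi_t z"
text \<open>\<open>D / t\<close> is constant in \<open>x\<close>, and the fluxes need
  \<open>T\<close> differentiated in space only, so no derivative of \<open>f\<close> ever
  appears.\<close>

definition "T z = wt z - 2 * (\<Sum>k\<in>UNIV. Y k z * wk k z) - D * (1 / snd z) * w z"
definition "F i z = V i z * T z + Y i z * H z - q z * (Y i z * (w z * w z))"
definition "F0 z = (q z * (w z * w z) - H z) * (1 / 2)"

text \<open>Formal derivatives, built from the total functions \<open>da\<close> and
  \<open>adt\<close>; they are actual ones at good points of the strip.\<close>

definition "dV i z = (\<Sum>j\<in>UNIV. da i i j z * wk j z + a i j z * ww i j z)"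
definition "dY i k z = (\<Sum>l\<in>UNIV. da i k l z * psi_x l z + a k l z * psi_xx i l z)"
definition "dH k z = (\<Sum>i\<in>UNIV. \<Sum>j\<in>UNIV. da k i j z * (wk i z * wk j z)) + 2 * (\<Sum>i\<in>UNIV. V i z * ww k i z)"
definition "dtH z = (\<Sum>i\<in>UNIV. \<Sum>j\<in>UNIV. adt i j z * (wk i z * wk j z)) + 2 * (\<Sum>i\<in>UNIV. V i z * wtk i z)"
definition "dq k z = (\<Sum>i\<in>UNIV. \<Sum>j\<in>UNIV. da k i j z * (psi_x i z * psi_x j z))
    + 2 * (\<Sum>i\<in>UNIV. Y i z * psi_xx k i z) + psi_x k z / snd z"
definition "dtq z = (\<Sum>i\<in>UNIV. \<Sum>j\<in>UNIV. adt i j z * (psi_x i z * psi_x j z))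
    - 2 * (\<Sum>k\<in>UNIV. Y k z * psi_x k z) / snd z - psi_tt z"
definition "dT i z = wtk i z - 2 * (\<Sum>k\<in>UNIV. dY i k z * wk k z + Y k z * ww i k z) - D / snd z * wk i z"
definition "G i z = dV i z * T z + V i z * dT i z + (dY i i z * H z + Y i z * dH i z)
      - (dq i z * (Y i z * (w z)\<^sup>2) + q z * (dY i i z * (w z)\<^sup>2 + Y i z * (2 * w z * wk i z)))"
definition "G0 z = (dtq z * (w z)\<^sup>2 + q z * (2 * w z * wt z) - dtH z) / 2"

lemma dF:
  assumes z: "z \<in> \<Omega>" and g: "good z"
  shows "has_dderiv (F i) (dir_x i) z (G i z)" "has_dderiv F0 dir_t z (G0 z)"
proof -
  have t: "0 < snd z" using z by auto
  have sym: "a i j z = a j i z" for i j using z by (rule a_sym)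
  have dax: "has_dderiv (a i j) (dir_x k) z (da k i j z)" for i j k using g by (simp add: good_def)
  have dat: "has_dderiv (a i j) dir_t z (adt i j z)" for i j using g by (simp add: good_def)
  note px = has_dderiv_psi_x[OF t] and wk = dwk[OF z]
  have dV: "has_dderiv (V i) (dir_x i) z (dV i z)" for i
    unfolding V_def[abs_def]
    by (rule has_dderiv_eq_rhs, (rule has_dderiv_sum has_dderiv_mult dax wk)+) (simp add: dV_def)
  have dY: "has_dderiv (Y k) (dir_x i) z (dY i k z)" for i k
    unfolding Y_def[abs_def]
    by (rule has_dderiv_eq_rhs, (rule has_dderiv_sum has_dderiv_mult dax px)+) (simp add: dY_def)
  have dH: "has_dderiv H (dir_x k) z (dH k z)" for k
  proof (rule has_dderiv_eq_rhs)
    show "has_dderiv H (dir_x k) z (\<Sum>i\<in>UNIV. \<Sum>j\<in>UNIV. da k i j z * (wk i z * wk j z)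
        + a i j z * (ww k i z * wk j z + wk i z * ww k j z))"
      unfolding H_def[abs_def] by (intro has_dderiv_sum has_dderiv_mult dax wk)
    show "\<dots> = dH k z"
      unfolding sum.distrib dH_def V_def
      by (subst sum_symmetric_polar[of "\<lambda>i j. a i j z", OF sym]) simp
  qed
  have dtH: "has_dderiv H dir_t z (dtH z)"
  proof (rule has_dderiv_eq_rhs)
    show "has_dderiv H dir_t z (\<Sum>i\<in>UNIV. \<Sum>j\<in>UNIV. adt i j z * (wk i z * wk j z)
        + a i j z * (wtk i z * wk j z + wk i z * wtk j z))"
      unfolding H_def[abs_def] by (intro has_dderiv_sum has_dderiv_mult dat wk)
    show "\<dots> = dtH z"
      unfolding sum.distrib dtH_def V_def
      by (subst sum_symmetric_polar[of "\<lambda>i j. a i j z", OF sym]) simp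
  qed
  have dq: "has_dderiv q (dir_x k) z (dq k z)" for k
  proof (rule has_dderiv_eq_rhs)
    show "has_dderiv q (dir_x k) z ((\<Sum>i\<in>UNIV. \<Sum>j\<in>UNIV. da k i j z * (psi_x i z * psi_x j z)
        + a i j z * (psi_xx k i z * psi_x j z + psi_x i z * psi_xx k j z)) - (- psi_x k z / snd z))"
      unfolding q_def[abs_def] by (intro has_dderiv_diff has_dderiv_sum has_dderiv_mult dax px has_dderiv_psi_t[OF t])
    show "\<dots> = dq k z"
      unfolding sum.distrib dq_def Y_def
      by (subst sum_symmetric_polar[of "\<lambda>i j. a i j z", OF sym]) simp
  qed
  have dtq: "has_dderiv q dir_t z (dtq z)"
  proof (rule has_dderiv_eq_rhs)
    show "has_dderiv q dir_t z ((\<Sum>i\<in>UNIV. \<Sum>j\<in>UNIV. adt i j z * (psi_x i z * psi_x j z)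
        + a i j z * ((- psi_x i z / snd z) * psi_x j z + psi_x i z * (- psi_x j z / snd z))) - psi_tt z)"
      unfolding q_def[abs_def] by (intro has_dderiv_diff has_dderiv_sum has_dderiv_mult dat px has_dderiv_psi_t[OF t])
    show "\<dots> = dtq z"
      unfolding sum.distrib dtq_def Y_def
      by (subst sum_symmetric_polar[of "\<lambda>i j. a i j z", OF sym])
        (simp add: sum_negf sum_divide_distrib[symmetric] sum_distrib_right[symmetric])
  qed
  have dT: "has_dderiv T (dir_x i) z (dT i z)" for i
    unfolding T_def[abs_def]
    by (rule has_dderiv_eq_rhs, (rule has_dderiv_diff has_dderiv_sum has_dderiv_mult dwt[OF z] dY wk dw[OF z]
        has_dderiv_const has_dderiv_snd_dir_x)+) (simp add: dT_def)
  show "has_dderiv (F i) (dir_x i) z (G i z)"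
    unfolding F_def[abs_def]
    by (rule has_dderiv_eq_rhs, (rule has_dderiv_diff has_dderiv_add has_dderiv_mult dV dT dY dH dq dw[OF z])+)
      (simp add: G_def power2_eq_square algebra_simps)
  show "has_dderiv F0 dir_t z (G0 z)"
    unfolding F0_def[abs_def]
    by (rule has_dderiv_eq_rhs, (rule has_dderiv_diff has_dderiv_mult dtq dtH dw[OF z] has_dderiv_const)+)
      (simp add: G0_def power2_eq_square algebra_simps)
qed

lemma zero_outside:
  assumes "z \<notin> S"
  shows "v z = 0" "vk k z = 0" "vt z = 0" "fderiv u (vk k) z = 0" "w z = 0" "wk k z = 0" "wt z = 0"
    "V i z = 0" "H z = 0" "T z = 0" "F i z = 0" "F0 z = 0"
proof -
  have cl: "closed S" using S(1) by (rule compact_imp_closed)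
  show 1: "v z = 0" using assms by (rule v0)
  have vk: "vk k z = 0" if "z \<notin> S" for k z
    unfolding vk_def using v cl v0 that by (rule fderiv_eq_0)
  show 2: "vk k z = 0" for k using assms by (rule vk)
  show 3: "vt z = 0" unfolding vt_def using v cl v0 assms by (rule fderiv_eq_0)
  show "fderiv u (vk k) z = 0"
    by (rule fderiv_eq_0[OF _ cl vk assms]) (use Ck_fderiv[OF v] in \<open>simp_all add: vk_def\<close>)
  show 4: "w z = 0" by (simp add: w_def 1)
  show 5: "wk k z = 0" for k by (simp add: wk_def 1 2)
  show 6: "wt z = 0" by (simp add: wt_def 1 3)
  show 7: "V i z = 0" for i by (simp add: V_def 5)
  show 8: "H z = 0" by (simp add: H_def 5)
  show 9: "T z = 0" by (simp add: T_def 4 5 6)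
  show "F i z = 0" "F0 z = 0" by (simp_all add: F_def F0_def 4 7 8 9)
qed

lemma has_dderiv_outside:
  assumes "\<And>z. z \<notin> S \<Longrightarrow> f z = 0" and "z \<notin> S"
  shows "has_dderiv f u z 0"
proof -
  have "has_dderiv f u z 0 \<longleftrightarrow> has_dderiv (\<lambda>_. 0) u z 0"
    by (rule has_dderiv_cong_open[of "- S"]) (use assms compact_imp_closed[OF S(1)] in auto)
  thus ?thesis by (simp add: has_dderiv_const)
qed

section \<open>Lipschitz continuity and integrals of the fluxes\<close>

lemma snd_pos: "z \<in> B \<Longrightarrow> 0 < snd z" using B(3) by auto

lemma lip_basic:
  "lipschitz_fun_on B (a i j)" "lipschitz_fun_on B v" "lipschitz_fun_on B (vk k)" "lipschitz_fun_on B vt"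
  "lipschitz_fun_on B (\<lambda>z. snd z powr r)" "lipschitz_fun_on B phi"
proof -
  obtain L where "L-lipschitz_on (UNIV \<times> {0..1}) (a i j)" using A_lip unfolding a_def[abs_def] by blast
  moreover have "B \<subseteq> UNIV \<times> {0..1}" using B(3) by auto
  ultimately show "lipschitz_fun_on B (a i j)"
    unfolding lipschitz_fun_on_def using lipschitz_on_subset by blast
  show "lipschitz_fun_on B v" "lipschitz_fun_on B (vk k)" "lipschitz_fun_on B vt"
    unfolding vk_def vt_def using B by (intro lipschitz_fun_on_C1 Ck_fderiv v; simp)+
  show "lipschitz_fun_on B (\<lambda>z. snd z powr r)"
    using B(1) snd_pos by (intro lipschitz_fun_on_powr lipschitz_fun_on_snd)
  show "lipschitz_fun_on B phi"
    unfolding phi_def[abs_def] using B(1) by (rule lipschitz_fun_on_japanese_bracket_powr)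
qed

lemma lip_inverse_powers: "lipschitz_fun_on B (\<lambda>z. 1 / snd z)" "lipschitz_fun_on B (\<lambda>z. 1 / (2 * snd z))"
  "lipschitz_fun_on B (\<lambda>z. 1 / (2 * (snd z)\<^sup>2))"
proof -
  have p: "lipschitz_fun_on B (\<lambda>z. snd z powr (- 1))" by (rule lip_basic)
  show 1: "lipschitz_fun_on B (\<lambda>z. 1 / snd z)"
  proof (rule lipschitz_fun_on_cong[OF _ p])
    fix z assume "z \<in> B"
    hence "0 < snd z" by (rule snd_pos)
    thus "1 / snd z = snd z powr (- 1)" by (simp add: powr_minus_divide)
  qed
  show "lipschitz_fun_on B (\<lambda>z. 1 / (2 * snd z))"
    by (rule lipschitz_fun_on_cong[OF _ lipschitz_fun_on_mult[OF lipschitz_fun_on_const[of B "1 / 2"] 1 B(1)]]) simp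
  show "lipschitz_fun_on B (\<lambda>z. 1 / (2 * (snd z)\<^sup>2))"
    by (rule lipschitz_fun_on_cong[OF _ lipschitz_fun_on_mult[OF lipschitz_fun_on_const[of B "1 / 2"]
        lipschitz_fun_on_mult[OF 1 1 B(1)] B(1)]]) (simp add: power2_eq_square)
qed

lemma lip_weight: "lipschitz_fun_on B e" "lipschitz_fun_on B (psi_x k)" "lipschitz_fun_on B psi_t"
proof -
  note intros = lipschitz_fun_on_exp lipschitz_fun_on_mult lipschitz_fun_on_add lipschitz_fun_on_diff
    lipschitz_fun_on_minus lipschitz_fun_on_const lip_basic lip_inverse_powers
    lipschitz_fun_on_japanese_bracket_powr lipschitz_fun_on_component lipschitz_fun_on_snd B(1)
  show "lipschitz_fun_on B e"
    unfolding e_def[abs_def] psi_def[abs_def] by (intro intros)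
  show "lipschitz_fun_on B (psi_x k)"
    unfolding psi_x_def[abs_def] by (intro intros)
  show "lipschitz_fun_on B psi_t"
    unfolding psi_t_def[abs_def] gam_def[abs_def] by (intro intros)
qed

lemma lip_w: "lipschitz_fun_on B w" "lipschitz_fun_on B (wk k)" "lipschitz_fun_on B wt"
  unfolding w_def[abs_def] wk_def[abs_def] wt_def[abs_def]
  by (intro lipschitz_fun_on_mult lipschitz_fun_on_add lip_basic lip_weight B(1))+

lemma lip_F: "lipschitz_fun_on B (F i)" "lipschitz_fun_on B F0"
proof -
  note intros = lipschitz_fun_on_mult lipschitz_fun_on_add lipschitz_fun_on_diff lipschitz_fun_on_sum
    lipschitz_fun_on_const lip_basic lip_weight lip_w lip_inverse_powers B(1)
  have Y: "lipschitz_fun_on B (Y k)" for k unfolding Y_def[abs_def] by (intro intros)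
  have V: "lipschitz_fun_on B (V k)" for k unfolding V_def[abs_def] by (intro intros)
  have H: "lipschitz_fun_on B H" unfolding H_def[abs_def] by (intro intros)
  have q: "lipschitz_fun_on B q" unfolding q_def[abs_def] by (intro intros)
  have T: "lipschitz_fun_on B T" unfolding T_def[abs_def] by (intro intros Y)
  show "lipschitz_fun_on B (F i)" "lipschitz_fun_on B F0"
    unfolding F_def[abs_def] F0_def[abs_def] by (intro intros Y V H q T)+
qed

lemma lipschitz_compact_support:
  assumes "lipschitz_fun_on B f" and "\<And>z. z \<notin> S \<Longrightarrow> f z = 0"
  obtains L where "L-lipschitz_on UNIV f"
  using assms lipschitz_on_zero_extension[OF _ S] unfolding lipschitz_fun_on_def by metis

text \<open>Outside the open strip the formula \<open>g\<close> need not be a derivative, so it is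
  replaced by 0. This is correct there because \<open>f\<close> vanishes on the open complement of
  \<open>S\<close>.\<close>

lemma has_bochner_integral_flux:
  assumes f: "lipschitz_fun_on B f" "\<And>z. z \<notin> S \<Longrightarrow> f z = 0"
    and g: "\<And>z. z \<in> \<Omega> \<Longrightarrow> good z \<Longrightarrow> has_dderiv f u z (g z)"
  shows "has_bochner_integral lebesgue (\<lambda>z. if z \<in> \<Omega> then g z else 0) 0"
proof -
  obtain L where L: "L-lipschitz_on UNIV f" using f by (rule lipschitz_compact_support)
  show ?thesis
  proof (rule has_bochner_integral_dderiv[OF L S(1) f(2)])
    show "AE z in lebesgue. has_dderiv f u z (if z \<in> \<Omega> then g z else 0)"
      using AE_good
    proof eventually_elim
      case (elim z)
      show ?case
      proof (cases "z \<in> \<Omega>")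
        case True thus ?thesis using elim g by simp
      next
        case False
        hence "z \<notin> S" using S_\<Omega> by blast
        hence "has_dderiv f u z 0" using f(2) by (intro has_dderiv_outside)
        thus ?thesis using False by simp
      qed
    qed
  qed
qed

lemma integrable_compact_support:
  assumes "lipschitz_fun_on B f" "\<And>z. z \<notin> S \<Longrightarrow> f z = 0"
  shows "integrable lebesgue f"
proof -
  obtain L where "L-lipschitz_on UNIV f" using assms by (rule lipschitz_compact_support)
  hence "continuous_on UNIV f" by (rule lipschitz_on_continuous_on)
  hence "integrable lborel f"
    using S(1) assms(2) by (rule integrable_continuous_compact_support)
  thus ?thesis by (simp add: integrable_completion)
qed

lemma bounded_compact_support:
  assumes "lipschitz_fun_on B f" "\<And>z. z \<notin> S \<Longrightarrow> f z = 0"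
  obtains C where "\<And>z. \<bar>f z\<bar> \<le> C"
proof -
  obtain C where C: "0 \<le> C" "\<And>z. z \<in> B \<Longrightarrow> \<bar>f z\<bar> \<le> C"
    using lipschitz_fun_on_bounded[OF assms(1) B(1)] by blast
  have "\<bar>f z\<bar> \<le> C" for z
  proof (cases "z \<in> S")
    case True
    hence "z \<in> B" using S(2) interior_subset by blast
    thus ?thesis by (rule C(2))
  qed (use C(1) assms(2)[of z] in simp)
  thus ?thesis by (rule that)
qed

section \<open>Integrability of both sides\<close>

definition "lhs z = (w z * w z) + (\<Sum>k\<in>UNIV. (e z * vk k z) * (e z * vk k z))"

lemma lhs_eq: "lhs z = (e z)\<^sup>2 * ((v z)\<^sup>2 + (\<Sum>k\<in>UNIV. (vk k z)\<^sup>2))"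
  by (simp add: lhs_def w_def power2_eq_square distrib_left sum_distrib_left mult_ac)

lemma grad_x_v: "(norm (grad_x v z))\<^sup>2 = (\<Sum>k\<in>UNIV. (vk k z)\<^sup>2)"
proof -
  have "grad_x v z = (\<chi> k. vk k z)" unfolding grad_x_def using dv(1) partial_x_eq by metis
  thus ?thesis by (simp add: norm_vec_def L2_set_def sum_nonneg)
qed

lemma lhs_set_integrand:
  "indicator \<Omega> z *\<^sub>R (carleman_weight \<alpha> b K \<gamma> z * (\<bar>v z\<bar>\<^sup>2 + (norm (grad_x v z))\<^sup>2)) = lhs z"
proof (cases "z \<in> \<Omega>")
  case True
  thus ?thesis by (simp add: lhs_eq grad_x_v carleman_weight_eq e_def)
next
  case False
  hence "z \<notin> S" using S_\<Omega> by blast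
  thus ?thesis using False by (simp add: lhs_def zero_outside)
qed

lemma integrable_lhs: "integrable lebesgue lhs"
proof (rule integrable_compact_support)
  show "lipschitz_fun_on B lhs"
    unfolding lhs_def[abs_def]
    by (intro lipschitz_fun_on_mult lipschitz_fun_on_add lipschitz_fun_on_sum lip_w lip_basic lip_weight B(1))
qed (simp add: lhs_def zero_outside)

definition "Pv z = vt z + (\<Sum>i\<in>UNIV. \<Sum>j\<in>UNIV. da i i j z * vk j z + a i j z * fderiv (dir_x i) (vk j) z)"

lemma parabolic_op_v:
  assumes "good z"
  shows "parabolic_op A v z = Pv z"
proof -
  have "partial_x j v = vk j" for j using dv(1) partial_x_eq by blast
  moreover have "partial_x i (\<lambda>w. A w $ i $ j * vk j w) z = da i i j z * vk j z + a i j z * fderiv (dir_x i) (vk j) z" for i j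
    unfolding a_def[symmetric]
    by (intro partial_x_eq has_dderiv_mult dvk) (use assms in \<open>simp add: good_def\<close>)
  moreover have "partial_t v z = vt z" using dv(2) by (rule partial_t_eq)
  ultimately show ?thesis by (simp add: parabolic_op_def Pv_def)
qed

definition "rhs z = indicator \<Omega> z *\<^sub>R (carleman_weight \<alpha> b K \<gamma> z * \<bar>parabolic_op A v z\<bar>\<^sup>2)"

lemma rhs_eq: "z \<in> \<Omega> \<Longrightarrow> good z \<Longrightarrow> rhs z = (e z)\<^sup>2 * (Pv z)\<^sup>2"
  by (simp add: rhs_def carleman_weight_eq e_def parabolic_op_v)

text \<open>Monotonicity of the Bochner integral needs an integrable right side, yet
  \<open>P v\<close> contains derivatives of merely Lipschitz coefficients. They are recovered from
  the derivative \<open>g\<close> of the compactly supported Lipschitz function \<open>f\<close>,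
  from which the derivative of the weight is removed by \<open>h\<close>. Integrability of
  \<open>g\<close> gives measurability of \<open>Q\<close>, and the Lipschitz constants of
  \<open>f\<close> bound it at good points.\<close>

lemma integrable_rhs: "integrable lebesgue rhs"
proof -
  define f where "f i j z = a i j z * (e z * vk j z)" for i j z
  define g where "g i j z = da i i j z * (e z * vk j z)
    + a i j z * (e z * psi_x i z * vk j z + e z * fderiv (dir_x i) (vk j) z)" for i j z
  define h where "h i j z = a i j z * (e z * psi_x i z * vk j z)" for i j z
  define Q where "Q z = e z * vt z + (\<Sum>i\<in>UNIV. \<Sum>j\<in>UNIV. (if z \<in> \<Omega> then g i j z else 0) - h i j z)" for z
  note intros = lipschitz_fun_on_mult lip_basic lip_weight B(1)
  have f: "lipschitz_fun_on B (f i j)" "z \<notin> S \<Longrightarrow> f i j z = 0" for i j z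
    unfolding f_def[abs_def] by ((intro intros)[1], simp add: zero_outside)
  have h: "lipschitz_fun_on B (h i j)" "z \<notin> S \<Longrightarrow> h i j z = 0" for i j z
    unfolding h_def[abs_def] by ((intro intros)[1], simp add: zero_outside)
  have ev: "lipschitz_fun_on B (\<lambda>z. e z * vt z)" "z \<notin> S \<Longrightarrow> e z * vt z = 0" for z
    by ((intro intros)[1], simp add: zero_outside)
  have g: "has_dderiv (f i j) (dir_x i) z (g i j z)" if "z \<in> \<Omega>" "good z" for i j z
    unfolding f_def[abs_def] g_def
    by (intro has_dderiv_mult de[OF that(1)] dvk) (use that(2) in \<open>simp add: good_def\<close>)
  have gi: "integrable lebesgue (\<lambda>z. if z \<in> \<Omega> then g i j z else 0)" for i j
    using has_bochner_integral_flux[OF f g] has_bochner_integral_iff by blast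
  have Qm: "Q \<in> borel_measurable lebesgue"
    unfolding Q_def[abs_def]
    using gi integrable_compact_support[OF h] integrable_compact_support[OF ev]
    by (intro borel_measurable_add borel_measurable_sum borel_measurable_diff borel_measurable_integrable)
  have Q0: "Q z = 0" if "z \<notin> S" for z
  proof -
    have "g i j z = 0" for i j using that by (simp add: g_def zero_outside)
    thus ?thesis using that by (simp add: Q_def h zero_outside cong: if_cong)
  qed
  have QP: "Q z = e z * Pv z" if "z \<in> \<Omega>" for z
    using that by (simp add: Q_def g_def h_def Pv_def distrib_left sum_distrib_left algebra_simps)
  have "\<exists>C. \<forall>z. \<bar>h i j z\<bar> \<le> C" for i j using bounded_compact_support[OF h] by metis
  then obtain Ch where Ch: "\<And>i j z. \<bar>h i j z\<bar> \<le> Ch i j" by metis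
  obtain C0 where C0: "\<And>z. \<bar>e z * vt z\<bar> \<le> C0" using bounded_compact_support[OF ev] by metis
  have "\<exists>L. L-lipschitz_on UNIV (f i j)" for i j using lipschitz_compact_support[OF f] by metis
  then obtain L where L: "\<And>i j. (L i j)-lipschitz_on UNIV (f i j)" by metis
  define C where "C = C0 + (\<Sum>i\<in>UNIV. \<Sum>j\<in>UNIV. L i j * norm (dir_x i) + Ch i j)"
  have bound: "\<bar>Q z\<bar> \<le> C" if "z \<in> \<Omega>" "good z" for z
  proof -
    have "\<bar>\<Sum>i\<in>UNIV. \<Sum>j\<in>UNIV. (if z \<in> \<Omega> then g i j z else 0) - h i j z\<bar>
        \<le> (\<Sum>i\<in>UNIV. \<Sum>j\<in>UNIV. L i j * norm (dir_x i) + Ch i j)"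
    proof (intro order_trans[OF sum_abs] sum_mono)
      fix i j
      have "\<bar>g i j z\<bar> \<le> L i j * norm (dir_x i)" using L g[OF that] by (rule has_dderiv_le_lipschitz)
      thus "\<bar>(if z \<in> \<Omega> then g i j z else 0) - h i j z\<bar> \<le> L i j * norm (dir_x i) + Ch i j"
        using Ch[of i j z] that(1) by (simp add: abs_le_iff)
    qed
    thus ?thesis unfolding Q_def C_def using C0[of z] by linarith
  qed
  have eq: "AE z in lebesgue. (Q z)\<^sup>2 = rhs z"
    using AE_good
  proof eventually_elim
    case (elim z)
    show ?case
    proof (cases "z \<in> \<Omega>")
      case True
      thus ?thesis using elim QP rhs_eq by (simp add: power_mult_distrib)
    next
      case False
      hence "z \<notin> S" using S_\<Omega> by blast
      thus ?thesis using False Q0 by (simp add: rhs_def)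
    qed
  qed
  have "S \<in> lmeasurable" using S(1) by (rule lmeasurable_compact)
  hence "integrable lebesgue (indicat_real S)" by (auto simp: fmeasurable_def intro!: integrable_real_indicator)
  hence int: "integrable lebesgue (\<lambda>z. C\<^sup>2 * indicat_real S z)" by (rule integrable_mult_right)
  have Qi: "integrable lebesgue (\<lambda>z. (Q z)\<^sup>2)"
  proof (rule Bochner_Integration.integrable_bound[OF int])
    show "(\<lambda>z. (Q z)\<^sup>2) \<in> borel_measurable lebesgue" using Qm by simp
    show "AE z in lebesgue. norm ((Q z)\<^sup>2) \<le> norm (C\<^sup>2 * indicat_real S z)"
      using AE_good
    proof eventually_elim
      case (elim z)
      show ?case
      proof (cases "z \<in> S")
        case True
        hence "\<bar>Q z\<bar> \<le> C" using elim S_\<Omega> bound by blast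
        hence "\<bar>Q z\<bar>\<^sup>2 \<le> C\<^sup>2" by (intro power_mono) auto
        thus ?thesis using True by simp
      next
        case False thus ?thesis using Q0 by simp
      qed
    qed
  qed
  have "rhs \<in> borel_measurable lebesgue"
    using borel_measurable_lebesgue_cong_AE[OF _ eq] Qm by simp
  from integrable_cong_AE_imp[OF Qi this eq] show ?thesis .
qed

lemma pointwise:
  assumes z: "z \<in> \<Omega>" and g: "good z"
  shows "lhs z + 2 * ((\<Sum>i\<in>UNIV. G i z) + G0 z) \<le> rhs z"
proof -
  have t: "0 < snd z" "snd z \<le> 1" using z by auto
  have sym: "a i j z = a j i z" for i j using z by (rule a_sym)
  have da: "\<bar>da k i j z\<bar> \<le> Ec * japanese_bracket (fst z) powr (- \<beta>)" for k i j using g by (simp add: good_def)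
  have adt: "\<bar>adt i j z\<bar> \<le> M" for i j using g by (simp add: good_def)
  have gam: "0 \<le> gam z" using pos t by (simp add: gam_def)
  have sc: "0 \<le> japanese_bracket (fst z) powr (\<alpha> - 1)" "0 \<le> japanese_bracket (fst z) powr (- \<beta>)" by simp_all
  have \<beta>': "\<alpha> - 1 \<le> \<beta>" by (simp add: \<beta>)
  have H: "H z = (\<Sum>i\<in>UNIV. V i z * wk i z)"
    by (simp add: H_def V_def sum_distrib_left sum_distrib_right mult_ac)
  have q: "q z = (\<Sum>k\<in>UNIV. Y k z * psi_x k z) - psi_t z"
    by (simp add: q_def Y_def sum_distrib_left sum_distrib_right mult_ac)
  have T: "T z = wt z - 2 * (\<Sum>k\<in>UNIV. Y k z * wk k z) - D / snd z * w z" by (simp add: T_def)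
  have pt: "psi_t z = - gam z * snd z + (b * phi z + K) / (2 * (snd z)\<^sup>2)" by (simp add: psi_t_def)
  note facts = t sym ww_sym a_ell[OF z] a_bound[OF z] da adt pos(1-5) b0 gam b sc
    scale_bounds[OF \<alpha> \<beta>'] weight_bounds[OF \<alpha> b0 t(1)] pt psi_tt_def w_def wt_def wk_def ww_def Y_def q
    dY_def dq_def dtq_def refl V_def H T dV_def dT_def dH_def dtH_def G_def G0_def
    D1[unfolded c1 c2 n] D2[unfolded c c1 n] K[unfolded c1 n]
  have "(e z)\<^sup>2 * ((v z)\<^sup>2 + (\<Sum>k\<in>UNIV. (vk k z)\<^sup>2)) + 2 * ((\<Sum>i\<in>UNIV. G i z) + G0 z) \<le> (e z)\<^sup>2 * (Pv z)\<^sup>2"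
    unfolding Pv_def
    by (rule pointwise_carleman[where t="snd z" and a="\<lambda>i j. a i j z" and da="\<lambda>k i j. da k i j z"
          and adt="\<lambda>i j. adt i j z" and lam=lam and \<Lambda>=\<Lambda> and M=M and Ec=Ec and b=b and K=K and D=D
          and \<phi>="phi z" and \<sigma>="japanese_bracket (fst z) powr (\<alpha> - 1)" and \<rho>="japanese_bracket (fst z) powr (- \<beta>)"
          and P="gam z" and p="\<lambda>k. psi_x k z" and pp="\<lambda>i j. psi_xx i j z" and pt="psi_t z" and ptt="psi_tt z"
          and w="w z" and wt="wt z" and wk="\<lambda>k. wk k z" and ww="\<lambda>i j. ww i j z" and Y="\<lambda>k. Y k z" and q="q z"
          and dY="\<lambda>i k. dY i k z" and dq="\<lambda>k. dq k z" and dtq="dtq z" and f="D / snd z" and V="\<lambda>i. V i z" and H="H z"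
          and T="T z" and dV="\<lambda>i. dV i z" and dT="\<lambda>i. dT i z" and wtk="\<lambda>i. wtk i z" and dH="\<lambda>i. dH i z" and dtH="dtH z"])
       (rule facts)+
  thus ?thesis unfolding lhs_eq rhs_eq[OF z g] .
qed

text \<open>Adding twice the flux, whose integral is 0, does not change the left integral and
  reduces the claim to the inequality at good points.\<close>

theorem carleman_estimate:
  "(LINT z:\<Omega>|lebesgue. carleman_weight \<alpha> b K \<gamma> z * (\<bar>v z\<bar>\<^sup>2 + (norm (grad_x v z))\<^sup>2))
    \<le> (LINT z:\<Omega>|lebesgue. carleman_weight \<alpha> b K \<gamma> z * \<bar>parabolic_op A v z\<bar>\<^sup>2)"
proof -
  define flux where "flux z = (\<Sum>i\<in>UNIV. if z \<in> \<Omega> then G i z else 0) + (if z \<in> \<Omega> then G0 z else 0)" for z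
  have "has_bochner_integral lebesgue flux ((\<Sum>i\<in>(UNIV :: 'n set). 0) + 0)"
    unfolding flux_def[abs_def]
    by (intro has_bochner_integral_add has_bochner_integral_sum has_bochner_integral_flux[OF lip_F(1) _ dF(1)]
        has_bochner_integral_flux[OF lip_F(2) _ dF(2)] zero_outside)
  hence flux: "integrable lebesgue flux" "integral\<^sup>L lebesgue flux = 0"
    by (simp_all add: has_bochner_integral_iff)
  have "integral\<^sup>L lebesgue lhs = (\<integral>z. lhs z + 2 * flux z \<partial>lebesgue)"
    using flux integrable_lhs by simp
  also have "\<dots> \<le> integral\<^sup>L lebesgue rhs"
  proof (rule integral_mono_AE)
    show "AE z in lebesgue. lhs z + 2 * flux z \<le> rhs z"
      using AE_good
    proof eventually_elim
      case (elim z)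
      show ?case
      proof (cases "z \<in> \<Omega>")
        case True thus ?thesis using elim pointwise by (simp add: flux_def)
      next
        case False
        hence "z \<notin> S" using S_\<Omega> by blast
        thus ?thesis using False by (simp add: flux_def lhs_def rhs_def zero_outside)
      qed
    qed
  qed (use flux integrable_lhs integrable_rhs in auto)
  finally show ?thesis
    unfolding set_lebesgue_integral_def lhs_set_integrand rhs_def .
qed

end

lemma compact_in_convex_compact:
  fixes S :: "('a::euclidean_space \<times> real) set"
  assumes S: "compact S" "S \<subseteq> UNIV \<times> {0<..<1}"
  obtains B where "compact B" "convex B" "B \<subseteq> UNIV \<times> {0<..<1}" "S \<subseteq> interior B"
proof -
  obtain l u where lu: "0 < l" "u < 1" "\<And>z. z \<in> S \<Longrightarrow> l < snd z \<and> snd z < u"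
  proof (cases "S = {}")
    case True thus ?thesis using that[of "1/2" "1/2"] by simp
  next
    case False
    have "compact (snd ` S)" using S(1) by (intro compact_continuous_image continuous_intros)
    then obtain l u where "l \<in> snd ` S" "u \<in> snd ` S" "\<And>t. t \<in> snd ` S \<Longrightarrow> l \<le> t \<and> t \<le> u"
      using compact_attains_inf[of "snd ` S"] compact_attains_sup[of "snd ` S"] False
      by (metis image_is_empty)
    moreover from this have "0 < l" "u < 1" using S(2) by auto
    \<comment> \<open>Moving each end halfway towards 0 or 1 keeps the interval inside
      \<open>(0, 1)\<close> and makes the inclusion of the support strict.\<close>
    ultimately show ?thesis using that[of "l / 2" "(1 + u) / 2"] by fastforce
  qed
  obtain R where R: "\<And>z. z \<in> S \<Longrightarrow> norm (fst z) < R"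
  proof -
    have "compact (fst ` S)" using S(1) by (intro compact_continuous_image continuous_intros)
    then obtain R where "\<forall>x\<in>fst ` S. norm x \<le> R" using compact_imp_bounded bounded_iff by blast
    thus ?thesis using that[of "R + 1"] by force
  qed
  show ?thesis
  proof (rule that[of "cball 0 R \<times> {l..u}"])
    show "compact (cball (0::'a) R \<times> {l..u})" by (intro compact_Times) auto
    show "convex (cball (0::'a) R \<times> {l..u})" by (intro convex_Times) auto
    show "cball (0::'a) R \<times> {l..u} \<subseteq> UNIV \<times> {0<..<1}" using lu(1,2) by auto
    show "S \<subseteq> interior (cball 0 R \<times> {l..u})"
    proof
      fix z assume "z \<in> S"
      thus "z \<in> interior (cball 0 R \<times> {l..u})"
        using R[of z] lu(3)[of z] by (cases z) (auto simp: interior_Times)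
    qed
  qed
qed

theorem proposition1p3:
  fixes \<alpha> \<beta> b lam \<Lambda> M E :: real
  assumes "0 \<le> \<alpha>" and "\<alpha> \<le> 2"
    and "\<beta> = max 0 (\<alpha> - 1)"
    and "0 < lam" and "lam \<le> \<Lambda>"
    and "0 < M" and "0 < E"
    and "b = 1 / (8 * \<Lambda>)"
  shows "\<exists>K>0. \<forall>A :: (real ^ 'n) \<times> real \<Rightarrow> real ^ 'n ^ 'n.
    (\<forall>z \<in> UNIV \<times> {0..1}. transpose (A z) = A z) \<longrightarrow>
    (\<forall>z \<in> UNIV \<times> {0..1}. \<forall>\<xi> :: real ^ 'n.
        lam * (norm \<xi>)\<^sup>2 \<le> (\<Sum>i\<in>UNIV. \<Sum>j\<in>UNIV. A z $ i $ j * \<xi> $ i * \<xi> $ j) \<and>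
        (\<Sum>i\<in>UNIV. \<Sum>j\<in>UNIV. A z $ i $ j * \<xi> $ i * \<xi> $ j) \<le> \<Lambda> * (norm \<xi>)\<^sup>2) \<longrightarrow>
    (\<forall>i j. \<exists>L. L-lipschitz_on (UNIV \<times> {0..1}) (\<lambda>z. A z $ i $ j)) \<longrightarrow>
    (\<forall>i j. AE z in lebesgue. z \<in> UNIV \<times> {0..1} \<longrightarrow>
        norm (grad_x (\<lambda>w. A w $ i $ j) z) + \<bar>partial_t (\<lambda>w. A w $ i $ j) z\<bar> \<le> M) \<longrightarrow>
    (\<forall>i j. AE z in lebesgue. z \<in> UNIV \<times> {0..1} \<longrightarrow>
        norm (grad_x (\<lambda>w. A w $ i $ j) z) \<le> E * japanese_bracket (fst z) powr (- \<beta>)) \<longrightarrow>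
    (\<forall>v. test_function (UNIV \<times> {0<..<1}) v \<longrightarrow>
      (\<forall>\<gamma>>0.
        (LINT z:UNIV \<times> {0<..<1}|lebesgue.
            carleman_weight \<alpha> b K \<gamma> z * (\<bar>v z\<bar>\<^sup>2 + (norm (grad_x v z))\<^sup>2))
        \<le> (LINT z:UNIV \<times> {0<..<1}|lebesgue.
            carleman_weight \<alpha> b K \<gamma> z * \<bar>parabolic_op A v z\<bar>\<^sup>2)))"
proof -
  define n where "n = real CARD('n)"
  define c1 where "c1 = n * (E * b + 2 * \<Lambda> * b)"
  define c2 where "c2 = n * \<Lambda> * b * E"
  define c where "c = n ^ 4 * \<Lambda> * E * b\<^sup>2 + 4 * n ^ 4 * \<Lambda>\<^sup>2 * b\<^sup>2 + n\<^sup>2 * M * b"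
  \<comment> \<open>\<open>d1\<close> and \<open>d2\<close> are the thresholds for
    \<open>D - n * c1\<close> at which the gradient terms and the zero order terms close.\<close>
  define d1 where "d1 = (1 + n\<^sup>2 * M / 2 + 2 * n ^ 3 * \<Lambda> * c1 + n ^ 3 * c2) / lam"
  define d2 where "d2 = 8 / 3 * (1 + b + 1/2 + c)"
  define D where "D = n * c1 + max d1 d2"
  define K where "K = max (2 * (D + n * c1)) ((D + n * c1)\<^sup>2 + 1)"
  have lam: "0 < lam" and \<Lambda>: "0 < \<Lambda>" using assms by auto
  have K: "2 * (D + n * c1) \<le> K" "(D + n * c1)\<^sup>2 + 1 \<le> K" by (simp_all add: K_def)
  have "0 < (D + n * c1)\<^sup>2 + 1" by (simp add: add_nonneg_pos)
  hence K0: "0 < K" using K(2) by linarith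
  have "lam * d1 \<le> lam * (D - n * c1)" using lam by (intro mult_left_mono) (auto simp: D_def)
  hence D1: "1 + n\<^sup>2 * M / 2 + 2 * n ^ 3 * \<Lambda> * c1 + n ^ 3 * c2 \<le> lam * (D - n * c1)"
    using lam by (simp add: d1_def)
  have "d2 \<le> D - n * c1" by (simp add: D_def)
  hence D2: "1 + b + 1/2 + c \<le> 3 / 8 * (D - n * c1)" by (simp add: d2_def)
  show ?thesis
  \<comment> \<open>\<open>K\<close> is fixed before \<open>A\<close>, \<open>v\<close> and \<gamma>
    are introduced, and is built from \<open>n\<close>, \<Lambda>, \<open>lam\<close>,
    \<open>M\<close> and \<open>E\<close> alone, as \<open>b\<close> depends on \<Lambda>.\<close>
  proof (intro exI[of _ K] conjI allI impI K0, goal_cases)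
    case (1 A v \<gamma>)
    define S where "S = closure {z. v z \<noteq> 0}"
    have v: "\<And>k. Ck k v" and S: "compact S" "S \<subseteq> UNIV \<times> {0<..<1}"
      using 1(6) by (auto simp: test_function_def S_def)
    have v0: "v z = 0" if "z \<notin> S" for z
      using that closure_subset[of "{z. v z \<noteq> 0}"] by (auto simp: S_def)
    obtain B where B: "compact B" "convex B" "B \<subseteq> UNIV \<times> {0<..<1}" "S \<subseteq> interior B"
      using compact_in_convex_compact[OF S] by blast
    interpret carleman_setting \<alpha> b K \<gamma> \<beta> lam \<Lambda> M E D n c1 c2 c A v B S
      by unfold_locales (fact assms lam \<Lambda> K0 K D1 D2 n_def c1_def c2_def c_def v v0 S B 1)+
    show ?case by (rule carleman_estimate)
  qed
qed

end
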